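(* For $\rho>2$ and $u\in H^1(B(0,\rho))\cap L^\infty(B(0,\rho))$, let $$H(u):=\int_{B(0,\rho)}\Big((a(x)\nabla u)\cdot\nabla u+b(x)W(u)+G(x,u)\Big)dx,$$ where $W(u)=-\int_0^uf(s)\,ds$ is as in the context, $a(x)$ is a symmetric $n\times n$ matrix, $a\in W^{1,\infty}(B(0,\rho);\mathbb R^{n\times n})$, $b\in L^\infty(B(0,\rho))$, $G(x,u)$ is a Carathéodory function, and $a$ and $b$ satisfy $$\lambda\le b(x)\le\lambda^{-1}\quad\text{and}\quad\lambda|\xi|^2\le(a(x)\xi)\cdot\xi\le\lambda^{-1}|\xi|^2\qquad\forall x\in B(0,\rho),\ \forall\xi\in\mathbb R^n,$$ for some $\lambda>0$. Then there exists $r_0\in\mathbb N$ depending only on $n$, $W$, $\|a\|_{W^{1,\infty}(B(0,\rho);\mathbb R^{n\times n})}$ and $\lambda$ such that if $u$ is a minimizer of $H$ with prescribed boundary data on $\partial B(0,\rho)$, $\|u-\frac12\|_{L^\infty(B(0,\rho))}\le1$, $\alpha\in(0,r_0^{1-n})$, $R_0$ is an integer such that $r_0+1\le R_0<\rho$, and $\|G\|_{L^\infty(B(0,\rho)\times(-\frac12,\frac32))}\le\alpha R_0^{-1}$, then $$\frac1{|B(0,r_0)|}\int_{B(0,r_0)}u^2dx\ge\alpha\ \Rightarrow\ \frac1{|B(0,R)|}\int_{B(0,R)}u^2dx\ge\alpha,$$ $$\frac1{|B(0,r_0)|}\int_{B(0,r_0)}(1-u)^2dx\ge\alpha\ \Rightarrow\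 \frac1{|B(0,R)|}\int_{B(0,R)}(1-u)^2dx\ge\alpha,$$ for all integers $R\in[r_0,R_0]$.
   Context: $n\ge2$; $B(x,r)$ is the open ball in $\mathbb R^n$ of radius $r$ centered at $x$; $|\cdot|$ of a set is Lebesgue measure. The function $f$ satisfies: $f\in C^{1,\beta}_{loc}(\mathbb R)$ for some $\beta\in(0,1]$, $f(0)=f(1)=0$, $f'(0)<0$, $f'(1)<0$, and $W(u)=-\int_0^uf(s)\,ds$ satisfies $W(0)=W(1)=0$, $W(u)>0$ for all $u\neq0,1$, and $\liminf_{|u|\to\infty}W(u)>0$. *)

theory Defs
  imports "HOL-Analysis.Analysis" "HOL-Probability.Essential_Supremum"
begin

section \<open>Lebesgue and Sobolev spaces on a set\<close>

text \<open>Elements of these spaces are functions, not classes modulo null sets; values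
  outside the domain are irrelevant.\<close>

definition Linf_norm :: "'a measure \<Rightarrow> ('a \<Rightarrow> 'b::real_normed_vector) \<Rightarrow> ereal" where
  "Linf_norm M g = esssup M (\<lambda>x. ereal (norm (g x)))"

definition Linf :: "'a measure \<Rightarrow> ('a \<Rightarrow> 'b::real_normed_vector) set" where
  "Linf M = {g \<in> borel_measurable M. Linf_norm M g < \<infinity>}"

definition L2 :: "'a measure \<Rightarrow> ('a \<Rightarrow> real) set" where
  "L2 M = {g \<in> borel_measurable M. integrable M (\<lambda>x. (g x)\<^sup>2)}"

primrec Ck :: "nat \<Rightarrow> ('a::euclidean_space \<Rightarrow> real) \<Rightarrow> bool" where
  "Ck 0 \<phi> \<longleftrightarrow> continuous_on UNIV \<phi>"
| "Ck (Suc k) \<phi> \<longleftrightarrow> \<phi> differentiable_on UNIV \<and>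
     (\<forall>i\<in>Basis. Ck k (\<lambda>x. frechet_derivative \<phi> (at x) i))"

text \<open>The test functions $C_c^\infty(S)$, extended by zero to the whole space.\<close>

definition test_functions :: "'a::euclidean_space set \<Rightarrow> ('a \<Rightarrow> real) set" where
  "test_functions S = {\<phi>. (\<forall>k. Ck k \<phi>) \<and>
     compact (closure {x. \<phi> x \<noteq> 0}) \<and> closure {x. \<phi> x \<noteq> 0} \<subseteq> S}"

definition locally_integrable ::
    "'a::euclidean_space set \<Rightarrow> ('a \<Rightarrow> 'b::{banach, second_countable_topology}) \<Rightarrow> bool" where
  "locally_integrable S g \<longleftrightarrow> (\<forall>K. compact K \<and> K \<subseteq> S \<longrightarrow> integrable (lebesgue_on K) g)"

definition has_weak_pderiv ::
    "'a::euclidean_space set \<Rightarrow> 'a \<Rightarrow> ('a \<Rightarrow> 'b::{banach, second_countable_topology}) \<Rightarrow> ('a \<Rightarrow> 'b) \<Rightarrow> bool" where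
  "has_weak_pderiv S i u g \<longleftrightarrow> locally_integrable S u \<and> locally_integrable S g \<and>
     (\<forall>\<phi>\<in>test_functions S.
        (LINT x|lebesgue_on S. frechet_derivative \<phi> (at x) i *\<^sub>R u x) =
        - (LINT x|lebesgue_on S. \<phi> x *\<^sub>R g x))"

text \<open>A choice of representative: on an open set the weak derivative is unique up to null sets.\<close>

definition weak_pderiv ::
    "'a::euclidean_space set \<Rightarrow> 'a \<Rightarrow> ('a \<Rightarrow> 'b::{banach, second_countable_topology}) \<Rightarrow> 'a \<Rightarrow> 'b" where
  "weak_pderiv S i u = (SOME g. has_weak_pderiv S i u g)"

definition weak_grad :: "'a::euclidean_space set \<Rightarrow> ('a \<Rightarrow> real) \<Rightarrow> 'a \<Rightarrow> 'a" where
  "weak_grad S u x = (\<Sum>i\<in>Basis. weak_pderiv S i u x *\<^sub>R i)"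

definition H1 :: "'a::euclidean_space set \<Rightarrow> ('a \<Rightarrow> real) set" where
  "H1 S = {u \<in> L2 (lebesgue_on S).
     \<forall>i\<in>Basis. \<exists>g\<in>L2 (lebesgue_on S). has_weak_pderiv S i u g}"

definition H1_norm :: "'a::euclidean_space set \<Rightarrow> ('a \<Rightarrow> real) \<Rightarrow> real" where
  "H1_norm S u =
     sqrt (LINT x|lebesgue_on S. (u x)\<^sup>2 + (norm (weak_grad S u x))\<^sup>2)"

text \<open>$H^1_0(S)$, the closure of the test functions in $H^1(S)$.\<close>

definition H10 :: "'a::euclidean_space set \<Rightarrow> ('a \<Rightarrow> real) set" where
  "H10 S = {u \<in> H1 S. \<forall>\<epsilon>>0. \<exists>\<phi>\<in>test_functions S. H1_norm S (\<lambda>x. u x - \<phi> x) < \<epsilon>}"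

definition W1inf ::
    "'a::euclidean_space set \<Rightarrow> ('a \<Rightarrow> 'b::{banach, second_countable_topology}) set" where
  "W1inf S = {a \<in> Linf (lebesgue_on S).
     \<forall>i\<in>Basis. \<exists>g\<in>Linf (lebesgue_on S). has_weak_pderiv S i a g}"

definition W1inf_norm ::
    "'a::euclidean_space set \<Rightarrow> ('a \<Rightarrow> 'b::{banach, second_countable_topology}) \<Rightarrow> ereal" where
  "W1inf_norm S a = Linf_norm (lebesgue_on S) a +
     (\<Sum>i\<in>Basis. Linf_norm (lebesgue_on S) (weak_pderiv S i a))"

section \<open>The nonlinearity\<close>

definition C1_holder_loc :: "real \<Rightarrow> (real \<Rightarrow> real) \<Rightarrow> bool" where
  "C1_holder_loc \<beta> f \<longleftrightarrow> f differentiable_on UNIV \<and>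
     (\<forall>K. compact K \<longrightarrow>
        (\<exists>C. \<forall>x\<in>K. \<forall>y\<in>K. \<bar>deriv f x - deriv f y\<bar> \<le> C * \<bar>x - y\<bar> powr \<beta>))"

text \<open>The interval integral is oriented, as needed for negative \<open>u\<close>.\<close>

definition potential :: "(real \<Rightarrow> real) \<Rightarrow> real \<Rightarrow> real" where
  "potential f u = - (LBINT s=ereal 0..ereal u. f s)"

section \<open>The functional and its minimizers\<close>

definition caratheodory :: "'a::euclidean_space set \<Rightarrow> ('a \<Rightarrow> real \<Rightarrow> real) \<Rightarrow> bool" where
  "caratheodory S G \<longleftrightarrow> (\<forall>t. (\<lambda>x. G x t) \<in> borel_measurable (lebesgue_on S)) \<and>
     (AE x in lebesgue_on S. continuous_on UNIV (G x))"

definition energy_density ::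
    "(real^'n) set \<Rightarrow> (real^'n \<Rightarrow> real^'n^'n) \<Rightarrow> (real^'n \<Rightarrow> real) \<Rightarrow> (real \<Rightarrow> real) \<Rightarrow>
     (real^'n \<Rightarrow> real \<Rightarrow> real) \<Rightarrow> (real^'n \<Rightarrow> real) \<Rightarrow> real^'n \<Rightarrow> real" where
  "energy_density S a b W G u x =
     (a x *v weak_grad S u x) \<bullet> weak_grad S u x + b x * W (u x) + G x (u x)"

definition energy ::
    "(real^'n) set \<Rightarrow> (real^'n \<Rightarrow> real^'n^'n) \<Rightarrow> (real^'n \<Rightarrow> real) \<Rightarrow> (real \<Rightarrow> real) \<Rightarrow>
     (real^'n \<Rightarrow> real \<Rightarrow> real) \<Rightarrow> (real^'n \<Rightarrow> real) \<Rightarrow> real" where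
  "energy S a b W G u = (LINT x|lebesgue_on S. energy_density S a b W G u x)"

text \<open>A Carath\'eodory \<open>G\<close> may grow arbitrarily in its second argument, so the functional need
  not be finite on all of $H^1 \cap L^\infty$. Its domain has to be spelled out because the
  Bochner integral of a non-integrable function is 0.\<close>

definition energy_domain ::
    "(real^'n) set \<Rightarrow> (real^'n \<Rightarrow> real^'n^'n) \<Rightarrow> (real^'n \<Rightarrow> real) \<Rightarrow> (real \<Rightarrow> real) \<Rightarrow>
     (real^'n \<Rightarrow> real \<Rightarrow> real) \<Rightarrow> (real^'n \<Rightarrow> real) set" where
  "energy_domain S a b W G =
     {u \<in> H1 S \<inter> Linf (lebesgue_on S). integrable (lebesgue_on S) (energy_density S a b W G u)}"

text \<open>Minimizers with prescribed boundary data: competitors have the same trace, that is,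
  they differ from \<open>u\<close> by an element of $H^1_0(S)$.\<close>

definition is_minimizer ::
    "(real^'n) set \<Rightarrow> (real^'n \<Rightarrow> real^'n^'n) \<Rightarrow> (real^'n \<Rightarrow> real) \<Rightarrow> (real \<Rightarrow> real) \<Rightarrow>
     (real^'n \<Rightarrow> real \<Rightarrow> real) \<Rightarrow> (real^'n \<Rightarrow> real) \<Rightarrow> bool" where
  "is_minimizer S a b W G u \<longleftrightarrow> u \<in> energy_domain S a b W G \<and>
     (\<forall>v\<in>energy_domain S a b W G. (\<lambda>x. v x - u x) \<in> H10 S \<longrightarrow>
        energy S a b W G u \<le> energy S a b W G v)"

definition ball_average :: "real \<Rightarrow> (real^'n \<Rightarrow> real) \<Rightarrow> real" where
  "ball_average r g = (LINT x|lebesgue_on (ball 0 r). g x) / measure lebesgue (ball (0::real^'n) r)"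

end

theory Submission
  imports Defs "HOL-Probability.Probability_Measure"
begin

text \<open>
  Let \<open>z\<close> be \<open>u\<close> or \<open>1 - u\<close>. The claim follows by induction on the radius, once it is shown that
  the mean of \<open>z\<^sup>2\<close> cannot be at least \<open>\<alpha>\<close> on the ball of radius \<open>R\<close> and less than \<open>\<alpha>\<close> on the ball
  of radius \<open>R + 1\<close>, when \<open>R\<close> is large and \<open>\<alpha>\<close> is small. Since the dimension \<open>n\<close> is at least two,
  \<open>\<alpha>\<close> is less than \<open>1 / r0\<close>, so both requirements are met by choosing \<open>r0\<close> large.

  Suppose the mean drops. Then the shell between the two radii has mass at most of order
  \<open>\<alpha> R\<^sup>n / R\<close>. Comparing \<open>u\<close> with a competitor that is identically at the well inside
  the smaller ball (\<open>energy_comparison\<close>) shows that the gradient and potential energy of \<open>u\<close>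
  in the ball are at most of the same order; the bound on \<open>G\<close> makes its contribution
  of this order as well. The potential is comparable to \<open>z\<^sup>2\<close> away from the other well
  (\<open>quadratic_well\<close>), so for large \<open>R\<close> most of the mass, of order \<open>\<alpha> R\<^sup>n\<close>, comes from points
  where \<open>z\<close> exceeds \<open>3/4\<close>. On the other hand the set where \<open>z\<close> exceeds \<open>1/4\<close> has volume at most of
  order \<open>\<alpha> R\<^sup>n\<close>, a small fraction of the ball. An isoperimetric inequality
  (\<open>smooth_isoperimetric\<close>, \<open>sobolev_isoperimetric\<close>) then forces a transition between these levels
  that costs more than the energy available (\<open>mass_spread_estimate\<close>, \<open>mass_dichotomy\<close>).

  The analytic groundwork is mollification: it shows that a cut-off Sobolev function lies in the
  closure of the test functions (\<open>cutoff_mult_H10\<close>), so that the competitor has the right boundary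
  data; that weak derivatives are unique (\<open>weak_pderiv_AE\<close>), so that its energy
  can be computed; and that the isoperimetric inequality extends from smooth functions.
\<close>

section \<open>Smooth functions\<close>

definition smooth :: "('a::euclidean_space \<Rightarrow> real) \<Rightarrow> bool" where
  "smooth \<phi> \<longleftrightarrow> (\<forall>k. Ck k \<phi>)"

abbreviation pd :: "'a::euclidean_space \<Rightarrow> ('a \<Rightarrow> real) \<Rightarrow> 'a \<Rightarrow> real" where
  "pd i \<phi> x \<equiv> frechet_derivative \<phi> (at x) i"

lemma Ck_SucI:
  assumes "\<And>x. (\<phi> has_derivative \<phi>' x) (at x)" "\<And>i. i \<in> Basis \<Longrightarrow> Ck k (\<lambda>x. \<phi>' x i)"
  shows "Ck (Suc k) \<phi>"
proof -
  have "frechet_derivative \<phi> (at x) = \<phi>' x" for x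
    using frechet_derivative_at[OF assms(1)[of x]] by simp
  then show ?thesis
    using assms by (auto simp: differentiable_on_def differentiable_def)
qed

lemma Ck_Suc_has_derivative:
  "Ck (Suc k) \<phi> \<Longrightarrow> (\<phi> has_derivative frechet_derivative \<phi> (at x)) (at x)"
  by (auto simp: differentiable_on_def frechet_derivative_works)

lemma Ck_Suc_imp: "Ck (Suc k) \<phi> \<Longrightarrow> Ck k \<phi>"
proof (induction k arbitrary: \<phi>)
  case 0
  then show ?case
    using differentiable_imp_continuous_on by auto
qed auto

lemma Ck_imp_continuous: "Ck k \<phi> \<Longrightarrow> continuous_on UNIV \<phi>"
  by (cases k) (auto intro: differentiable_imp_continuous_on)

lemma Ck_const [simp]: "Ck k (\<lambda>x. c)"
proof (induction k arbitrary: c)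
  case (Suc k)
  show ?case by (rule Ck_SucI[where \<phi>'="\<lambda>_ _. 0"]) (auto intro!: derivative_eq_intros Suc)
qed auto

lemma Ck_add: "Ck k \<phi> \<Longrightarrow> Ck k \<psi> \<Longrightarrow> Ck k (\<lambda>x. \<phi> x + \<psi> x)"
proof (induction k arbitrary: \<phi> \<psi>)
  case (Suc k)
  show ?case
    by (rule Ck_SucI[OF has_derivative_add[OF Suc.prems[THEN Ck_Suc_has_derivative]]])
      (use Suc in auto)
qed (simp_all add: continuous_on_add continuous_on_mult)

lemma Ck_mult: "Ck k \<phi> \<Longrightarrow> Ck k \<psi> \<Longrightarrow> Ck k (\<lambda>x. \<phi> x * \<psi> x)"
proof (induction k arbitrary: \<phi> \<psi>)
  case (Suc k)
  show ?case
    by (rule Ck_SucI[OF has_derivative_mult[OF Suc.prems[THEN Ck_Suc_has_derivative]]])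
      (use Suc.prems in \<open>auto intro!: Ck_add Suc.IH Suc.prems[THEN Ck_Suc_imp]\<close>)
qed (simp_all add: continuous_on_add continuous_on_mult)

text \<open>The derivative of \<open>f (\<phi> x)\<close> in direction \<open>i\<close> is a product of a composition of the same kind, one
  order lower, with a partial derivative of \<open>\<phi>\<close>; this is why \<open>f\<close> varies in the induction.\<close>

lemma Ck_compose:
  fixes f :: "real \<Rightarrow> real"
  shows "Ck k f \<Longrightarrow> Ck k \<phi> \<Longrightarrow> Ck k (\<lambda>x. f (\<phi> x))"
proof (induction k arbitrary: f \<phi>)
  case 0
  then show ?case
    by (metis Ck.simps(1) continuous_on_compose2 subset_UNIV)
next
  case (Suc k)
  have lin: "frechet_derivative f (at y) h = h * frechet_derivative f (at y) 1" for y h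
    using linear_cmul[OF has_derivative_linear[OF Ck_Suc_has_derivative[OF Suc.prems(1)]], of y h 1]
    by simp
  have D: "((\<lambda>x. f (\<phi> x)) has_derivative
      (\<lambda>h. pd h \<phi> x * frechet_derivative f (at (\<phi> x)) 1)) (at x)" for x
    using has_derivative_compose[OF Ck_Suc_has_derivative[OF Suc.prems(2)]
        Ck_Suc_has_derivative[OF Suc.prems(1)], of x]
    by (subst (asm) lin)
  show ?case
  proof (rule Ck_SucI[OF D], rule Ck_mult)
    show "Ck k (pd i \<phi>)" if "i \<in> Basis" for i using that Suc.prems(2) by simp
    show "Ck k (\<lambda>x. pd 1 f (\<phi> x))"
      by (rule Suc.IH[OF _ Ck_Suc_imp[OF Suc.prems(2)]]) (use Suc.prems(1) in simp)
  qed
qed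

lemma Ck_linear:
  assumes "bounded_linear L" shows "Ck k L"
proof (cases k)
  case 0
  then show ?thesis using assms by (simp add: linear_continuous_on)
next
  case (Suc m)
  show ?thesis unfolding Suc
    by (rule Ck_SucI[OF bounded_linear.has_derivative[OF assms has_derivative_ident]]) auto
qed

lemma smooth_const [simp]: "smooth (\<lambda>x. c)" by (simp add: smooth_def)
lemma smooth_add: "smooth \<phi> \<Longrightarrow> smooth \<psi> \<Longrightarrow> smooth (\<lambda>x. \<phi> x + \<psi> x)"
  by (simp add: smooth_def Ck_add)
lemma smooth_mult: "smooth \<phi> \<Longrightarrow> smooth \<psi> \<Longrightarrow> smooth (\<lambda>x. \<phi> x * \<psi> x)"
  by (simp add: smooth_def Ck_mult)
lemma smooth_compose: "smooth f \<Longrightarrow> smooth \<phi> \<Longrightarrow> smooth (\<lambda>x. f (\<phi> x))" for f :: "real \<Rightarrow> real"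
  by (simp add: smooth_def Ck_compose)
lemma smooth_linear: "bounded_linear L \<Longrightarrow> smooth L"
  by (simp add: smooth_def Ck_linear)
lemma smooth_sum: "finite I \<Longrightarrow> (\<And>i. i \<in> I \<Longrightarrow> smooth (\<phi> i)) \<Longrightarrow> smooth (\<lambda>x. \<Sum>i\<in>I. \<phi> i x)"
  by (induction I rule: finite_induct) (auto intro: smooth_add)

lemma smooth_diff: "smooth \<phi> \<Longrightarrow> smooth \<psi> \<Longrightarrow> smooth (\<lambda>x. \<phi> x - \<psi> x)"
  using smooth_add[of \<phi> "\<lambda>x. (-1) * \<psi> x"] smooth_mult[of "\<lambda>x. -1" \<psi>] by simp

lemma smooth_norm_sq: "smooth (\<lambda>x::'a::euclidean_space. (norm x)\<^sup>2)"
proof -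
  have eq: "(norm x)\<^sup>2 = (\<Sum>i\<in>Basis. (x \<bullet> i) * (x \<bullet> i))" for x :: 'a
    unfolding power2_norm_eq_inner by (rule euclidean_inner)
  show ?thesis
    unfolding eq
    by (intro smooth_sum smooth_mult smooth_linear bounded_linear_inner_left finite_Basis)
qed

lemma smooth_has_derivative:
  assumes "smooth \<phi>" shows "(\<phi> has_derivative frechet_derivative \<phi> (at x)) (at x)"
  using assms Ck_Suc_has_derivative[of 0 \<phi>] unfolding smooth_def by blast

lemma smooth_pd: "smooth \<phi> \<Longrightarrow> i \<in> Basis \<Longrightarrow> smooth (pd i \<phi>)"
  unfolding smooth_def by (metis Ck.simps(2))

lemma smooth_continuous: "smooth \<phi> \<Longrightarrow> continuous_on S \<phi>"
  unfolding smooth_def by (meson Ck_imp_continuous continuous_on_subset subset_UNIV)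

lemma smooth_measurable: "smooth \<phi> \<Longrightarrow> \<phi> \<in> borel_measurable borel"
  by (rule borel_measurable_continuous_onI[OF smooth_continuous])

lemma smooth_DERIV:
  fixes f :: "real \<Rightarrow> real"
  assumes "smooth f" shows "(f has_real_derivative pd 1 f t) (at t)"
proof -
  have "frechet_derivative f (at t) h = pd 1 f t * h" for h
    using linear_cmul[OF has_derivative_linear[OF smooth_has_derivative[OF assms]], of t h 1]
    by (simp add: mult.commute)
  then show ?thesis
    using smooth_has_derivative[OF assms, of t] unfolding has_field_derivative_def
    by (metis (no_types, lifting) ext)
qed

lemma pd_mult:
  assumes "smooth \<phi>" "smooth \<psi>"
  shows "pd i (\<lambda>x. \<phi> x * \<psi> x) x = \<phi> x * pd i \<psi> x + pd i \<phi> x * \<psi> x"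
  using fun_cong[OF frechet_derivative_at[OF has_derivative_mult[OF assms[THEN smooth_has_derivative]]]]
  by (rule sym)

section \<open>A smooth step\<close>

text \<open>Allowing a polynomial factor in \<open>1 / t\<close> makes this family closed under
  differentiation, so that smoothness of the classical flat function is a plain induction.\<close>

definition flat :: "real poly \<Rightarrow> real \<Rightarrow> real" where
  "flat p t = (if t > 0 then poly p (1 / t) * exp (- (1 / t)) else 0)"

lemma poly_times_exp_tendsto: "((\<lambda>s::real. poly p s * exp (- s)) \<longlongrightarrow> 0) at_top"
proof -
  have "poly p s * exp (- s) = (\<Sum>i\<le>degree p. coeff p i * (s ^ i / exp s))" for s
    by (simp add: poly_altdef exp_minus sum_distrib_right sum_divide_distrib field_simps)
  moreover have "((\<lambda>s. \<Sum>i\<le>degree p. coeff p i * (s ^ i / exp s)) \<longlongrightarrow> (\<Sum>i\<le>degree p. coeff p i * 0)) at_top"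
    by (intro tendsto_intros tendsto_power_div_exp_0)
  ultimately show ?thesis by simp
qed

lemma flat_DERIV: "(flat p has_real_derivative flat ([:0, 0, 1:] * (p - pderiv p)) t) (at t)"
proof (cases t "0::real" rule: linorder_cases)
  case less
  have ev: "\<forall>\<^sub>F s in nhds t. flat p s = 0"
    using less by (intro eventually_mono[OF order_tendstoD(2)[OF filterlim_ident less]])
      (auto simp: flat_def)
  show ?thesis
    using less by (subst DERIV_cong_ev[OF refl ev refl]) (auto simp: flat_def)
next
  case greater
  have ev: "\<forall>\<^sub>F s in nhds t. flat p s = poly p (1 / s) * exp (- (1 / s))"
    using greater by (intro eventually_mono[OF order_tendstoD(1)[OF filterlim_ident greater]])
      (auto simp: flat_def)
  show ?thesis
    using greater
    by (subst DERIV_cong_ev[OF refl ev refl])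
      (auto intro!: derivative_eq_intros simp: flat_def field_simps power2_eq_square)
next
  case equal
  have "((\<lambda>s. flat p s / s) \<longlongrightarrow> 0) (at_right 0)"
  proof -
    have "((\<lambda>s. poly (pCons 0 p) (1 / s) * exp (- (1 / s))) \<longlongrightarrow> 0) (at_right (0::real))"
      using filterlim_compose[OF poly_times_exp_tendsto[of "pCons 0 p"] filterlim_inverse_at_top_right]
      by (simp add: field_simps)
    then show ?thesis
      by (rule Lim_transform_eventually)
        (auto simp: eventually_at_right_field flat_def intro!: exI[of _ 1])
  qed
  moreover have "((\<lambda>s. flat p s / s) \<longlongrightarrow> 0) (at_left 0)"
    by (rule Lim_transform_eventually[OF tendsto_const])
      (auto simp: eventually_at_left_field flat_def intro!: exI[of _ "-1"])
  ultimately have "((\<lambda>s. flat p s / s) \<longlongrightarrow> 0) (at 0)"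
    by (simp add: filterlim_split_at)
  then show ?thesis
    by (simp add: equal DERIV_def flat_def)
qed

lemma Ck_flat: "Ck k (flat p)"
proof (induction k arbitrary: p)
  case 0
  then show ?case
    using DERIV_continuous[OF flat_DERIV] by (simp add: continuous_at_imp_continuous_on)
next
  case (Suc k)
  show ?case
    by (rule Ck_SucI[OF flat_DERIV[unfolded has_field_derivative_def]]) (use Suc in \<open>auto intro: Ck_mult\<close>)
qed

definition flat1 :: "real \<Rightarrow> real" where
  "flat1 = flat 1"

lemma flat1_eq: "flat1 t = (if t > 0 then exp (- (1 / t)) else 0)"
  by (simp add: flat1_def flat_def)

lemma smooth_flat1: "smooth flat1"
  by (simp add: flat1_def smooth_def Ck_flat)

lemma flat1_mono: "s \<le> t \<Longrightarrow> flat1 s \<le> flat1 t"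
  by (auto simp: flat1_eq field_simps)

text \<open>A composition of two flat functions avoids the quotient in the usual construction of a smooth
  step: the inner one is at least its value at \<open>1\<close> when \<open>t \<le> 0\<close> and vanishes when \<open>t \<ge> 1\<close>.\<close>

definition step :: "real \<Rightarrow> real" where
  "step t = flat1 (exp (- 1) - flat1 (1 - t)) / flat1 (exp (- 1))"

lemma flat1_exp_pos: "flat1 (exp (- 1)) > 0"
  by (simp add: flat1_eq)

lemma smooth_step: "smooth step"
proof -
  have "smooth (\<lambda>t. flat1 (exp (- 1) - flat1 (1 - t)) * (1 / flat1 (exp (- 1))))"
    by (intro smooth_mult smooth_compose[OF smooth_flat1] smooth_diff smooth_const smooth_linear
        bounded_linear_ident)
  then show ?thesis by (simp add: step_def [abs_def])
qed

lemma step_0: "t \<le> 0 \<Longrightarrow> step t = 0"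
  using flat1_mono[of 1 "1 - t"] by (simp add: step_def flat1_eq[of "exp (-1) - _"] flat1_eq[of 1])

lemma step_1: "1 \<le> t \<Longrightarrow> step t = 1"
  using flat1_exp_pos by (simp add: step_def flat1_eq[of "1 - t"])

lemma step_range: "0 \<le> step t" "step t \<le> 1"
proof -
  show "0 \<le> step t" using flat1_exp_pos by (simp add: step_def flat1_eq[of "_ - _"])
  have "flat1 (exp (- 1) - flat1 (1 - t)) \<le> flat1 (exp (- 1))"
    by (rule flat1_mono) (simp add: flat1_eq)
  then show "step t \<le> 1" using flat1_exp_pos by (simp add: step_def)
qed

lemma step_deriv: "(step has_real_derivative deriv step t) (at t)"
  using smooth_DERIV[OF smooth_step, of t] DERIV_deriv_iff_real_differentiable real_differentiable_def
  by blast

lemma step_deriv_pd: "deriv step = pd 1 step"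
proof
  fix t show "deriv step t = pd 1 step t"
    using fun_cong[OF frechet_derivative_at[OF step_deriv[unfolded has_field_derivative_def]], of t 1]
    by simp
qed

lemma smooth_deriv_step: "smooth (deriv step)"
  unfolding step_deriv_pd by (intro smooth_pd smooth_step) simp

text \<open>At the two end points the step attains its minimum or maximum, so its derivative vanishes there as well.\<close>

lemma step_deriv_0: assumes "t \<le> 0 \<or> 1 \<le> t" shows "deriv step t = 0"
proof -
  from assms consider "t \<le> 0" | "1 \<le> t" by blast
  then show ?thesis
  proof cases
    case 1
    show ?thesis by (rule DERIV_local_min[OF step_deriv, of 1]) (use 1 step_0 step_range in auto)
  next
    case 2
    show ?thesis by (rule DERIV_local_max[OF step_deriv, of 1]) (use 2 step_1 step_range in auto)
  qed
qed

text \<open>Both the derivative and the second derivative are continuous with support in the unit interval.\<close>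

lemma deriv_step_bounds:
  obtains M where "M > 0" "\<And>t. \<bar>deriv step t\<bar> \<le> M" "\<And>s t. \<bar>deriv step s - deriv step t\<bar> \<le> M * \<bar>s - t\<bar>"
proof -
  have bd: "\<exists>M>0. \<forall>t. \<bar>g t\<bar> \<le> M" if "continuous_on UNIV g" "\<And>t. t \<notin> {0..1} \<Longrightarrow> g t = 0" for g :: "real \<Rightarrow> real"
  proof -
    have "bounded (g ` {0..1})"
      using that(1) by (meson compact_Icc compact_continuous_image compact_imp_bounded continuous_on_subset subset_UNIV)
    then obtain M where "M > 0" "\<And>t. t \<in> {0..1} \<Longrightarrow> \<bar>g t\<bar> \<le> M"
      unfolding bounded_pos by (auto simp del: atLeastAtMost_iff)
    then show ?thesis using that(2) by (metis abs_zero order.strict_iff_order)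
  qed
  have D: "(deriv step has_real_derivative pd 1 (deriv step) t) (at t)" for t
    using smooth_DERIV[OF smooth_deriv_step] .
  have z: "pd 1 (deriv step) t = 0" if "t \<notin> {0..1}" for t
  proof -
    have "\<forall>\<^sub>F s in nhds t. deriv step s = 0"
      using that eventually_nhds_in_open[of "- {0..1}" t]
      by (auto elim!: eventually_mono intro!: step_deriv_0 simp: open_Compl)
    then have "(deriv step has_real_derivative 0) (at t)"
      by (subst DERIV_cong_ev[OF refl _ refl]) auto
    then show ?thesis using D DERIV_unique by blast
  qed
  obtain M1 where M1: "M1 > 0" "\<And>t. \<bar>deriv step t\<bar> \<le> M1"
    using bd[of "deriv step", OF smooth_continuous[OF smooth_deriv_step]] step_deriv_0
    by (metis atLeastAtMost_iff linear)
  obtain M2 where M2: "M2 > 0" "\<And>t. \<bar>pd 1 (deriv step) t\<bar> \<le> M2"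
    using bd[of "pd 1 (deriv step)", OF smooth_continuous[OF smooth_pd[OF smooth_deriv_step]]] z
    by auto
  have L: "\<bar>deriv step s - deriv step t\<bar> \<le> M2 * \<bar>s - t\<bar>" for s t
    using field_differentiable_bound[of UNIV "deriv step" "pd 1 (deriv step)" M2 s t] D M2 by auto
  show ?thesis
    by (rule that[of "max M1 M2"])
      (use M1 M2 L in \<open>auto intro: order_trans mult_right_mono simp: le_max_iff_disj\<close>,
       meson L max.cobounded2 mult_right_mono abs_ge_zero order_trans)
qed

section \<open>Continuity of translations\<close>

lemma integrable_indicator_cball [simp]:
  "integrable lborel (indicat_real (cball (a::'a::euclidean_space) r))"
  by (intro integrable_real_indicator emeasure_lborel_cball_finite) auto

lemma integrable_dominated:
  fixes f g :: "'a \<Rightarrow> real"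
  assumes "integrable M f" "g \<in> borel_measurable M" "\<And>x. x \<in> space M \<Longrightarrow> \<bar>g x\<bar> \<le> f x"
  shows "integrable M g"
proof (rule Bochner_Integration.integrable_bound[OF assms(1,2)], rule AE_I2)
  fix x assume "x \<in> space M"
  then show "norm (g x) \<le> norm (f x)" using assms(3)[of x] by simp
qed

lemma lborel_distr_affine_unit:
  fixes t :: "'a::euclidean_space"
  assumes "\<bar>c\<bar> = 1" shows "distr lborel borel (\<lambda>x. t + c *\<^sub>R x) = lborel"
  using lborel_affine[of c t] assms by (cases "c = 0") (auto simp: density_1)

lemma nn_integral_lborel_translate:
  fixes t :: "'a::euclidean_space"
  assumes [measurable]: "f \<in> borel_measurable borel"
  shows "(\<integral>\<^sup>+x. f (x + t) \<partial>lborel) = (\<integral>\<^sup>+x. f x \<partial>lborel)"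
proof -
  have "(\<integral>\<^sup>+x. f x \<partial>lborel) = (\<integral>\<^sup>+x. f x \<partial>distr lborel borel (\<lambda>x. t + 1 *\<^sub>R x))"
    by (subst lborel_distr_affine_unit) auto
  also have "\<dots> = (\<integral>\<^sup>+x. f (x + t) \<partial>lborel)"
    by (subst nn_integral_distr) (auto simp: add.commute)
  finally show ?thesis ..
qed

lemma integral_lborel_reflect:
  fixes t :: "'a::euclidean_space" and f :: "'a \<Rightarrow> real"
  assumes [measurable]: "f \<in> borel_measurable borel"
  shows "(LINT x|lborel. f (t - x)) = (LINT x|lborel. f x)"
proof -
  have "(LINT x|lborel. f x) = (LINT x|distr lborel borel (\<lambda>x. t + (-1) *\<^sub>R x). f x)"
    by (subst lborel_distr_affine_unit) auto
  also have "\<dots> = (LINT x|lborel. f (t - x))"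
    by (subst integral_distr) auto
  finally show ?thesis ..
qed

lemma integrable_lborel_reflect:
  fixes t :: "'a::euclidean_space" and f :: "'a \<Rightarrow> real"
  assumes "integrable lborel f"
  shows "integrable lborel (\<lambda>x. f (t - x))"
proof -
  have [measurable]: "f \<in> borel_measurable borel" using assms by auto
  have "integrable (distr lborel borel (\<lambda>x. t + (-1) *\<^sub>R x)) f"
    by (subst lborel_distr_affine_unit) (use assms in auto)
  then show ?thesis by (subst (asm) integrable_distr_eq) auto
qed

lemma integrable_lborel_translate:
  fixes t :: "'a::euclidean_space" and f :: "'a \<Rightarrow> real"
  assumes "integrable lborel f"
  shows "integrable lborel (\<lambda>x. f (x + t))"
proof -
  have [measurable]: "f \<in> borel_measurable borel" using assms by auto
  have "integrable (distr lborel borel (\<lambda>x. t + 1 *\<^sub>R x)) f"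
    by (subst lborel_distr_affine_unit) (use assms in auto)
  then show ?thesis by (subst (asm) integrable_distr_eq) (auto simp: add.commute)
qed

lemma integral_lborel_translate:
  fixes t :: "'a::euclidean_space" and f :: "'a \<Rightarrow> real"
  assumes [measurable]: "f \<in> borel_measurable borel"
  shows "(LINT x|lborel. f (x + t)) = (LINT x|lborel. f x)"
proof -
  have "(LINT x|lborel. f x) = (LINT x|distr lborel borel (\<lambda>x. t + 1 *\<^sub>R x). f x)"
    by (subst lborel_distr_affine_unit) auto
  also have "\<dots> = (LINT x|lborel. f (x + t))"
    by (subst integral_distr) (auto simp: add.commute)
  finally show ?thesis ..
qed

lemma abs_add_power_le: "\<bar>a + b\<bar> ^ p \<le> 2 ^ p * (\<bar>a\<bar> ^ p + \<bar>b\<bar> ^ p)" for a b :: real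
proof -
  have "\<bar>a + b\<bar> ^ p \<le> (2 * max \<bar>a\<bar> \<bar>b\<bar>) ^ p" by (intro power_mono) auto
  also have "\<dots> = 2 ^ p * (max \<bar>a\<bar> \<bar>b\<bar>) ^ p" by (simp add: power_mult_distrib)
  also have "(max \<bar>a\<bar> \<bar>b\<bar>) ^ p \<le> \<bar>a\<bar> ^ p + \<bar>b\<bar> ^ p" by (auto simp: max_def)
  finally show ?thesis by simp
qed

lemma integrable_abs_power_add:
  fixes f g :: "'a \<Rightarrow> real"
  assumes [measurable]: "f \<in> borel_measurable M" "g \<in> borel_measurable M"
    and "integrable M (\<lambda>x. \<bar>f x\<bar> ^ p)" "integrable M (\<lambda>x. \<bar>g x\<bar> ^ p)"
  shows "integrable M (\<lambda>x. \<bar>f x + g x\<bar> ^ p)"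
  by (rule Bochner_Integration.integrable_bound[where f="\<lambda>x. 2 ^ p * (\<bar>f x\<bar> ^ p + \<bar>g x\<bar> ^ p)"])
    (use assms abs_add_power_le in \<open>auto\<close>)

text \<open>A measurable function is an almost everywhere limit of continuous ones. To turn this into
  convergence in the mean, truncate first in height and in space, and apply the same truncation to
  the continuous approximants; dominated convergence then applies twice.\<close>

lemma Lp_approx_continuous:
  fixes k :: "'a::euclidean_space \<Rightarrow> real"
  assumes k [measurable]: "k \<in> borel_measurable borel" and ik: "integrable lborel (\<lambda>x. \<bar>k x\<bar> ^ p)"
    and p: "p \<ge> 1" and e: "e > 0"
  obtains h m where "continuous_on UNIV h" "\<And>x. norm x \<ge> m \<Longrightarrow> h x = 0"
    "integrable lborel (\<lambda>x. \<bar>k x - h x\<bar> ^ p)" "(LINT x|lborel. \<bar>k x - h x\<bar> ^ p) < e"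
proof -
  have [simp]: "0 ^ p = (0::real)" using p by simp
  define clip where "clip m t = max (- m) (min m t)" for m t :: real
  have clip: "\<bar>clip m t\<bar> \<le> \<bar>t\<bar>" "\<bar>clip m t\<bar> \<le> m" if "m \<ge> 0" for m t using that by (auto simp: clip_def)
  have clip_lip: "\<bar>clip m s - clip m t\<bar> \<le> \<bar>s - t\<bar>" for m s t by (auto simp: clip_def)
  have [measurable]: "clip m \<in> borel_measurable borel" for m unfolding clip_def[abs_def] by measurable
  define cut where "cut m x = max 0 (min 1 (m + 1 - norm x))" for m :: real and x :: 'a
  have cut: "0 \<le> cut m x" "cut m x \<le> 1" "norm x \<le> m \<Longrightarrow> cut m x = 1" "norm x \<ge> m + 1 \<Longrightarrow> cut m x = 0" for m x
    by (auto simp: cut_def)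
  have cutc: "continuous_on UNIV (cut m)" for m unfolding cut_def by (intro continuous_intros)
  define km where "km m x = clip m (k x) * indicator (cball 0 m) x" for m and x :: 'a
  have km [measurable]: "km m \<in> borel_measurable borel" for m
    unfolding km_def by (intro borel_measurable_times borel_measurable_indicator) auto
  have 1: "(\<lambda>n. LINT x|lborel. \<bar>k x - km (real n) x\<bar> ^ p) \<longlonglongrightarrow> (LINT x|(lborel::'a measure). 0)"
  proof (rule integral_dominated_convergence[where w="\<lambda>x. 2 ^ p * (\<bar>k x\<bar> ^ p + \<bar>k x\<bar> ^ p)"])
    show "AE x in lborel. (\<lambda>n. \<bar>k x - km (real n) x\<bar> ^ p) \<longlonglongrightarrow> 0"
    proof (rule AE_I2)
      fix x
      obtain N :: nat where N: "N \<ge> max (norm x) \<bar>k x\<bar>" using real_arch_simple by blast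
      have "\<forall>\<^sub>F n in sequentially. \<bar>k x - km (real n) x\<bar> ^ p = 0"
        using eventually_ge_at_top[of N]
      proof eventually_elim
        case (elim n)
        then have "real n \<ge> max (norm x) \<bar>k x\<bar>" using N by linarith
        then have "km n x = k x" by (auto simp: km_def clip_def indicator_def)
        then show ?case using p by simp
      qed
      then show "(\<lambda>n. \<bar>k x - km (real n) x\<bar> ^ p) \<longlonglongrightarrow> 0" by (rule tendsto_eventually)
    qed
    show "AE x in lborel. norm (\<bar>k x - km (real n) x\<bar> ^ p) \<le> 2 ^ p * (\<bar>k x\<bar> ^ p + \<bar>k x\<bar> ^ p)" for n
    proof (rule AE_I2)
      fix x
      have "\<bar>k x - km (real n) x\<bar> ^ p \<le> 2 ^ p * (\<bar>k x\<bar> ^ p + \<bar>- km (real n) x\<bar> ^ p)"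
        using abs_add_power_le[of "k x" "- km (real n) x" p] by simp
      also have "\<bar>- km (real n) x\<bar> ^ p \<le> \<bar>k x\<bar> ^ p"
        using clip(1)[of n "k x"] by (intro power_mono) (auto simp: km_def indicator_def)
      finally show "norm (\<bar>k x - km (real n) x\<bar> ^ p) \<le> 2 ^ p * (\<bar>k x\<bar> ^ p + \<bar>k x\<bar> ^ p)" by simp
    qed
  qed (use ik in auto)
  have "e / 2 ^ (p + 1) > 0" using e by simp
  then have "\<forall>\<^sub>F n in sequentially. (LINT x|lborel. \<bar>k x - km (real n) x\<bar> ^ p) < e / 2 ^ (p + 1)"
    using order_tendstoD(2)[OF 1] by simp
  then obtain n where n: "(LINT x|lborel. \<bar>k x - km (real n) x\<bar> ^ p) < e / 2 ^ (p + 1)"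
    by (meson eventually_sequentially order_refl)
  define m where "m = real n"
  have m0: "m \<ge> 0" by (simp add: m_def)
  have "km m measurable_on UNIV"
    by (rule lebesgue_measurable_imp_measurable_on_real) (auto intro!: measurable_completion)
  then obtain N g where N: "negligible N" and g: "\<And>n. continuous_on UNIV (g n)"
    and lim: "\<And>x. x \<notin> N \<Longrightarrow> (\<lambda>n. g n x) \<longlonglongrightarrow> km m x"
    unfolding measurable_on_def by auto
  define h where "h j x = clip m (g j x) * cut m x" for j x
  have hc: "continuous_on UNIV (h j)" for j
    unfolding h_def clip_def by (intro continuous_intros g cutc)
  then have [measurable]: "h j \<in> borel_measurable borel" for j by (rule borel_measurable_continuous_onI)
  have ball_int: "integrable lborel (\<lambda>x::'a. (2 * m) ^ p * indicator (cball 0 (m + 1)) x :: real)"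
    by (intro integrable_mult_right) simp
  have hb: "\<bar>km m x - h j x\<bar> ^ p \<le> (2 * m) ^ p * indicator (cball 0 (m + 1)) x" for j x
  proof -
    have "\<bar>km m x\<bar> \<le> m" using clip(2)[OF m0, of "k x"] m0 by (auto simp: km_def indicator_def)
    moreover have "\<bar>h j x\<bar> \<le> m * 1"
      unfolding h_def abs_mult using clip(2)[OF m0] cut(1,2)[of m x] m0 by (intro mult_mono) auto
    ultimately have "\<bar>km m x - h j x\<bar> ^ p \<le> (2 * m) ^ p" by (intro power_mono) auto
    moreover have "km m x - h j x = 0" if "x \<notin> cball 0 (m + 1)"
      using that cut(4)[where m=m and x=x] by (auto simp: km_def h_def indicator_def)
    ultimately show ?thesis using p by (auto simp: indicator_def)
  qed
  have 2: "(\<lambda>j. LINT x|lborel. \<bar>km m x - h j x\<bar> ^ p) \<longlonglongrightarrow> (LINT x|(lborel::'a measure). 0)"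
  proof (rule integral_dominated_convergence[OF _ _ ball_int])
    have "AE x in lebesgue. x \<notin> N" using N negligible_iff_null_sets AE_not_in by blast
    then have "AE x in lborel. x \<notin> N" by (simp add: AE_completion_iff)
    then show "AE x in lborel. (\<lambda>j. \<bar>km m x - h j x\<bar> ^ p) \<longlonglongrightarrow> 0"
    proof eventually_elim
      case (elim x)
      have "(\<lambda>j. h j x) \<longlonglongrightarrow> clip m (km m x) * cut m x"
        unfolding h_def clip_def by (intro tendsto_intros lim elim)
      moreover have "clip m (km m x) * cut m x = km m x"
        using cut(3)[where m=m and x=x] m0 by (auto simp: km_def indicator_def clip_def)
      ultimately have "(\<lambda>j. h j x) \<longlonglongrightarrow> km m x" by simp
      then have "(\<lambda>j. \<bar>km m x - h j x\<bar> ^ p) \<longlonglongrightarrow> \<bar>km m x - km m x\<bar> ^ p"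
        by (intro tendsto_intros)
      then show ?case using p by simp
    qed
  qed (use hb in auto)
  have "\<forall>\<^sub>F j in sequentially. (LINT x|lborel. \<bar>km m x - h j x\<bar> ^ p) < e / 2 ^ (p + 1)"
    using order_tendstoD(2)[OF 2, of "e / 2 ^ (p + 1)"] e by simp
  then obtain j where j: "(LINT x|lborel. \<bar>km m x - h j x\<bar> ^ p) < e / 2 ^ (p + 1)"
    by (meson eventually_sequentially order_refl)
  have i1: "integrable lborel (\<lambda>x. \<bar>km m x - h j x\<bar> ^ p)"
    by (rule integrable_dominated[OF ball_int]) (measurable, metis abs_idempotent power_abs hb)
  have i2': "integrable lborel (\<lambda>x. \<bar>- km m x\<bar> ^ p)"
  proof (rule Bochner_Integration.integrable_bound[OF ik])
    have "\<bar>km m x\<bar> ^ p \<le> \<bar>k x\<bar> ^ p" for x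
      using clip(1)[OF m0, of "k x"] by (intro power_mono) (auto simp: km_def indicator_def)
    then show "AE x in lborel. norm (\<bar>- km m x\<bar> ^ p) \<le> norm (\<bar>k x\<bar> ^ p)" by simp
  qed auto
  have i2: "integrable lborel (\<lambda>x. \<bar>k x - km m x\<bar> ^ p)"
    using integrable_abs_power_add[OF _ _ ik i2'] by simp
  have i: "integrable lborel (\<lambda>x. \<bar>k x - h j x\<bar> ^ p)"
    using integrable_abs_power_add[OF _ _ i2 i1] by simp
  have "(LINT x|lborel. \<bar>k x - h j x\<bar> ^ p)
      \<le> (LINT x|lborel. 2 ^ p * (\<bar>k x - km m x\<bar> ^ p + \<bar>km m x - h j x\<bar> ^ p))"
    using i i1 i2 by (intro integral_mono) (use abs_add_power_le[of "k x - km m x" "km m x - h j x" p for x] in auto)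
  also have "\<dots> = 2 ^ p * ((LINT x|lborel. \<bar>k x - km m x\<bar> ^ p) + (LINT x|lborel. \<bar>km m x - h j x\<bar> ^ p))"
    using i1 i2 by simp
  also have "\<dots> < 2 ^ p * (e / 2 ^ (p + 1) + e / 2 ^ (p + 1))"
    using n j by (intro mult_strict_left_mono add_strict_mono) (auto simp: m_def)
  also have "\<dots> = e" by (simp add: field_simps)
  finally show ?thesis
    by (intro that[OF hc[of j], of "m + 1"] i) (auto simp: h_def cut)
qed

text \<open>For a continuous function with compact support this is uniform continuity; the general case
  follows because a translation does not change the distance to the approximating function.\<close>

lemma Lp_translation_continuous:
  fixes k :: "'a::euclidean_space \<Rightarrow> real"
  assumes k [measurable]: "k \<in> borel_measurable borel" and ik: "integrable lborel (\<lambda>x. \<bar>k x\<bar> ^ p)"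
    and p: "p \<ge> 1" and e: "e > 0"
  obtains d where "d > 0" "\<And>t. norm t < d \<Longrightarrow> (\<integral>\<^sup>+x. ennreal (\<bar>k (x + t) - k x\<bar> ^ p) \<partial>lborel) \<le> ennreal e"
proof -
  have [simp]: "0 ^ p = (0::real)" using p by simp
  define e' where "e' = e / (4 * 4 ^ p)"
  have e': "e' > 0" using e by (simp add: e'_def)
  obtain h m where hc: "continuous_on UNIV h" and hm: "\<And>x. norm x \<ge> m \<Longrightarrow> h x = 0"
    and ih: "integrable lborel (\<lambda>x. \<bar>k x - h x\<bar> ^ p)" and he: "(LINT x|lborel. \<bar>k x - h x\<bar> ^ p) < e'"
    by (rule Lp_approx_continuous[OF k ik p e']) blast
  have [measurable]: "h \<in> borel_measurable borel" using hc by (rule borel_measurable_continuous_onI)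
  define v where "v = measure lborel (cball (0::'a) (m + 1))"
  have v: "v \<ge> 0" by (simp add: v_def)
  define w where "w = min 1 (2 * e' / (v + 1))"
  have w: "w > 0" "w \<le> 1" using e' v by (auto simp: w_def)
  have wv: "w ^ p * v \<le> 2 * e'"
  proof -
    have "w ^ p \<le> w" using w p by (metis power_decreasing power_one_right less_imp_le)
    also have "w \<le> 2 * e' / (v + 1)" by (simp add: w_def)
    finally have "w ^ p * v \<le> 2 * e' / (v + 1) * v" using v by (rule mult_right_mono)
    also have "\<dots> \<le> 2 * e'" using v e' by (simp add: field_simps)
    finally show ?thesis .
  qed
  have "uniformly_continuous_on (cball 0 (m + 2)) h"
    by (intro compact_uniformly_continuous continuous_on_subset[OF hc]) auto
  then obtain d where d: "d > 0"
    "\<And>x y. x \<in> cball 0 (m + 2) \<Longrightarrow> y \<in> cball 0 (m + 2) \<Longrightarrow> dist y x < d \<Longrightarrow> dist (h y) (h x) < w"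
    unfolding uniformly_continuous_on_def using w(1) by blast
  show ?thesis
  proof (rule that[of "min d 1"])
    fix t :: 'a assume t: "norm t < min d 1"
    have hb: "\<bar>h (x + t) - h x\<bar> ^ p \<le> w ^ p * indicator (cball 0 (m + 1)) x" for x
    proof (cases "norm x \<le> m + 1")
      case True
      have "norm (x + t) \<le> norm x + norm t" by (rule norm_triangle_ineq)
      then have "norm (x + t) \<le> m + 2" using True t by linarith
      then have "dist (h (x + t)) (h x) < w" using True t by (intro d(2)) (auto simp: mem_cball_0 dist_norm simp del: mem_cball)
      then have "\<bar>h (x + t) - h x\<bar> ^ p \<le> w ^ p" by (intro power_mono) (auto simp: dist_real_def)
      then show ?thesis using True by simp
    next
      case False
      have "norm x \<le> norm (x + t) + norm t" using norm_triangle_ineq4[of "x + t" t] by simp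
      then have "norm (x + t) \<ge> m" using False t by linarith
      then show ?thesis using hm[of x] hm[of "x + t"] False p by (simp add: indicator_def)
    qed
    have ii: "integrable lborel (\<lambda>x. \<bar>k (x + t) - h (x + t)\<bar> ^ p)"
      using integrable_lborel_translate[OF ih, of t] by simp
    have bi: "integrable lborel (\<lambda>x::'a. w ^ p * indicator (cball 0 (m + 1)) x :: real)"
      by (intro integrable_mult_right) simp
    define F where "F x = 4 ^ p * (\<bar>k (x + t) - h (x + t)\<bar> ^ p + w ^ p * indicator (cball 0 (m + 1)) x + \<bar>k x - h x\<bar> ^ p)" for x
    have four: "(4::real) ^ p = 2 ^ p * 2 ^ p" by (simp flip: power_mult_distrib)
    have le: "\<bar>k (x + t) - k x\<bar> ^ p \<le> F x" for x
    proof -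
      have "\<bar>k (x + t) - k x\<bar> ^ p \<le> 2 ^ p * (\<bar>k (x + t) - h (x + t)\<bar> ^ p + \<bar>(h (x + t) - h x) + (h x - k x)\<bar> ^ p)"
        using abs_add_power_le[of "k (x + t) - h (x + t)" "(h (x + t) - h x) + (h x - k x)" p] by simp
      also have "\<dots> \<le> 2 ^ p * (2 ^ p * \<bar>k (x + t) - h (x + t)\<bar> ^ p + 2 ^ p * (\<bar>h (x + t) - h x\<bar> ^ p + \<bar>h x - k x\<bar> ^ p))"
        by (intro mult_left_mono add_mono abs_add_power_le) (auto simp: mult_le_cancel_right1)
      also have "\<dots> = 4 ^ p * (\<bar>k (x + t) - h (x + t)\<bar> ^ p + \<bar>h (x + t) - h x\<bar> ^ p + \<bar>k x - h x\<bar> ^ p)"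
        unfolding four abs_minus_commute[of "h x" "k x"] by (simp only: distrib_left mult.assoc add.assoc)
      also have "\<dots> \<le> F x" unfolding F_def by (intro mult_left_mono add_mono hb) auto
      finally show ?thesis .
    qed
    have "(\<integral>\<^sup>+x. ennreal (\<bar>k (x + t) - k x\<bar> ^ p) \<partial>lborel) \<le> (\<integral>\<^sup>+x. ennreal (F x) \<partial>lborel)"
      by (intro nn_integral_mono ennreal_leI le)
    also have "\<dots> = ennreal (LINT x|lborel. F x)"
    proof (rule nn_integral_eq_integral)
      show "integrable lborel F" unfolding F_def using ii bi ih by auto
      show "AE x in lborel. 0 \<le> F x"
        unfolding F_def using w(1) by (intro AE_I2 mult_nonneg_nonneg add_nonneg_nonneg) auto
    qed
    also have "(LINT x|lborel. F x) = 4 ^ p * ((LINT x|lborel. \<bar>k (x + t) - h (x + t)\<bar> ^ p) + w ^ p * v + (LINT x|lborel. \<bar>k x - h x\<bar> ^ p))"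
      unfolding F_def using ii bi ih by (simp add: v_def)
    also have "\<dots> \<le> 4 ^ p * (e' + 2 * e' + e')"
      using integral_lborel_translate[of "\<lambda>x. \<bar>k x - h x\<bar> ^ p" t] he wv
      by (intro mult_left_mono add_mono) auto
    also have "\<dots> = e" by (simp add: e'_def)
    finally show "(\<integral>\<^sup>+x. ennreal (\<bar>k (x + t) - k x\<bar> ^ p) \<partial>lborel) \<le> ennreal e"
      by (simp add: ennreal_leI)
  qed (use d(1) in simp)
qed

section \<open>Mollification\<close>

definition smooth_compact :: "('a::euclidean_space \<Rightarrow> real) \<Rightarrow> bool" where
  "smooth_compact \<phi> \<longleftrightarrow> smooth \<phi> \<and> (\<exists>m. \<forall>x. m \<le> norm x \<longrightarrow> \<phi> x = 0)"

lemma smooth_compactD: "smooth_compact \<phi> \<Longrightarrow> smooth \<phi>"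
  by (simp add: smooth_compact_def)

lemma pd_eq_0_open:
  assumes "open U" "x \<in> U" "\<And>y. y \<in> U \<Longrightarrow> \<phi> y = 0"
  shows "frechet_derivative \<phi> (at x) i = 0"
proof -
  have "(\<phi> has_derivative (\<lambda>h. 0)) (at x)"
    by (rule has_derivative_transform_within_open[of "\<lambda>_. 0" _ _ _ U]) (use assms in auto)
  then show ?thesis using frechet_derivative_at by metis
qed

lemma smooth_compact_pd:
  assumes "smooth_compact \<phi>" "i \<in> Basis" shows "smooth_compact (pd i \<phi>)"
proof -
  obtain m where m: "\<And>x. m \<le> norm x \<Longrightarrow> \<phi> x = 0" using assms by (auto simp: smooth_compact_def)
  have "pd i \<phi> x = 0" if "m + 1 \<le> norm x" for x
    by (rule pd_eq_0_open[of "- cball 0 m"]) (use that m in auto)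
  then show ?thesis using assms smooth_pd unfolding smooth_compact_def by blast
qed

lemma smooth_compact_bounded:
  assumes "smooth_compact \<phi>" obtains B where "B > 0" "\<And>x. \<bar>\<phi> x\<bar> \<le> B"
proof -
  obtain m where m: "\<And>x. m \<le> norm x \<Longrightarrow> \<phi> x = 0" using assms by (auto simp: smooth_compact_def)
  have "bounded (\<phi> ` cball 0 m)"
    by (intro compact_imp_bounded compact_continuous_image smooth_continuous)
      (use assms in \<open>auto simp: smooth_compact_def\<close>)
  then obtain B where "B > 0" "\<And>x. x \<in> cball 0 m \<Longrightarrow> \<bar>\<phi> x\<bar> \<le> B"
    unfolding bounded_pos by (metis image_eqI real_norm_def)
  then have "B > 0" "\<And>x. \<bar>\<phi> x\<bar> \<le> B"
    using m by (auto simp: not_le) (metis abs_zero less_imp_le linear)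
  then show ?thesis by (rule that)
qed

lemma smooth_compact_measurable: "smooth_compact \<phi> \<Longrightarrow> \<phi> \<in> borel_measurable borel"
  by (simp add: smooth_compact_def smooth_measurable)

lemma smooth_compact_integrable_power:
  fixes \<phi> :: "'a::euclidean_space \<Rightarrow> real"
  assumes "smooth_compact \<phi>" "p \<ge> 1" shows "integrable lborel (\<lambda>x. \<bar>\<phi> x\<bar> ^ p)"
proof -
  obtain m where m: "\<And>x. m \<le> norm x \<Longrightarrow> \<phi> x = 0" using assms by (auto simp: smooth_compact_def)
  obtain B where B: "B > 0" "\<And>x. \<bar>\<phi> x\<bar> \<le> B" using smooth_compact_bounded[OF assms(1)] by blast
  have [measurable]: "\<phi> \<in> borel_measurable borel" by (rule smooth_compact_measurable[OF assms(1)])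
  have "\<bar>\<phi> x\<bar> ^ p \<le> B ^ p * indicator (cball 0 m) x" for x
    using m[of x] B(2)[of x] assms(2) by (auto simp: indicator_def zero_power intro: power_mono)
  then show ?thesis
    by (intro integrable_dominated[OF integrable_mult_right[OF integrable_indicator_cball]]) auto
qed

lemma smooth_compact_integrable:
  assumes "smooth_compact \<phi>" shows "integrable lborel \<phi>"
  using smooth_compact_integrable_power[OF assms, of 1] smooth_compact_measurable[OF assms]
  by (subst integrable_abs_iff [symmetric]) auto

lemma smooth_frechet_sum:
  assumes "smooth \<phi>" shows "frechet_derivative \<phi> (at x) h = (\<Sum>i\<in>Basis. (h \<bullet> i) * pd i \<phi> x)"
proof -
  have lin: "linear (frechet_derivative \<phi> (at x))"
    using has_derivative_linear[OF smooth_has_derivative[OF assms]] .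
  have "frechet_derivative \<phi> (at x) (\<Sum>i\<in>Basis. (h \<bullet> i) *\<^sub>R i) = (\<Sum>i\<in>Basis. (h \<bullet> i) * pd i \<phi> x)"
    by (simp add: linear_sum[OF lin] linear_cmul[OF lin])
  then show ?thesis by (simp add: euclidean_representation)
qed

lemma smooth_compact_lipschitz:
  fixes \<phi> :: "'a::euclidean_space \<Rightarrow> real"
  assumes "smooth_compact \<phi>"
  obtains L where "L > 0" "\<And>x y. \<bar>\<phi> x - \<phi> y\<bar> \<le> L * norm (x - y)"
proof -
  have "\<forall>i\<in>Basis. \<exists>B. 0 < B \<and> (\<forall>x. \<bar>pd i \<phi> x\<bar> \<le> B)"
  proof
    fix i :: 'a assume "i \<in> Basis"
    then show "\<exists>B. 0 < B \<and> (\<forall>x. \<bar>pd i \<phi> x\<bar> \<le> B)"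
      by (rule smooth_compact_bounded[OF smooth_compact_pd[OF assms]]) blast
  qed
  from bchoice[OF this] obtain B where
    B: "\<And>i x. i \<in> Basis \<Longrightarrow> 0 < B i" "\<And>i x. i \<in> Basis \<Longrightarrow> \<bar>pd i \<phi> x\<bar> \<le> B i" by blast
  define L where "L = (\<Sum>i\<in>Basis. B i)"
  have "L > 0" unfolding L_def by (intro sum_pos B) auto
  moreover have "norm (\<phi> x - \<phi> y) \<le> L * norm (x - y)" for x y
  proof (rule differentiable_bound[OF convex_UNIV, where f'="\<lambda>x. frechet_derivative \<phi> (at x)"])
    fix z
    show "(\<phi> has_derivative frechet_derivative \<phi> (at z)) (at z)"
      using assms by (auto simp: smooth_compact_def intro: smooth_has_derivative)
    show "onorm (frechet_derivative \<phi> (at z)) \<le> L"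
    proof (rule onorm_le)
      fix h
      have "norm (frechet_derivative \<phi> (at z) h) \<le> (\<Sum>i\<in>Basis. norm ((h \<bullet> i) * pd i \<phi> z))"
        unfolding smooth_frechet_sum[OF smooth_compactD[OF assms], of z h] by (rule norm_sum)
      also have "\<dots> \<le> (\<Sum>i\<in>Basis. norm h * B i)"
        using B Basis_le_norm by (intro sum_mono) (auto simp: abs_mult intro!: mult_mono)
      also have "\<dots> = L * norm h" by (simp add: L_def sum_distrib_left mult.commute)
      finally show "norm (frechet_derivative \<phi> (at z) h) \<le> L * norm h" .
    qed
  qed auto
  ultimately show ?thesis using that by auto
qed

text \<open>The first-order remainder is quadratic uniformly in the base point. This uniformity is what
  makes differentiation under the integral sign in a convolution immediate.\<close>

lemma smooth_compact_taylor:
  fixes \<phi> :: "'a::euclidean_space \<Rightarrow> real"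
  assumes "smooth_compact \<phi>"
  obtains C where "C > 0" "\<And>a b. \<bar>\<phi> b - \<phi> a - frechet_derivative \<phi> (at a) (b - a)\<bar> \<le> C * (norm (b - a))\<^sup>2"
proof -
  have "\<forall>i\<in>Basis. \<exists>L. 0 < L \<and> (\<forall>x y. \<bar>pd i \<phi> x - pd i \<phi> y\<bar> \<le> L * norm (x - y))"
  proof
    fix i :: 'a assume "i \<in> Basis"
    then show "\<exists>L. 0 < L \<and> (\<forall>x y. \<bar>pd i \<phi> x - pd i \<phi> y\<bar> \<le> L * norm (x - y))"
      by (rule smooth_compact_lipschitz[OF smooth_compact_pd[OF assms]]) blast
  qed
  from bchoice[OF this] obtain L where L: "\<And>i x. i \<in> Basis \<Longrightarrow> 0 < L i"
    "\<And>i x y. i \<in> Basis \<Longrightarrow> \<bar>pd i \<phi> x - pd i \<phi> y\<bar> \<le> L i * norm (x - y)" by blast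
  define C where "C = (\<Sum>i\<in>Basis. L i)"
  have C: "C > 0" unfolding C_def by (intro sum_pos L) auto
  have "\<bar>\<phi> b - \<phi> a - frechet_derivative \<phi> (at a) (b - a)\<bar> \<le> norm (b - a) * (C * norm (b - a))" for a b
    unfolding real_norm_def[symmetric]
  proof (rule differentiable_bound_linearization[where S="cball a (norm (b - a))" and f'="\<lambda>x. frechet_derivative \<phi> (at x)", unfolded fun_diff_def])
    fix t :: real assume "t \<in> {0..1}"
    then show "a + t *\<^sub>R (b - a) \<in> cball a (norm (b - a))"
      by (auto simp: dist_norm mult_left_le_one_le)
  next
    fix z
    show "(\<phi> has_derivative frechet_derivative \<phi> (at z)) (at z within cball a (norm (b - a)))"
      using assms by (auto simp: smooth_compact_def intro: has_derivative_at_withinI smooth_has_derivative)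
    assume z: "z \<in> cball a (norm (b - a))"
    show "onorm (\<lambda>h. frechet_derivative \<phi> (at z) h - frechet_derivative \<phi> (at a) h) \<le> C * norm (b - a)"
    proof (rule onorm_le)
      fix h
      have "norm (frechet_derivative \<phi> (at z) h - frechet_derivative \<phi> (at a) h)
          = norm (\<Sum>i\<in>Basis. (h \<bullet> i) * (pd i \<phi> z - pd i \<phi> a))"
        by (simp add: smooth_frechet_sum[OF smooth_compactD[OF assms], of _ h] sum_subtractf right_diff_distrib)
      also have "\<dots> \<le> (\<Sum>i\<in>Basis. norm ((h \<bullet> i) * (pd i \<phi> z - pd i \<phi> a)))" by (rule norm_sum)
      also have "\<dots> \<le> (\<Sum>i\<in>Basis. norm h * (L i * norm (b - a)))"
      proof (rule sum_mono)
        fix i :: 'a assume i: "i \<in> Basis"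
        have "L i * norm (z - a) \<le> L i * norm (b - a)"
          using z L(1)[OF i] by (intro mult_left_mono) (auto simp: dist_norm norm_minus_commute)
        then have "\<bar>pd i \<phi> z - pd i \<phi> a\<bar> \<le> L i * norm (b - a)" using L(2)[OF i, of z a] by linarith
        then show "norm ((h \<bullet> i) * (pd i \<phi> z - pd i \<phi> a)) \<le> norm h * (L i * norm (b - a))"
          unfolding real_norm_def abs_mult using Basis_le_norm[OF i] by (intro mult_mono) auto
      qed
      also have "\<dots> = C * norm (b - a) * norm h"
        by (simp add: C_def sum_distrib_left sum_distrib_right mult_ac)
      finally show "norm (frechet_derivative \<phi> (at z) h - frechet_derivative \<phi> (at a) h) \<le> C * norm (b - a) * norm h" .
    qed
  qed simp
  then show ?thesis by (intro that[OF C]) (simp add: power2_eq_square mult_ac)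
qed

definition mollify :: "('a::euclidean_space \<Rightarrow> real) \<Rightarrow> ('a \<Rightarrow> real) \<Rightarrow> 'a \<Rightarrow> real" where
  "mollify \<psi> k x = (LINT y|lborel. \<psi> (x - y) * k y)"

lemma integrable_bounded_mult:
  fixes k g :: "'a \<Rightarrow> real"
  assumes "integrable M k" "g \<in> borel_measurable M" "\<And>x. \<bar>g x\<bar> \<le> B"
  shows "integrable M (\<lambda>x. g x * k x)"
proof (rule integrable_dominated)
  show "integrable M (\<lambda>x. B * \<bar>k x\<bar>)" using assms(1) by auto
  show "(\<lambda>x. g x * k x) \<in> borel_measurable M" using assms by auto
  show "\<bar>g x * k x\<bar> \<le> B * \<bar>k x\<bar>" for x
    unfolding abs_mult using assms(3)[of x] by (intro mult_right_mono) auto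
qed

lemma smooth_compact_mult_integrable:
  fixes k :: "'a::euclidean_space \<Rightarrow> real"
  assumes "smooth_compact \<psi>" and k: "integrable lborel k"
  shows "integrable lborel (\<lambda>y. \<psi> (x - y) * k y)"
proof -
  obtain B where B: "B > 0" "\<And>x. \<bar>\<psi> x\<bar> \<le> B" using smooth_compact_bounded[OF assms(1)] by blast
  have [measurable]: "\<psi> \<in> borel_measurable borel" by (rule smooth_compact_measurable[OF assms(1)])
  show ?thesis by (rule integrable_bounded_mult[OF k _ B(2)]) measurable
qed

lemma diff_diff_eq_cancel: "z - y - (x - y) = z - (x::'a::ab_group_add)"
  by (simp add: algebra_simps)

lemma mollify_has_derivative:
  fixes k :: "'a::euclidean_space \<Rightarrow> real"
  assumes \<psi>: "smooth_compact \<psi>" and k: "integrable lborel k"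
  shows "(mollify \<psi> k has_derivative (\<lambda>h. \<Sum>i\<in>Basis. (h \<bullet> i) * mollify (pd i \<psi>) k x)) (at x)"
proof -
  let ?D = "\<lambda>h. \<Sum>i\<in>Basis. (h \<bullet> i) * mollify (pd i \<psi>) k x"
  obtain C where C: "C > 0" "\<And>a b. \<bar>\<psi> b - \<psi> a - frechet_derivative \<psi> (at a) (b - a)\<bar> \<le> C * (norm (b - a))\<^sup>2"
    using smooth_compact_taylor[OF \<psi>] by blast
  define K where "K = (LINT y|lborel. \<bar>k y\<bar>)"
  have lin: "bounded_linear ?D"
    by (intro bounded_linear_sum bounded_linear_mult_left bounded_linear_compose[OF bounded_linear_mult_left bounded_linear_inner_left])
  have est: "\<bar>mollify \<psi> k z - mollify \<psi> k x - ?D (z - x)\<bar> \<le> C * (norm (z - x))\<^sup>2 * K" for z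
  proof -
    have i1: "integrable lborel (\<lambda>y. \<psi> (w - y) * k y)" for w
      by (rule smooth_compact_mult_integrable[OF \<psi> k])
    have i2: "integrable lborel (\<lambda>y. pd i \<psi> (x - y) * k y)" if "i \<in> Basis" for i
      by (rule smooth_compact_mult_integrable[OF smooth_compact_pd[OF \<psi> that] k])
    have fd: "frechet_derivative \<psi> (at (x - y)) (z - x) * k y
        = (\<Sum>i\<in>Basis. ((z - x) \<bullet> i) * (pd i \<psi> (x - y) * k y))" for y
      unfolding smooth_frechet_sum[OF smooth_compactD[OF \<psi>], of "x - y" "z - x"]
      by (simp add: sum_distrib_right mult.assoc)
    have i3: "integrable lborel (\<lambda>y. frechet_derivative \<psi> (at (x - y)) (z - x) * k y)"
      unfolding fd using i2 by (intro Bochner_Integration.integrable_sum integrable_mult_right) auto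
    have D: "?D (z - x) = (LINT y|lborel. frechet_derivative \<psi> (at (x - y)) (z - x) * k y)"
      unfolding fd mollify_def using i2
      by (subst Bochner_Integration.integral_sum) auto
    have pw: "\<bar>\<psi> (z - y) * k y - \<psi> (x - y) * k y - frechet_derivative \<psi> (at (x - y)) (z - x) * k y\<bar> \<le> C * (norm (z - x))\<^sup>2 * \<bar>k y\<bar>" for y
    proof -
      have eq: "z - y - (x - y) = z - x" by (rule diff_diff_eq_cancel)
      have "\<bar>\<psi> (z - y) - \<psi> (x - y) - frechet_derivative \<psi> (at (x - y)) (z - x)\<bar> \<le> C * (norm (z - x))\<^sup>2"
        using C(2)[where b="z - y" and a="x - y"] unfolding eq .
      then show ?thesis
        unfolding left_diff_distrib[symmetric] abs_mult by (rule mult_right_mono) (rule abs_ge_zero)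
    qed
    have eq: "mollify \<psi> k z - mollify \<psi> k x - ?D (z - x)
        = (LINT y|lborel. \<psi> (z - y) * k y - \<psi> (x - y) * k y - frechet_derivative \<psi> (at (x - y)) (z - x) * k y)"
      unfolding D unfolding mollify_def using i1 i3 by simp
    have "\<bar>mollify \<psi> k z - mollify \<psi> k x - ?D (z - x)\<bar>
        \<le> (LINT y|lborel. \<bar>\<psi> (z - y) * k y - \<psi> (x - y) * k y - frechet_derivative \<psi> (at (x - y)) (z - x) * k y\<bar>)"
      unfolding eq by (rule integral_abs_bound)
    also have "\<dots> \<le> (LINT y|lborel. C * (norm (z - x))\<^sup>2 * \<bar>k y\<bar>)"
      by (rule integral_mono[OF integrable_abs[OF Bochner_Integration.integrable_diff[OF Bochner_Integration.integrable_diff[OF i1 i1] i3]] _ pw])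
        (use k in simp)
    also have "\<dots> = C * (norm (z - x))\<^sup>2 * K" by (simp add: K_def)
    finally show ?thesis .
  qed
  show ?thesis
  proof (rule has_derivativeI_sandwich[where e=1 and H="\<lambda>z. C * K * norm (z - x)"])
    fix z assume "z \<noteq> x" "dist z x < 1"
    have "norm (mollify \<psi> k z - mollify \<psi> k x - ?D (z - x)) / norm (z - x) \<le> C * (norm (z - x))\<^sup>2 * K / norm (z - x)"
      using est[of z] by (intro divide_right_mono) auto
    then show "norm (mollify \<psi> k z - mollify \<psi> k x - ?D (z - x)) / norm (z - x) \<le> C * K * norm (z - x)"
      using \<open>z \<noteq> x\<close> by (simp add: power2_eq_square mult_ac)
  next
    show "((\<lambda>z. C * K * norm (z - x)) \<longlongrightarrow> 0) (at x)"
      by (rule tendsto_eq_intros | simp)+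
  qed (use lin in auto)
qed

lemma mollify_pd:
  assumes "smooth_compact \<psi>" "integrable lborel k" "i \<in> Basis"
  shows "pd i (mollify \<psi> k) x = mollify (pd i \<psi>) k x"
proof -
  have "pd i (mollify \<psi> k) x = (\<Sum>j\<in>Basis. (i \<bullet> j) * mollify (pd j \<psi>) k x)"
    using fun_cong[OF frechet_derivative_at[OF mollify_has_derivative[OF assms(1,2)]], of i x] by simp
  also have "\<dots> = mollify (pd i \<psi>) k x"
    using assms(3) by (simp add: inner_Basis if_distrib[of "\<lambda>c. c * _"] cong: if_cong)
  finally show ?thesis .
qed

text \<open>Every derivative falls on the kernel, so the induction runs over all smooth kernels.\<close>

lemma smooth_mollify:
  assumes "smooth_compact \<psi>" "integrable lborel k"
  shows "smooth (mollify \<psi> k)"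
proof -
  have "Ck n (mollify \<psi> k)" for n
    using assms(1)
  proof (induction n arbitrary: \<psi>)
    case 0
    show ?case
      using has_derivative_continuous[OF mollify_has_derivative[OF 0 assms(2)]]
      by (simp add: continuous_at_imp_continuous_on)
  next
    case (Suc n)
    show ?case
    proof (rule Ck_SucI[OF mollify_has_derivative[OF Suc.prems assms(2)]])
      fix i :: 'a assume i: "i \<in> Basis"
      have "(\<lambda>x. \<Sum>j\<in>Basis. (i \<bullet> j) * mollify (pd j \<psi>) k x) = mollify (pd i \<psi>) k"
        using i by (auto simp: inner_Basis if_distrib[of "\<lambda>c. c * _"] cong: if_cong)
      then show "Ck n (\<lambda>x. \<Sum>j\<in>Basis. (i \<bullet> j) * mollify (pd j \<psi>) k x)"
        using Suc.IH[OF smooth_compact_pd[OF Suc.prems i]] by simp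
    qed
  qed
  then show ?thesis by (simp add: smooth_def)
qed

lemma mollify_eq_0:
  assumes "\<And>y. \<epsilon> \<le> norm y \<Longrightarrow> \<psi> y = 0" "\<And>y. dist x y < \<epsilon> \<Longrightarrow> k y = 0"
  shows "mollify \<psi> k x = 0"
proof -
  have "\<psi> (x - y) * k y = 0" for y
    using assms(1)[of "x - y"] assms(2)[of y] by (cases "dist x y < \<epsilon>") (auto simp: dist_norm)
  then have "(\<lambda>y. \<psi> (x - y) * k y) = (\<lambda>y. 0)" by blast
  then show ?thesis by (simp add: mollify_def)
qed

definition mollifier :: "real \<Rightarrow> ('a::euclidean_space \<Rightarrow> real) \<Rightarrow> bool" where
  "mollifier \<epsilon> \<psi> \<longleftrightarrow> smooth \<psi> \<and> (\<forall>x. 0 \<le> \<psi> x) \<and> (\<forall>x. \<epsilon> \<le> norm x \<longrightarrow> \<psi> x = 0) \<and> (LINT x|lborel. \<psi> x) = 1"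

lemma mollifier_smooth_compact: "mollifier \<epsilon> \<psi> \<Longrightarrow> smooth_compact \<psi>"
  by (auto simp: mollifier_def smooth_compact_def)

lemma mollifier_exists:
  assumes "\<epsilon> > 0" obtains \<psi> :: "'a::euclidean_space \<Rightarrow> real" where "mollifier \<epsilon> \<psi>"
proof -
  define g :: "'a \<Rightarrow> real" where "g x = flat1 (\<epsilon>\<^sup>2 - (norm x)\<^sup>2)" for x
  have sg: "smooth g"
    unfolding g_def by (rule smooth_compose[OF smooth_flat1]) (intro smooth_diff smooth_const smooth_norm_sq)
  have g0: "g x = 0" if "\<epsilon> \<le> norm x" for x
  proof -
    have "\<not> 0 < \<epsilon>\<^sup>2 - (norm x)\<^sup>2" using power_mono[OF that, of 2] assms by linarith
    then show ?thesis by (simp only: g_def flat1_eq if_False)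
  qed
  have gnn: "g x \<ge> 0" for x by (simp add: g_def flat1_eq)
  have sc: "smooth_compact g" using sg g0 by (auto simp: smooth_compact_def)
  have gm [measurable]: "g \<in> borel_measurable borel" by (rule smooth_measurable[OF sg])
  have pos: "g x > 0" if "x \<in> ball 0 \<epsilon>" for x
    using that power_strict_mono[of "norm x" \<epsilon> 2] by (simp add: g_def flat1_eq)
  define c where "c = (LINT x|lborel. g x)"
  have "c \<noteq> 0"
  proof
    assume "c = 0"
    then have "AE x in lborel. g x = 0"
      using integral_nonneg_eq_0_iff_AE[OF smooth_compact_integrable[OF sc]] gnn by (auto simp: c_def)
    then have "AE x in lborel. x \<notin> ball (0::'a) \<epsilon>" by (rule eventually_mono) (use pos in \<open>force simp del: mem_ball\<close>)
    then have "emeasure lborel (ball (0::'a) \<epsilon>) = 0"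
      by (subst (asm) AE_iff_measurable[of "ball 0 \<epsilon>"]) auto
    then have "measure lborel (ball (0::'a) \<epsilon>) = 0" by (simp add: measure_def)
    then show False using content_ball_pos[OF assms, of "0::'a"] by simp
  qed
  moreover have "c \<ge> 0" unfolding c_def by (rule integral_nonneg_AE) (use gnn in simp)
  ultimately have c: "c > 0" by simp
  have "mollifier \<epsilon> (\<lambda>x. inverse c * g x)"
    unfolding mollifier_def using c gnn g0 by (auto intro!: smooth_mult sg simp: c_def[symmetric])
  then show ?thesis by (rule that)
qed

text \<open>Stated with an extended-valued right-hand side, so that no integrability of the power is
  required beforehand; only the exponents one and two occur below.\<close>

lemma (in prob_space) jensen_abs_power:
  fixes X :: "'a \<Rightarrow> real"
  assumes X: "integrable M X" and p: "p \<in> {1, 2::nat}"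
  shows "ennreal (\<bar>LINT y|M. X y\<bar> ^ p) \<le> (\<integral>\<^sup>+y. ennreal (\<bar>X y\<bar> ^ p) \<partial>M)"
proof (cases "integrable M (\<lambda>y. \<bar>X y\<bar> ^ p)")
  case True
  have "\<bar>LINT y|M. X y\<bar> ^ p \<le> (LINT y|M. \<bar>X y\<bar> ^ p)"
  proof (cases "p = 1")
    case False
    then have p2: "p = 2" using p by simp
    show ?thesis
      using jensens_inequality[OF X, of UNIV _ _ "\<lambda>x. x\<^sup>2"] True convex_power_even[of 2] unfolding p2
      by simp
  qed simp
  also have "ennreal (LINT y|M. \<bar>X y\<bar> ^ p) = (\<integral>\<^sup>+y. ennreal (\<bar>X y\<bar> ^ p) \<partial>M)"
    by (rule nn_integral_eq_integral[OF True, symmetric]) auto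
  finally show ?thesis by (simp add: ennreal_leI)
next
  case False
  have [measurable]: "X \<in> borel_measurable M" using X by auto
  have "(\<integral>\<^sup>+y. ennreal (\<bar>X y\<bar> ^ p) \<partial>M) = \<infinity>"
    using False unfolding integrable_iff_bounded by (simp add: less_top[symmetric] power_abs)
  then show ?thesis by simp
qed

text \<open>The mollification error at \<open>x\<close> is the mean of \<open>k (x - y) - k x\<close> with respect to the probability
  measure with density \<open>\<psi>\<close>. Jensen and Fubini reduce it to the modulus of continuity of
  translations.\<close>

lemma mollify_Lp:
  fixes k :: "'a::euclidean_space \<Rightarrow> real"
  assumes \<psi>: "mollifier \<epsilon> \<psi>" and k: "integrable lborel k" and p: "p \<in> {1, 2}"
    and tr: "\<And>t. norm t < \<epsilon> \<Longrightarrow> (\<integral>\<^sup>+x. ennreal (\<bar>k (x + t) - k x\<bar> ^ p) \<partial>lborel) \<le> ennreal e"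
  shows "(\<integral>\<^sup>+x. ennreal (\<bar>mollify \<psi> k x - k x\<bar> ^ p) \<partial>lborel) \<le> ennreal e"
proof -
  have sc: "smooth_compact \<psi>" by (rule mollifier_smooth_compact[OF \<psi>])
  have [measurable]: "\<psi> \<in> borel_measurable borel" by (rule smooth_compact_measurable[OF sc])
  have [measurable]: "k \<in> borel_measurable borel" using k by auto
  have nn: "\<psi> y \<ge> 0" and supp: "\<epsilon> \<le> norm y \<Longrightarrow> \<psi> y = 0" and one: "(LINT x|lborel. \<psi> x) = 1" for y
    using \<psi> by (auto simp: mollifier_def)
  define M where "M = density lborel (\<lambda>y. ennreal (\<psi> y))"
  have nn1: "(\<integral>\<^sup>+y. ennreal (\<psi> y) \<partial>lborel) = 1"
    using nn_integral_eq_integral[OF smooth_compact_integrable[OF sc]] nn one by simp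
  interpret M: prob_space M
    by (rule prob_spaceI) (simp add: M_def emeasure_density nn1)
  have [measurable_cong, simp]: "sets M = sets borel" by (simp add: M_def)
  interpret pair_sigma_finite lborel M ..
  have iM: "integrable M (\<lambda>y. k (x - y))" for x
    unfolding M_def
    by (subst integrable_density) (use nn integrable_lborel_reflect[OF smooth_compact_mult_integrable[OF sc k, of x], of x] in auto)
  have mol: "mollify \<psi> k x - k x = (LINT y|M. k (x - y) - k x)" for x
  proof -
    have "mollify \<psi> k x = (LINT y|lborel. \<psi> (x - (x - y)) * k (x - y))"
      unfolding mollify_def by (rule integral_lborel_reflect[symmetric]) measurable
    also have "\<dots> = (LINT y|M. k (x - y))"
      unfolding M_def by (subst integral_density) (use nn in auto)
    finally show ?thesis using iM M.prob_space by simp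
  qed
  have "(\<integral>\<^sup>+x. ennreal (\<bar>mollify \<psi> k x - k x\<bar> ^ p) \<partial>lborel)
      \<le> (\<integral>\<^sup>+x. (\<integral>\<^sup>+y. ennreal (\<bar>k (x - y) - k x\<bar> ^ p) \<partial>M) \<partial>lborel)"
    unfolding mol using iM p by (intro nn_integral_mono M.jensen_abs_power) auto
  also have "\<dots> = (\<integral>\<^sup>+y. (\<integral>\<^sup>+x. ennreal (\<bar>k (x - y) - k x\<bar> ^ p) \<partial>lborel) \<partial>M)"
    by (rule Fubini'[symmetric]) measurable
  also have "\<dots> = (\<integral>\<^sup>+y. ennreal (\<psi> y) * (\<integral>\<^sup>+x. ennreal (\<bar>k (x - y) - k x\<bar> ^ p) \<partial>lborel) \<partial>lborel)"
    unfolding M_def by (rule nn_integral_density) measurable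
  also have "\<dots> \<le> (\<integral>\<^sup>+y. ennreal (\<psi> y) * ennreal e \<partial>lborel)"
  proof (rule nn_integral_mono)
    fix y
    show "ennreal (\<psi> y) * (\<integral>\<^sup>+x. ennreal (\<bar>k (x - y) - k x\<bar> ^ p) \<partial>lborel) \<le> ennreal (\<psi> y) * ennreal e"
    proof (cases "norm y < \<epsilon>")
      case True
      then show ?thesis using tr[of "- y"] by (intro mult_left_mono) auto
    next
      case False
      then show ?thesis using supp[of y] by simp
    qed
  qed
  also have "\<dots> = ennreal e"
    by (subst nn_integral_multc) (auto simp: nn1)
  finally show ?thesis .
qed

text \<open>The result is a threshold for the radius instead of a single kernel: below the smallest of
  several thresholds one kernel serves a function and all its partial derivatives.\<close>

lemma mollify_tendsto:
  fixes k :: "'a::euclidean_space \<Rightarrow> real"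
  assumes k: "integrable lborel k" and kp: "integrable lborel (\<lambda>x. \<bar>k x\<bar> ^ p)" and p: "p \<in> {1, 2}"
    and e: "e > 0"
  obtains d where "d > 0" "\<And>\<epsilon> \<psi>. \<epsilon> \<le> d \<Longrightarrow> mollifier \<epsilon> \<psi> \<Longrightarrow>
    integrable lborel (\<lambda>x. \<bar>mollify \<psi> k x - k x\<bar> ^ p) \<and> (LINT x|lborel. \<bar>mollify \<psi> k x - k x\<bar> ^ p) \<le> e"
proof -
  have [measurable]: "k \<in> borel_measurable borel" using k by auto
  obtain d where d: "d > 0" "\<And>t. norm t < d \<Longrightarrow> (\<integral>\<^sup>+x. ennreal (\<bar>k (x + t) - k x\<bar> ^ p) \<partial>lborel) \<le> ennreal e"
    by (rule Lp_translation_continuous[of k p e]) (use kp p e in auto)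
  show ?thesis
  proof (rule that[OF d(1)])
    fix \<epsilon> :: real and \<psi> :: "'a \<Rightarrow> real"
    assume a: "\<epsilon> \<le> d" "mollifier \<epsilon> \<psi>"
    have [measurable]: "mollify \<psi> k \<in> borel_measurable borel"
      by (rule smooth_measurable[OF smooth_mollify[OF mollifier_smooth_compact[OF a(2)] k]])
    have le: "(\<integral>\<^sup>+x. ennreal (\<bar>mollify \<psi> k x - k x\<bar> ^ p) \<partial>lborel) \<le> ennreal e"
      by (rule mollify_Lp[OF a(2) k p d(2)]) (use a(1) in auto)
    have int: "integrable lborel (\<lambda>x. \<bar>mollify \<psi> k x - k x\<bar> ^ p)"
      unfolding integrable_iff_bounded using le by (auto intro: le_less_trans simp: power_abs)
    have "ennreal (LINT x|lborel. \<bar>mollify \<psi> k x - k x\<bar> ^ p) \<le> ennreal e"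
      using nn_integral_eq_integral[OF int] le by simp
    then have "(LINT x|lborel. \<bar>mollify \<psi> k x - k x\<bar> ^ p) \<le> e"
      using e by (simp add: ennreal_le_iff)
    with int show "integrable lborel (\<lambda>x. \<bar>mollify \<psi> k x - k x\<bar> ^ p) \<and> (LINT x|lborel. \<bar>mollify \<psi> k x - k x\<bar> ^ p) \<le> e" ..
  qed
qed

section \<open>Borel representatives of functions on a set\<close>

text \<open>Integration over a set uses the completed measure, whereas translations and Fubini are
  available for the Borel product. A representative that vanishes off the set passes between the two.\<close>

definition borel_rep :: "'a::euclidean_space set \<Rightarrow> ('a \<Rightarrow> real) \<Rightarrow> ('a \<Rightarrow> real) \<Rightarrow> bool" where
  "borel_rep S f f' \<longleftrightarrow> f' \<in> borel_measurable borel \<and> (\<forall>x. x \<notin> S \<longrightarrow> f' x = 0) \<and>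
     (AE x in lebesgue_on S. f' x = f x)"

lemma borel_rep_exists:
  assumes S: "S \<in> sets borel" and f: "f \<in> borel_measurable (lebesgue_on S)"
  obtains f' where "borel_rep S f f'"
proof -
  have "(\<lambda>x. if x \<in> S then f x else 0) \<in> borel_measurable lebesgue"
    using S f by (simp add: borel_measurable_if)
  from completion_ex_borel_measurable_real[OF this] obtain h
    where h: "h \<in> borel_measurable lborel" and ae: "AE x in lborel. (if x \<in> S then f x else 0) = h x" by blast
  have [measurable]: "h \<in> borel_measurable borel" using h by simp
  note S [measurable]
  have "AE x in lebesgue. (if x \<in> S then f x else 0) = h x" using ae by (rule AE_completion)
  then have "AE x in lebesgue_on S. (if x \<in> S then h x else 0) = f x"
    using S by (subst AE_restrict_space_iff) auto
  then have "borel_rep S f (\<lambda>x. if x \<in> S then h x else 0)"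
    by (auto simp: borel_rep_def)
  then show ?thesis by (rule that)
qed

lemma AE_lebesgue_on_iff_lborel:
  assumes "S \<in> sets borel"
  shows "(AE x in lebesgue_on S. P x) \<longleftrightarrow> (AE x in lborel. x \<in> S \<longrightarrow> P x)"
  using assms by (subst AE_restrict_space_iff) (auto simp: AE_completion_iff)

lemma borel_rep_integral:
  assumes S: "S \<in> sets borel" and f: "f \<in> borel_measurable (lebesgue_on S)" and rep: "borel_rep S f f'"
  shows "integral\<^sup>L (lebesgue_on S) f = integral\<^sup>L lborel f'"
    and "integrable (lebesgue_on S) f \<longleftrightarrow> integrable lborel f'"
proof -
  have m [measurable]: "f' \<in> borel_measurable borel" using rep by (simp add: borel_rep_def)
  have m': "f' \<in> borel_measurable (lebesgue_on S)"
    by (rule measurable_restrict_space1) (auto intro: measurable_completion)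
  have ae: "AE x in lebesgue_on S. f x = f' x" using rep by (auto simp: borel_rep_def)
  have eq: "(if x \<in> S then f' x else 0) = f' x" for x using rep by (auto simp: borel_rep_def)
  have SL: "S \<in> sets lebesgue" using S by simp
  have "integral\<^sup>L (lebesgue_on S) f = integral\<^sup>L (lebesgue_on S) f'"
    by (rule integral_cong_AE[OF f m' ae])
  also have "\<dots> = integral\<^sup>L lebesgue f'"
    using Lebesgue_Measure.integral_restrict_UNIV[OF SL, of f'] unfolding eq by simp
  finally show "integral\<^sup>L (lebesgue_on S) f = integral\<^sup>L lborel f'" by (simp add: integral_completion)
  have "integrable (lebesgue_on S) f \<longleftrightarrow> integrable (lebesgue_on S) f'"
    by (rule integrable_cong_AE[OF f m' ae])
  also have "\<dots> \<longleftrightarrow> integrable lebesgue f'"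
    using Lebesgue_Measure.integrable_restrict_UNIV[OF SL, of f'] unfolding eq by simp
  finally show "integrable (lebesgue_on S) f \<longleftrightarrow> integrable lborel f'" by (simp add: integrable_completion)
qed

lemma borel_imp_lebesgue_on: "f \<in> borel_measurable borel \<Longrightarrow> f \<in> borel_measurable (lebesgue_on S)"
  for f :: "'a::euclidean_space \<Rightarrow> real"
  by (rule measurable_restrict_space1) (auto intro: measurable_completion)

lemma lebesgue_on_measurable_AE:
  fixes f g :: "'a::euclidean_space \<Rightarrow> real"
  assumes S: "S \<in> sets lebesgue" and f: "f \<in> borel_measurable (lebesgue_on S)"
    and ae: "AE x in lebesgue_on S. f x = g x"
  shows "g \<in> borel_measurable (lebesgue_on S)"
proof -
  have "(\<lambda>x. if x \<in> S then f x else 0) \<in> borel_measurable lebesgue" using f by (simp add: borel_measurable_if[OF S])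
  moreover have "AE x in lebesgue. x \<in> S \<longrightarrow> f x = g x" using ae S by (simp add: AE_restrict_space_iff)
  then have "AE x in lebesgue. (if x \<in> S then f x else 0) = (if x \<in> S then g x else 0)"
    by (rule eventually_mono) simp
  ultimately have "(\<lambda>x. if x \<in> S then g x else 0) \<in> borel_measurable lebesgue"
    by (rule borel_measurable_AE)
  then show ?thesis by (simp add: borel_measurable_if[OF S])
qed

lemma borel_rep_measurable:
  assumes S: "S \<in> sets borel" and rep: "borel_rep S f f'"
  shows "f \<in> borel_measurable (lebesgue_on S)"
  by (rule lebesgue_on_measurable_AE[OF _ borel_imp_lebesgue_on, of S f'])
    (use S rep in \<open>auto simp: borel_rep_def\<close>)

lemma borel_rep_mult:
  assumes "borel_rep S f f'" "h \<in> borel_measurable borel"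
  shows "borel_rep S (\<lambda>x. h x * f x) (\<lambda>x. h x * f' x)"
  using assms by (auto simp: borel_rep_def)

lemma borel_rep_power2:
  assumes "borel_rep S f f'"
  shows "borel_rep S (\<lambda>x. (f x)\<^sup>2) (\<lambda>x. (f' x)\<^sup>2)"
  using assms by (auto simp: borel_rep_def)

section \<open>Test functions and weak derivatives\<close>

lemma test_functionsI:
  assumes "smooth \<phi>" "compact K" "K \<subseteq> S" "\<And>x. x \<notin> K \<Longrightarrow> \<phi> x = 0"
  shows "\<phi> \<in> test_functions S"
proof -
  have "closure {x. \<phi> x \<noteq> 0} \<subseteq> K"
    using assms(2,4) by (intro closure_minimal compact_imp_closed) auto
  moreover have "compact (closure {x. \<phi> x \<noteq> 0})"
    using calculation compact_Int_closed[OF assms(2) closed_closure, of "{x. \<phi> x \<noteq> 0}"]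
    by (simp add: Int_absorb1)
  ultimately show ?thesis
    using assms(1,3) unfolding test_functions_def smooth_def by auto
qed

lemma test_functionsD:
  assumes "\<phi> \<in> test_functions S"
  obtains K where "compact K" "K \<subseteq> S" "\<And>x. x \<notin> K \<Longrightarrow> \<phi> x = 0" "\<And>x i. x \<notin> K \<Longrightarrow> pd i \<phi> x = 0"
proof (rule that)
  let ?K = "closure {x. \<phi> x \<noteq> 0}"
  show K: "compact ?K" "?K \<subseteq> S" using assms by (auto simp: test_functions_def)
  show z: "\<phi> x = 0" if "x \<notin> ?K" for x using that closure_subset[of "{x. \<phi> x \<noteq> 0}"] by auto
  show "pd i \<phi> x = 0" if "x \<notin> ?K" for x i
    by (rule pd_eq_0_open[of "- ?K", OF _ _ z]) (use that in \<open>simp_all add: open_Compl\<close>)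
qed

lemma test_functions_smooth: "\<phi> \<in> test_functions S \<Longrightarrow> smooth \<phi>"
  by (simp add: test_functions_def smooth_def)

lemma test_functions_smooth_compact:
  assumes "\<phi> \<in> test_functions S" shows "smooth_compact \<phi>"
proof -
  obtain K where K: "compact K" "\<And>x. x \<notin> K \<Longrightarrow> \<phi> x = 0" by (rule test_functionsD[OF assms]) blast
  obtain m where "\<And>x. x \<in> K \<Longrightarrow> norm x \<le> m"
    using compact_imp_bounded[OF K(1)] unfolding bounded_iff by blast
  then have "\<phi> x = 0" if "m + 1 \<le> norm x" for x
    using K(2)[of x] that by force
  then show ?thesis using test_functions_smooth[OF assms] unfolding smooth_compact_def by blast
qed

lemma test_functions_measurable: "\<phi> \<in> test_functions S \<Longrightarrow> \<phi> \<in> borel_measurable borel"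
  by (rule smooth_measurable[OF test_functions_smooth])

lemma test_functions_mult:
  assumes "smooth \<phi>" "\<theta> \<in> test_functions S" shows "(\<lambda>x. \<phi> x * \<theta> x) \<in> test_functions S"
proof -
  obtain K where K: "compact K" "K \<subseteq> S" "\<And>x. x \<notin> K \<Longrightarrow> \<theta> x = 0" by (rule test_functionsD[OF assms(2)]) blast
  show ?thesis
    by (rule test_functionsI[OF smooth_mult[OF assms(1) test_functions_smooth[OF assms(2)]] K(1,2)]) (use K(3) in simp)
qed

lemma test_functions_pd:
  assumes "\<theta> \<in> test_functions S" "i \<in> Basis" shows "pd i \<theta> \<in> test_functions S"
proof -
  obtain K where K: "compact K" "K \<subseteq> S" "\<And>x. x \<notin> K \<Longrightarrow> pd i \<theta> x = 0" by (rule test_functionsD[OF assms(1)]) blast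
  show ?thesis
    by (rule test_functionsI[OF smooth_pd[OF test_functions_smooth[OF assms(1)] assms(2)] K(1,2)]) (use K(3) in simp)
qed

lemma test_mult_integrable:
  fixes u :: "'a::euclidean_space \<Rightarrow> real"
  assumes \<phi>: "\<phi> \<in> test_functions S" and u: "locally_integrable S u" and S: "S \<in> sets borel"
  shows "integrable (lebesgue_on S) (\<lambda>x. \<phi> x * u x)"
proof -
  obtain K where K: "compact K" "K \<subseteq> S" "\<And>x. x \<notin> K \<Longrightarrow> \<phi> x = 0" by (rule test_functionsD[OF \<phi>]) blast
  obtain B where B: "\<And>x. \<bar>\<phi> x\<bar> \<le> B" using smooth_compact_bounded[OF test_functions_smooth_compact[OF \<phi>]] by blast
  have KL: "K \<in> sets lebesgue" "S \<in> sets lebesgue" using fmeasurableD[OF lmeasurable_compact[OF K(1)]] S by auto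
  have "integrable (lebesgue_on K) u" using u K by (simp add: locally_integrable_def)
  then have "integrable (lebesgue_on K) (\<lambda>x. \<phi> x * u x)"
    by (rule integrable_bounded_mult[OF _ borel_imp_lebesgue_on[OF test_functions_measurable[OF \<phi>]] B])
  then have "integrable lebesgue (\<lambda>x. if x \<in> K then \<phi> x * u x else 0)"
    by (simp only: Lebesgue_Measure.integrable_restrict_UNIV[OF KL(1)])
  moreover have "(\<lambda>x. if x \<in> K then \<phi> x * u x else 0) = (\<lambda>x. if x \<in> S then \<phi> x * u x else 0)"
    by (rule ext) (use K in auto)
  ultimately show ?thesis by (simp only: Lebesgue_Measure.integrable_restrict_UNIV[OF KL(2)])
qed

lemma locally_integrable_smooth_mult:
  fixes u :: "'a::euclidean_space \<Rightarrow> real"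
  assumes "smooth \<theta>" "locally_integrable S u"
  shows "locally_integrable S (\<lambda>x. \<theta> x * u x)"
  unfolding locally_integrable_def
proof (intro allI impI)
  fix K assume K: "compact K \<and> K \<subseteq> S"
  have "bounded (\<theta> ` K)"
    using K by (intro compact_imp_bounded compact_continuous_image smooth_continuous[OF assms(1)]) auto
  then obtain B where B: "B > 0" "\<And>x. x \<in> K \<Longrightarrow> \<bar>\<theta> x\<bar> \<le> B" unfolding bounded_pos by auto
  have u: "integrable (lebesgue_on K) u" using assms(2) K by (simp add: locally_integrable_def)
  have [measurable]: "\<theta> \<in> borel_measurable (lebesgue_on K)"
    by (rule borel_imp_lebesgue_on[OF smooth_measurable[OF assms(1)]])
  show "integrable (lebesgue_on K) (\<lambda>x. \<theta> x * u x)"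
  proof (rule integrable_dominated)
    show "integrable (lebesgue_on K) (\<lambda>x. B * \<bar>u x\<bar>)" using u by auto
    show "(\<lambda>x. \<theta> x * u x) \<in> borel_measurable (lebesgue_on K)" using u by auto
    show "\<bar>\<theta> x * u x\<bar> \<le> B * \<bar>u x\<bar>" if "x \<in> space (lebesgue_on K)" for x
      unfolding abs_mult using B(2)[of x] that by (intro mult_right_mono) auto
  qed
qed

lemma locally_integrable_add:
  fixes u :: "'a::euclidean_space \<Rightarrow> real"
  assumes "locally_integrable S u" "locally_integrable S v"
  shows "locally_integrable S (\<lambda>x. u x + v x)"
  using assms unfolding locally_integrable_def by auto

text \<open>The product rule comes from testing \<open>u\<close> with \<open>\<theta> \<phi>\<close> in place of \<open>\<phi>\<close>.\<close>

lemma has_weak_pderiv_smooth_mult: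
  fixes u :: "'a::euclidean_space \<Rightarrow> real"
  assumes S: "S \<in> sets borel" and u: "has_weak_pderiv S i u g" and \<theta>: "smooth \<theta>" and i: "i \<in> Basis"
  shows "has_weak_pderiv S i (\<lambda>x. \<theta> x * u x) (\<lambda>x. \<theta> x * g x + pd i \<theta> x * u x)"
  unfolding has_weak_pderiv_def
proof (intro conjI ballI)
  have lu: "locally_integrable S u" and lg: "locally_integrable S g" using u by (auto simp: has_weak_pderiv_def)
  show "locally_integrable S (\<lambda>x. \<theta> x * u x)" by (rule locally_integrable_smooth_mult[OF \<theta> lu])
  show "locally_integrable S (\<lambda>x. \<theta> x * g x + pd i \<theta> x * u x)"
    by (intro locally_integrable_add locally_integrable_smooth_mult \<theta> lu lg smooth_pd i)
  fix \<phi> assume \<phi>: "\<phi> \<in> test_functions S"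
  have sm: "smooth \<phi>" by (rule test_functions_smooth[OF \<phi>])
  have t1: "(\<lambda>x. \<theta> x * \<phi> x) \<in> test_functions S" by (rule test_functions_mult[OF \<theta> \<phi>])
  have t2: "(\<lambda>x. \<theta> x * pd i \<phi> x) \<in> test_functions S" by (rule test_functions_mult[OF \<theta> test_functions_pd[OF \<phi> i]])
  have t3: "(\<lambda>x. pd i \<theta> x * \<phi> x) \<in> test_functions S" by (rule test_functions_mult[OF smooth_pd[OF \<theta> i] \<phi>])
  have "(LINT x|lebesgue_on S. pd i (\<lambda>x. \<theta> x * \<phi> x) x * u x) = - (LINT x|lebesgue_on S. (\<theta> x * \<phi> x) * g x)"
    using u t1 by (simp add: has_weak_pderiv_def)
  then have "(LINT x|lebesgue_on S. (\<theta> x * pd i \<phi> x) * u x) + (LINT x|lebesgue_on S. (pd i \<theta> x * \<phi> x) * u x)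
      = - (LINT x|lebesgue_on S. (\<theta> x * \<phi> x) * g x)"
    using test_mult_integrable[OF t2 lu S] test_mult_integrable[OF t3 lu S]
    by (simp add: pd_mult[OF \<theta> sm] distrib_right)
  moreover have "(LINT x|lebesgue_on S. \<phi> x * (\<theta> x * g x + pd i \<theta> x * u x))
      = (LINT x|lebesgue_on S. (\<theta> x * \<phi> x) * g x) + (LINT x|lebesgue_on S. (pd i \<theta> x * \<phi> x) * u x)"
    using test_mult_integrable[OF t1 lg S] test_mult_integrable[OF t3 lu S]
    by (simp add: distrib_left mult_ac)
  ultimately show "(LINT x|lebesgue_on S. pd i \<phi> x *\<^sub>R (\<theta> x * u x))
      = - (LINT x|lebesgue_on S. \<phi> x *\<^sub>R (\<theta> x * g x + pd i \<theta> x * u x))"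
    by (simp add: mult_ac)
qed

lemma has_weak_pderiv_add:
  fixes u v :: "'a::euclidean_space \<Rightarrow> real"
  assumes S: "S \<in> sets borel" and u: "has_weak_pderiv S i u g" and v: "has_weak_pderiv S i v h" and i: "i \<in> Basis"
  shows "has_weak_pderiv S i (\<lambda>x. u x + v x) (\<lambda>x. g x + h x)"
  unfolding has_weak_pderiv_def
proof (intro conjI ballI)
  have l: "locally_integrable S u" "locally_integrable S g" "locally_integrable S v" "locally_integrable S h"
    using u v by (auto simp: has_weak_pderiv_def)
  show "locally_integrable S (\<lambda>x. u x + v x)" "locally_integrable S (\<lambda>x. g x + h x)"
    by (intro locally_integrable_add l)+
  fix \<phi> assume \<phi>: "\<phi> \<in> test_functions S"
  note t = test_functions_pd[OF \<phi> i]
  have "(LINT x|lebesgue_on S. pd i \<phi> x * u x) = - (LINT x|lebesgue_on S. \<phi> x * g x)"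
    "(LINT x|lebesgue_on S. pd i \<phi> x * v x) = - (LINT x|lebesgue_on S. \<phi> x * h x)"
    using u v \<phi> by (auto simp: has_weak_pderiv_def)
  then show "(LINT x|lebesgue_on S. pd i \<phi> x *\<^sub>R (u x + v x)) = - (LINT x|lebesgue_on S. \<phi> x *\<^sub>R (g x + h x))"
    using test_mult_integrable[OF t l(1) S] test_mult_integrable[OF t l(3) S]
      test_mult_integrable[OF \<phi> l(2) S] test_mult_integrable[OF \<phi> l(4) S]
    by (simp add: distrib_left)
qed

text \<open>The convolution of \<open>\<phi>\<close> with the indicator of a large ball is constant near the origin, so its
  derivative there, which is the integral in question, vanishes.\<close>

lemma integral_pd_eq_0:
  fixes \<phi> :: "'a::euclidean_space \<Rightarrow> real"
  assumes \<phi>: "smooth_compact \<phi>" and i: "i \<in> Basis"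
  shows "(LINT x|lborel. pd i \<phi> x) = 0"
proof -
  obtain m where m: "\<And>x. m \<le> norm x \<Longrightarrow> \<phi> x = 0" using \<phi> by (auto simp: smooth_compact_def)
  have m': "pd i \<phi> x = 0" if "m + 1 \<le> norm x" for x
    by (rule pd_eq_0_open[of "- cball 0 m"]) (use that m in auto)
  define k :: "'a \<Rightarrow> real" where "k = indicator (cball 0 (m + 2))"
  have k: "integrable lborel k" by (simp add: k_def)
  have const: "mollify \<phi> k x = (LINT y|lborel. \<phi> y)" if "x \<in> ball 0 1" for x
  proof -
    have "\<phi> (x - y) * k y = \<phi> (x - y)" for y
    proof (cases "norm y \<le> m + 2")
      case False
      have "norm y \<le> norm (x - y) + norm x" using norm_triangle_ineq4[of x "x - y"] by simp
      then have "m \<le> norm (x - y)" using that False by simp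
      then show ?thesis using m by simp
    qed (simp add: k_def)
    then have "(\<lambda>y. \<phi> (x - y) * k y) = (\<lambda>y. \<phi> (x - y))" by blast
    then have "mollify \<phi> k x = (LINT y|lborel. \<phi> (x - y))" by (simp add: mollify_def)
    also have "\<dots> = (LINT y|lborel. \<phi> y)" by (rule integral_lborel_reflect[OF smooth_compact_measurable[OF \<phi>]])
    finally show ?thesis .
  qed
  have "((\<lambda>x. mollify \<phi> k x) has_derivative (\<lambda>h. 0)) (at 0)"
    by (rule has_derivative_transform_within_open[of "\<lambda>_. LINT y|lborel. \<phi> y" _ _ _ "ball 0 1"]) (use const in auto)
  then have "pd i (mollify \<phi> k) 0 = 0"
    using fun_cong[OF frechet_derivative_at, of "mollify \<phi> k" "\<lambda>h. 0" 0 i] by simp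
  moreover have "pd i (mollify \<phi> k) 0 = mollify (pd i \<phi>) k 0" by (rule mollify_pd[OF \<phi> k i])
  moreover have "mollify (pd i \<phi>) k 0 = (LINT y|lborel. pd i \<phi> (0 - y))"
  proof -
    have "pd i \<phi> (0 - y) * k y = pd i \<phi> (0 - y)" for y
      using m'[of "0 - y"] by (cases "norm y \<le> m + 2") (auto simp: k_def)
    then have "(\<lambda>y. pd i \<phi> (0 - y) * k y) = (\<lambda>y. pd i \<phi> (0 - y))" by blast
    then show ?thesis by (simp only: mollify_def)
  qed
  moreover have "(LINT y|lborel. pd i \<phi> (0 - y)) = (LINT y|lborel. pd i \<phi> y)"
    by (rule integral_lborel_reflect[OF smooth_compact_measurable[OF smooth_compact_pd[OF \<phi> i]]])
  ultimately show ?thesis by simp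
qed

lemma has_weak_pderiv_const:
  fixes c :: real
  assumes S: "S \<in> sets borel" and i: "i \<in> Basis"
  shows "has_weak_pderiv S i (\<lambda>x. c) (\<lambda>x. 0)"
  unfolding has_weak_pderiv_def
proof (intro conjI ballI)
  show "locally_integrable S (\<lambda>x::'a. c)" "locally_integrable S (\<lambda>x::'a. 0::real)"
    by (auto simp: locally_integrable_def
        intro!: finite_measure.integrable_const finite_measure_lebesgue_on lmeasurable_compact)
  fix \<phi> assume \<phi>: "\<phi> \<in> test_functions S"
  note t = test_functions_pd[OF \<phi> i]
  obtain K where K: "K \<subseteq> S" "\<And>x. x \<notin> K \<Longrightarrow> pd i \<phi> x = 0" by (rule test_functionsD[OF \<phi>]) blast
  have "borel_rep S (pd i \<phi>) (pd i \<phi>)"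
    using K test_functions_measurable[OF t] by (auto simp: borel_rep_def)
  then have "(LINT x|lebesgue_on S. pd i \<phi> x) = (LINT x|lborel. pd i \<phi> x)"
    by (rule borel_rep_integral(1)[OF S borel_imp_lebesgue_on[OF test_functions_measurable[OF t]]])
  then show "(LINT x|lebesgue_on S. pd i \<phi> x *\<^sub>R c) = - (LINT x|lebesgue_on S. \<phi> x *\<^sub>R 0)"
    using integral_pd_eq_0[OF test_functions_smooth_compact[OF \<phi>] i] by simp
qed

lemma has_weak_pderiv_smooth:
  assumes S: "S \<in> sets borel" and i: "i \<in> Basis" and \<theta>: "smooth \<theta>"
  shows "has_weak_pderiv S i \<theta> (pd i \<theta>)"
  using has_weak_pderiv_smooth_mult[OF S has_weak_pderiv_const[OF S i, of 1] \<theta> i] by simp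

lemma has_weak_pderiv_cmult:
  fixes u :: "'a::euclidean_space \<Rightarrow> real"
  assumes S: "S \<in> sets borel" and i: "i \<in> Basis" and u: "has_weak_pderiv S i u g"
  shows "has_weak_pderiv S i (\<lambda>x. c * u x) (\<lambda>x. c * g x)"
proof -
  have "pd i (\<lambda>_. c) x = 0" for x by simp
  then show ?thesis using has_weak_pderiv_smooth_mult[OF S u smooth_const[of c] i] by simp
qed

section \<open>Radial cutoffs\<close>

text \<open>Using the squared norm keeps the cutoff smooth at the origin. For \<open>s = r + 1\<close> its gradient is
  bounded independently of \<open>r\<close>, because \<open>s\<^sup>2 - r\<^sup>2 = 2 r + 1\<close> compensates the factor \<open>norm x\<close>.\<close>

definition cutoff :: "real \<Rightarrow> real \<Rightarrow> 'a::euclidean_space \<Rightarrow> real" where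
  "cutoff r s x = step ((s\<^sup>2 - (norm x)\<^sup>2) / (s\<^sup>2 - r\<^sup>2))"

lemma smooth_cutoff: "smooth (cutoff r s)"
proof -
  have "smooth (\<lambda>x. step (1 / (s\<^sup>2 - r\<^sup>2) * (s\<^sup>2 - (norm x)\<^sup>2)))"
    by (rule smooth_compose[OF smooth_step]) (intro smooth_mult smooth_diff smooth_const smooth_norm_sq)
  then show ?thesis by (simp add: cutoff_def [abs_def])
qed

lemma cutoff_range: "0 \<le> cutoff r s x" "cutoff r s x \<le> 1"
  by (simp_all add: cutoff_def step_range)

lemma cutoff_1: assumes "0 \<le> r" "r < s" "norm x \<le> r" shows "cutoff r s x = 1"
proof -
  have "(norm x)\<^sup>2 \<le> r\<^sup>2" "r\<^sup>2 < s\<^sup>2" using assms by (auto intro: power_mono power_strict_mono)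
  then show ?thesis unfolding cutoff_def by (intro step_1) (simp add: field_simps)
qed

lemma cutoff_0: assumes "0 \<le> r" "r < s" "s \<le> norm x" shows "cutoff r s x = 0"
proof -
  have "s\<^sup>2 \<le> (norm x)\<^sup>2" "r\<^sup>2 < s\<^sup>2" using assms by (auto intro: power_mono power_strict_mono)
  then show ?thesis unfolding cutoff_def by (intro step_0) (simp add: divide_nonpos_pos)
qed

lemma cutoff_test_function:
  assumes "0 \<le> r" "r < s" "s < \<rho>" shows "cutoff r s \<in> test_functions (ball 0 \<rho>)"
proof (rule test_functionsI[OF smooth_cutoff, of "cball 0 s"])
  fix x :: 'a assume "x \<notin> cball 0 s"
  then show "cutoff r s x = 0" by (intro cutoff_0[OF assms(1,2)]) simp
qed (use assms in auto)

lemma pd_cutoff: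
  "pd i (cutoff r s) x = - 2 * (x \<bullet> i) / (s\<^sup>2 - r\<^sup>2) * deriv step ((s\<^sup>2 - (norm x)\<^sup>2) / (s\<^sup>2 - r\<^sup>2))"
proof -
  have "((\<lambda>x. (s\<^sup>2 - x \<bullet> x) / (s\<^sup>2 - r\<^sup>2)) has_derivative (\<lambda>h. - (2 * (x \<bullet> h)) / (s\<^sup>2 - r\<^sup>2))) (at x)"
    by (auto intro!: derivative_eq_intros simp: inner_commute divide_inverse)
  from has_derivative_compose[OF this, of step, OF step_deriv[unfolded has_field_derivative_def]]
  have "(cutoff r s has_derivative (\<lambda>h. deriv step ((s\<^sup>2 - x \<bullet> x) / (s\<^sup>2 - r\<^sup>2)) * (- (2 * (x \<bullet> h)) / (s\<^sup>2 - r\<^sup>2)))) (at x)"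
    by (simp add: cutoff_def [abs_def] power2_norm_eq_inner)
  from fun_cong[OF frechet_derivative_at[OF this], of i] show ?thesis
    by (simp add: power2_norm_eq_inner mult_ac)
qed

section \<open>Uniqueness of weak derivatives\<close>

lemma mollify_all_zero_imp_AE_0:
  fixes k :: "'a::euclidean_space \<Rightarrow> real"
  assumes k: "integrable lborel k" and z: "\<And>\<psi> x. smooth_compact \<psi> \<Longrightarrow> mollify \<psi> k x = 0"
  shows "AE x in lborel. k x = 0"
proof -
  have [measurable]: "k \<in> borel_measurable borel" using k by auto
  have ia: "integrable lborel (\<lambda>x. \<bar>k x\<bar> ^ 1)" using k by simp
  have "(LINT x|lborel. \<bar>k x\<bar>) \<le> e" if e: "e > 0" for e
  proof -
    obtain d where d: "d > 0" "\<And>\<epsilon> \<psi>. \<epsilon> \<le> d \<Longrightarrow> mollifier \<epsilon> \<psi> \<Longrightarrow>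
      integrable lborel (\<lambda>x. \<bar>mollify \<psi> k x - k x\<bar> ^ 1) \<and> (LINT x|lborel. \<bar>mollify \<psi> k x - k x\<bar> ^ 1) \<le> e"
      by (rule mollify_tendsto[OF k ia _ e]) auto
    obtain \<psi> :: "'a \<Rightarrow> real" where \<psi>: "mollifier d \<psi>" by (rule mollifier_exists[OF d(1)])
    show ?thesis using d(2)[OF order_refl \<psi>] z[OF mollifier_smooth_compact[OF \<psi>]] by simp
  qed
  then have "(LINT x|lborel. \<bar>k x\<bar>) \<le> 0" by (rule field_le_epsilon[where y=0, simplified])
  moreover have "(LINT x|lborel. \<bar>k x\<bar>) \<ge> 0" by (rule integral_nonneg_AE) simp
  ultimately have "(LINT x|lborel. \<bar>k x\<bar>) = 0" by simp
  then have "AE x in lborel. \<bar>k x\<bar> = 0"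
    by (subst (asm) integral_nonneg_eq_0_iff_AE) (use k in auto)
  then show ?thesis by simp
qed

lemma pd_reflect:
  assumes "smooth \<psi>" "i \<in> Basis"
  shows "smooth (\<lambda>y. \<psi> (x - y))" "pd i (\<lambda>y. \<psi> (x - y)) y = - pd i \<psi> (x - y)"
proof -
  have D: "((\<lambda>y. \<psi> (x - y)) has_derivative (\<lambda>h. frechet_derivative \<psi> (at (x - y)) (- h))) (at y)"
    if "smooth \<psi>" for \<psi> :: "'a \<Rightarrow> real" and y
    by (rule has_derivative_compose[OF _ smooth_has_derivative[OF that], of "\<lambda>y. x - y"])
      (auto intro!: derivative_eq_intros)
  have neg: "frechet_derivative \<psi> (at (x - y)) (- h) = - frechet_derivative \<psi> (at (x - y)) h"
    if "smooth \<psi>" for \<psi> :: "'a \<Rightarrow> real" and y h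
    by (rule linear_neg[OF has_derivative_linear[OF smooth_has_derivative[OF that]]])
  show "pd i (\<lambda>y. \<psi> (x - y)) y = - pd i \<psi> (x - y)"
    using fun_cong[OF frechet_derivative_at[OF D[OF assms(1)]], of y i] neg[OF assms(1)] by simp
  have "Ck n (\<lambda>y. \<psi> (x - y))" for n
    using assms(1)
  proof (induction n arbitrary: \<psi>)
    case 0
    show ?case using has_derivative_continuous[OF D[OF 0]] by (simp add: continuous_at_imp_continuous_on)
  next
    case (Suc n)
    show ?case
    proof (rule Ck_SucI[OF D[OF Suc.prems]])
      fix j :: 'a assume j: "j \<in> Basis"
      have "Ck n (\<lambda>y. (-1) * pd j \<psi> (x - y))"
        by (rule Ck_mult[OF Ck_const Suc.IH[OF smooth_pd[OF Suc.prems j]]])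
      then show "Ck n (\<lambda>y. frechet_derivative \<psi> (at (x - y)) (- j))"
        by (simp add: neg[OF Suc.prems])
    qed
  qed
  then show "smooth (\<lambda>y. \<psi> (x - y))" by (simp add: smooth_def)
qed

lemma lim_inverse_shift: "(\<lambda>n. 1 / (real n + c)) \<longlonglongrightarrow> 0"
  using tendsto_divide_0[OF tendsto_const[of 1] filterlim_at_top_imp_at_infinity[OF
        filterlim_tendsto_add_at_top[OF tendsto_const[of c] filterlim_real_sequentially]]]
  by (simp add: add.commute)

text \<open>After multiplication with a test function the given function is integrable on the whole
  space, and every mollification of the product vanishes because the kernel times the test function
  is again a test function. Countably many cutoffs exhaust the ball.\<close>

lemma locally_integrable_orthogonal_imp_AE_0:
  fixes d :: "'a::euclidean_space \<Rightarrow> real"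
  assumes d: "locally_integrable (ball 0 \<rho>) d" and m: "d \<in> borel_measurable (lebesgue_on (ball 0 \<rho>))"
    and z: "\<And>\<phi>. \<phi> \<in> test_functions (ball 0 \<rho>) \<Longrightarrow> (LINT x|lebesgue_on (ball 0 \<rho>). \<phi> x * d x) = 0"
  shows "AE x in lebesgue_on (ball 0 \<rho>). d x = 0"
proof -
  let ?S = "ball (0::'a) \<rho>"
  have S: "?S \<in> sets borel" by simp
  obtain d' where d': "borel_rep ?S d d'" by (rule borel_rep_exists[OF S m])
  have local: "AE x in lborel. \<theta> x * d' x = 0" if \<theta>: "\<theta> \<in> test_functions ?S" for \<theta>
  proof (rule mollify_all_zero_imp_AE_0)
    have \<theta>m: "\<theta> \<in> borel_measurable borel" by (rule test_functions_measurable[OF \<theta>])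
    have i: "integrable (lebesgue_on ?S) (\<lambda>x. \<theta> x * d x)" by (rule test_mult_integrable[OF \<theta> d S])
    then show "integrable lborel (\<lambda>x. \<theta> x * d' x)"
      using borel_rep_integral(2)[OF S _ borel_rep_mult[OF d' \<theta>m]] by blast
    fix \<psi> :: "'a \<Rightarrow> real" and x assume \<psi>: "smooth_compact \<psi>"
    have sm: "smooth (\<lambda>y. \<psi> (x - y))"
      using pd_reflect(1)[OF smooth_compactD[OF \<psi>] SOME_Basis] .
    have t: "(\<lambda>y. \<psi> (x - y) * \<theta> y) \<in> test_functions ?S" by (rule test_functions_mult[OF sm \<theta>])
    have "(LINT y|lebesgue_on ?S. (\<psi> (x - y) * \<theta> y) * d y) = (LINT y|lborel. (\<psi> (x - y) * \<theta> y) * d' y)"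
      using borel_rep_integral(1)[OF S _ borel_rep_mult[OF d' test_functions_measurable[OF t]]]
        test_mult_integrable[OF t d S] by blast
    then show "mollify \<psi> (\<lambda>x. \<theta> x * d' x) x = 0"
      using z[OF t] by (simp add: mollify_def mult.assoc)
  qed
  show ?thesis
  proof (cases "\<rho> > 0")
    case True
    define s where "s n = \<rho> * (1 - 1 / (real n + 2))" for n
    have s: "0 < s n" "s n < \<rho>" for n
    proof -
      have f: "0 < 1 / (real n + 2)" "1 / (real n + 2) < 1" by auto
      show "0 < s n" "s n < \<rho>"
        unfolding s_def using True mult_strict_left_mono[of "1 - 1 / (real n + 2)" 1 \<rho>] f
        by (auto intro!: mult_pos_pos)
    qed
    have "AE x in lborel. \<forall>n. cutoff (s n) ((s n + \<rho>) / 2) x * d' x = 0"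
      unfolding AE_all_countable
    proof
      fix n
      show "AE x in lborel. cutoff (s n) ((s n + \<rho>) / 2) x * d' x = 0"
        by (rule local[OF cutoff_test_function]) (use s[of n] in auto)
    qed
    then have "AE x in lborel. x \<in> ?S \<longrightarrow> d' x = 0"
    proof (rule eventually_mono, intro impI)
      fix x :: 'a assume a: "\<forall>n. cutoff (s n) ((s n + \<rho>) / 2) x * d' x = 0" and x: "x \<in> ?S"
      have "(\<lambda>n. s n) \<longlonglongrightarrow> \<rho> * (1 - 0)"
        unfolding s_def by (intro tendsto_intros lim_inverse_shift)
      then have "\<forall>\<^sub>F n in sequentially. norm x < s n" using x by (intro order_tendstoD(1)) auto
      then obtain n where n: "norm x < s n" by (meson eventually_sequentially order_refl)
      have "cutoff (s n) ((s n + \<rho>) / 2) x = 1" by (rule cutoff_1) (use n s[of n] in auto)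
      then show "d' x = 0" using a[rule_format, of n] by simp
    qed
    then have "AE x in lebesgue_on ?S. d' x = 0" by (simp add: AE_lebesgue_on_iff_lborel[OF S])
    moreover have "AE x in lebesgue_on ?S. d' x = d x" using d' by (simp add: borel_rep_def)
    ultimately show ?thesis by eventually_elim simp
  next
    case False
    then have "x \<notin> ?S" for x using norm_ge_zero[of x] by (simp del: norm_ge_zero)
    then show ?thesis by (simp only: AE_lebesgue_on_iff_lborel[OF S]) simp
  qed
qed

lemma locally_integrable_measurable:
  fixes g :: "'a::euclidean_space \<Rightarrow> real"
  assumes "locally_integrable (ball 0 \<rho>) g" shows "g \<in> borel_measurable (lebesgue_on (ball 0 \<rho>))"
proof -
  define K where "K n = cball (0::'a) (\<rho> * (1 - 1 / (real n + 1)))" for n :: nat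
  show ?thesis
  proof (cases "\<rho> > 0")
    case True
    have KS: "K n \<subseteq> ball 0 \<rho>" for n
    proof -
      have "0 < 1 / (real n + 1)" by simp
      then have "\<rho> * (1 - 1 / (real n + 1)) < \<rho>"
        using True mult_strict_left_mono[of "1 - 1 / (real n + 1)" 1 \<rho>] by simp
      then show ?thesis unfolding K_def by (intro cball_subset_ball_iff[THEN iffD2]) simp
    qed
    have KL: "K n \<in> sets lebesgue" for n by (simp add: K_def)
    have "g \<in> borel_measurable (lebesgue_on (K n))" for n
      using assms KS[of n] unfolding locally_integrable_def
      by (intro borel_measurable_integrable) (auto simp: K_def)
    then have m: "(\<lambda>x. if x \<in> K n then g x else 0) \<in> borel_measurable lebesgue" for n
      using borel_measurable_if[OF KL] by blast
    have "(\<lambda>x. if x \<in> ball 0 \<rho> then g x else 0) \<in> borel_measurable lebesgue"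
    proof (rule borel_measurable_LIMSEQ_real[OF _ m])
      fix x :: 'a
      have "\<forall>\<^sub>F n in sequentially. (if x \<in> K n then g x else 0) = (if x \<in> ball 0 \<rho> then g x else 0)"
      proof (cases "x \<in> ball 0 \<rho>")
        case True
        have "(\<lambda>n. \<rho> * (1 - 1 / (real n + 1))) \<longlonglongrightarrow> \<rho> * (1 - 0)"
          by (intro tendsto_intros lim_inverse_shift)
        then have "\<forall>\<^sub>F n in sequentially. norm x < \<rho> * (1 - 1 / (real n + 1))"
          using True by (intro order_tendstoD(1)) auto
        then show ?thesis by (rule eventually_mono) (use True in \<open>auto simp: K_def\<close>)
      next
        case False
        then have "x \<notin> K n" for n using KS[of n] by blast
        then show ?thesis using False by simp
      qed
      then show "(\<lambda>n. if x \<in> K n then g x else 0) \<longlonglongrightarrow> (if x \<in> ball 0 \<rho> then g x else 0)"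
        by (rule tendsto_eventually)
    qed
    then show ?thesis by (subst (asm) borel_measurable_if) auto
  next
    case False
    then have "ball (0::'a) \<rho> = {}" by simp
    then have "(\<lambda>x. if x \<in> ball 0 \<rho> then g x else 0) = (\<lambda>x. 0)" by (simp only: empty_iff if_False)
    then have "(\<lambda>x. if x \<in> ball 0 \<rho> then g x else 0) \<in> borel_measurable lebesgue" by simp
    then show ?thesis by (subst (asm) borel_measurable_if) auto
  qed
qed

text \<open>Uniqueness makes the chosen representative of the weak derivative computable.\<close>

lemma weak_pderiv_AE:
  fixes u :: "'a::euclidean_space \<Rightarrow> real"
  assumes u: "has_weak_pderiv (ball 0 \<rho>) i u g"
  shows "AE x in lebesgue_on (ball 0 \<rho>). weak_pderiv (ball 0 \<rho>) i u x = g x"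
proof -
  let ?S = "ball (0::'a) \<rho>" and ?h = "weak_pderiv (ball 0 \<rho>) i u"
  have S: "?S \<in> sets borel" by simp
  have h: "has_weak_pderiv ?S i u ?h" unfolding weak_pderiv_def by (rule someI[where P="has_weak_pderiv ?S i u", OF u])
  have lg: "locally_integrable ?S g" and lh: "locally_integrable ?S ?h"
    using u h by (auto simp: has_weak_pderiv_def)
  have "AE x in lebesgue_on ?S. ?h x - g x = 0"
  proof (rule locally_integrable_orthogonal_imp_AE_0)
    show "locally_integrable ?S (\<lambda>x. ?h x - g x)" using lg lh by (simp add: locally_integrable_def)
    then show "(\<lambda>x. ?h x - g x) \<in> borel_measurable (lebesgue_on ?S)" by (rule locally_integrable_measurable)
    fix \<phi> :: "'a \<Rightarrow> real" assume \<phi>: "\<phi> \<in> test_functions ?S"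
    have "(LINT x|lebesgue_on ?S. \<phi> x * ?h x) = (LINT x|lebesgue_on ?S. \<phi> x * g x)"
      using u h \<phi> by (simp add: has_weak_pderiv_def)
    then show "(LINT x|lebesgue_on ?S. \<phi> x * (?h x - g x)) = 0"
      using test_mult_integrable[OF \<phi> lg S] test_mult_integrable[OF \<phi> lh S]
      by (simp add: right_diff_distrib)
  qed
  then show ?thesis by simp
qed

section \<open>Approximation of cut-off Sobolev functions\<close>

lemma finite_min_bound:
  fixes Q :: "'i \<Rightarrow> real \<Rightarrow> bool"
  assumes "finite I" "\<And>i. i \<in> I \<Longrightarrow> \<exists>d>0. \<forall>\<epsilon>\<le>d. Q i \<epsilon>"
  shows "\<exists>d>0. \<forall>i\<in>I. \<forall>\<epsilon>\<le>d. Q i \<epsilon>"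
  using assms
proof (induction I rule: finite_induct)
  case (insert j I)
  obtain d1 where d1: "d1 > 0" "\<forall>i\<in>I. \<forall>\<epsilon>\<le>d1. Q i \<epsilon>" using insert by auto
  obtain d2 where d2: "d2 > 0" "\<forall>\<epsilon>\<le>d2. Q j \<epsilon>" using insert(4)[of j] by auto
  show ?case by (rule exI[of _ "min d1 d2"]) (use d1 d2 in auto)
qed (auto intro: exI[of _ 1])

lemma square_integrable_imp_integrable:
  fixes k :: "'a::euclidean_space \<Rightarrow> real"
  assumes [measurable]: "k \<in> borel_measurable borel" and i: "integrable lborel (\<lambda>x. (k x)\<^sup>2)"
    and z: "\<And>x. x \<notin> ball 0 \<rho> \<Longrightarrow> k x = 0"
  shows "integrable lborel k"
proof (rule integrable_dominated)
  show "integrable lborel (\<lambda>x. (k x)\<^sup>2 + indicat_real (cball 0 \<rho>) x)" using i by simp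
  show "\<bar>k x\<bar> \<le> (k x)\<^sup>2 + indicat_real (cball 0 \<rho>) x" for x
  proof (cases "x \<in> ball 0 \<rho>")
    case True
    have "0 \<le> (\<bar>k x\<bar> - 1)\<^sup>2 + \<bar>k x\<bar>" by simp
    then have "\<bar>k x\<bar> \<le> (k x)\<^sup>2 + 1" by (simp add: power2_diff)
    then show ?thesis using True by (simp add: indicator_def)
  qed (use z in simp)
qed simp

lemma square_integrable_bounded_mult:
  fixes k :: "'a \<Rightarrow> real"
  assumes "integrable M (\<lambda>x. (k x)\<^sup>2)" "k \<in> borel_measurable M" "h \<in> borel_measurable M" "\<And>x. \<bar>h x\<bar> \<le> B"
  shows "integrable M (\<lambda>x. (h x * k x)\<^sup>2)"
proof -
  have "\<bar>(h x)\<^sup>2\<bar> \<le> B\<^sup>2" for x using power_mono[OF assms(4)[of x] abs_ge_zero, of 2] by simp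
  then have "integrable M (\<lambda>x. (h x)\<^sup>2 * (k x)\<^sup>2)"
    by (rule integrable_bounded_mult[OF assms(1), rotated]) (use assms(3) in simp)
  then show ?thesis by (simp add: power_mult_distrib)
qed

lemma square_integrable_add:
  fixes k :: "'a \<Rightarrow> real"
  assumes "integrable M (\<lambda>x. (k x)\<^sup>2)" "integrable M (\<lambda>x. (h x)\<^sup>2)" "k \<in> borel_measurable M" "h \<in> borel_measurable M"
  shows "integrable M (\<lambda>x. (k x + h x)\<^sup>2)"
  using integrable_abs_power_add[of k M h 2] assms by simp

text \<open>The cut-off function \<open>\<theta> z\<close> vanishes near the boundary of the ball, so its product rule
  gradient is its weak gradient on the whole space, and mollification commutes with it.\<close>

lemma mollify_cutoff_pd:
  fixes z :: "'a::euclidean_space \<Rightarrow> real"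
  assumes iz: "integrable lborel z" and ip: "integrable lborel p"
    and weak: "\<And>\<phi>. \<phi> \<in> test_functions S \<Longrightarrow> (LINT y|lborel. pd i \<phi> y * z y) = - (LINT y|lborel. \<phi> y * p y)"
    and \<theta>: "\<theta> \<in> test_functions S" and i: "i \<in> Basis" and \<psi>: "smooth_compact \<psi>"
  shows "pd i (mollify \<psi> (\<lambda>y. \<theta> y * z y)) x = mollify \<psi> (\<lambda>y. \<theta> y * p y + pd i \<theta> y * z y) x"
proof -
  have s\<theta>: "smooth \<theta>" by (rule test_functions_smooth[OF \<theta>])
  have i\<theta>: "integrable lborel (\<lambda>y. \<theta> y * k y)" "integrable lborel (\<lambda>y. pd i \<theta> y * k y)"
    if "integrable lborel k" for k
  proof -
    obtain B where "\<And>x. \<bar>\<theta> x\<bar> \<le> B"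
      using smooth_compact_bounded[OF test_functions_smooth_compact[OF \<theta>]] by blast
    then show "integrable lborel (\<lambda>y. \<theta> y * k y)"
      by (rule integrable_bounded_mult[OF that, rotated]) (simp add: smooth_measurable[OF s\<theta>])
    obtain B where "\<And>x. \<bar>pd i \<theta> x\<bar> \<le> B"
      using smooth_compact_bounded[OF smooth_compact_pd[OF test_functions_smooth_compact[OF \<theta>] i]] by blast
    then show "integrable lborel (\<lambda>y. pd i \<theta> y * k y)"
      by (rule integrable_bounded_mult[OF that, rotated]) (simp add: smooth_measurable[OF smooth_pd[OF s\<theta> i]])
  qed
  have s\<psi>: "smooth (\<lambda>y. \<psi> (x - y))" by (rule pd_reflect(1)[OF smooth_compactD[OF \<psi>] i])
  have t: "(\<lambda>y. \<psi> (x - y) * \<theta> y) \<in> test_functions S" by (rule test_functions_mult[OF s\<psi> \<theta>])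
  have pdt: "pd i (\<lambda>y. \<psi> (x - y) * \<theta> y) y = \<psi> (x - y) * pd i \<theta> y - pd i \<psi> (x - y) * \<theta> y" for y
    using pd_mult[OF s\<psi> s\<theta>, of y i] pd_reflect(2)[OF smooth_compactD[OF \<psi>] i, of x y] by simp
  have j1: "integrable lborel (\<lambda>y. \<psi> (x - y) * (pd i \<theta> y * z y))"
    by (rule smooth_compact_mult_integrable[OF \<psi> i\<theta>(2)[OF iz]])
  have j2: "integrable lborel (\<lambda>y. pd i \<psi> (x - y) * (\<theta> y * z y))"
    by (rule smooth_compact_mult_integrable[OF smooth_compact_pd[OF \<psi> i] i\<theta>(1)[OF iz]])
  have j3: "integrable lborel (\<lambda>y. \<psi> (x - y) * (\<theta> y * p y))"
    by (rule smooth_compact_mult_integrable[OF \<psi> i\<theta>(1)[OF ip]])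
  have "(LINT y|lborel. \<psi> (x - y) * (pd i \<theta> y * z y)) - (LINT y|lborel. pd i \<psi> (x - y) * (\<theta> y * z y))
      = - (LINT y|lborel. \<psi> (x - y) * (\<theta> y * p y))"
    using weak[OF t] j1 j2 by (simp add: pdt left_diff_distrib mult.assoc)
  then show ?thesis
    unfolding mollify_pd[OF \<psi> i\<theta>(1)[OF iz] i] mollify_def using j1 j3 by (simp add: distrib_left)
qed

lemma cutoff_approx:
  fixes z :: "'a::euclidean_space \<Rightarrow> real"
  assumes zm [measurable]: "z \<in> borel_measurable borel" and pm: "\<And>i. i \<in> Basis \<Longrightarrow> p i \<in> borel_measurable borel"
    and iz: "integrable lborel (\<lambda>x. (z x)\<^sup>2)" and ip: "\<And>i. i \<in> Basis \<Longrightarrow> integrable lborel (\<lambda>x. (p i x)\<^sup>2)"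
    and z0: "\<And>x. x \<notin> ball 0 \<rho> \<Longrightarrow> z x = 0" and p0: "\<And>i x. i \<in> Basis \<Longrightarrow> x \<notin> ball 0 \<rho> \<Longrightarrow> p i x = 0"
    and weak: "\<And>i \<phi>. i \<in> Basis \<Longrightarrow> \<phi> \<in> test_functions (ball 0 \<rho>) \<Longrightarrow>
      (LINT y|lborel. pd i \<phi> y * z y) = - (LINT y|lborel. \<phi> y * p i y)"
    and \<theta>: "\<theta> \<in> test_functions (ball 0 \<rho>)" and e: "e > 0" and \<rho>: "\<rho> > 0"
  obtains \<phi> where "\<phi> \<in> test_functions (ball 0 \<rho>)"
    "integrable lborel (\<lambda>x. (\<phi> x - \<theta> x * z x)\<^sup>2)" "(LINT x|lborel. (\<phi> x - \<theta> x * z x)\<^sup>2) \<le> e"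
    "\<And>i. i \<in> Basis \<Longrightarrow> integrable lborel (\<lambda>x. (pd i \<phi> x - (\<theta> x * p i x + pd i \<theta> x * z x))\<^sup>2)"
    "\<And>i. i \<in> Basis \<Longrightarrow> (LINT x|lborel. (pd i \<phi> x - (\<theta> x * p i x + pd i \<theta> x * z x))\<^sup>2) \<le> e"
proof -
  let ?S = "ball (0::'a) \<rho>"
  define g where "g x = \<theta> x * z x" for x
  define G where "G i x = \<theta> x * p i x + pd i \<theta> x * z x" for i x
  have s\<theta>: "smooth \<theta>" by (rule test_functions_smooth[OF \<theta>])
  have \<theta>m [measurable]: "\<theta> \<in> borel_measurable borel" by (rule smooth_measurable[OF s\<theta>])
  have \<theta>pm: "pd i \<theta> \<in> borel_measurable borel" if "i \<in> Basis" for i by (rule smooth_measurable[OF smooth_pd[OF s\<theta> that]])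
  obtain B where B: "\<And>x. \<bar>\<theta> x\<bar> \<le> B" using smooth_compact_bounded[OF test_functions_smooth_compact[OF \<theta>]] by blast
  have g2: "integrable lborel (\<lambda>x. (g x)\<^sup>2)"
    unfolding g_def by (rule square_integrable_bounded_mult[OF iz _ _ B]) simp_all
  have gm: "g \<in> borel_measurable borel" unfolding g_def by measurable
  have g1: "integrable lborel g"
    by (rule square_integrable_imp_integrable[OF gm g2, of \<rho>]) (use z0 in \<open>simp add: g_def\<close>)
  have Gm: "G i \<in> borel_measurable borel" if "i \<in> Basis" for i
    unfolding G_def using pm[OF that] \<theta>pm[OF that] by measurable
  have G2: "integrable lborel (\<lambda>x. (G i x)\<^sup>2)" if i: "i \<in> Basis" for i
  proof -
    obtain C where C: "\<And>x. \<bar>pd i \<theta> x\<bar> \<le> C"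
      using smooth_compact_bounded[OF smooth_compact_pd[OF test_functions_smooth_compact[OF \<theta>] i]] by blast
    have "integrable lborel (\<lambda>x. (\<theta> x * p i x)\<^sup>2)"
      by (rule square_integrable_bounded_mult[OF ip[OF i] _ _ B]) (simp_all add: pm[OF i])
    moreover have "integrable lborel (\<lambda>x. (pd i \<theta> x * z x)\<^sup>2)"
      by (rule square_integrable_bounded_mult[OF iz _ _ C]) (simp_all add: \<theta>pm[OF i])
    ultimately show ?thesis
      unfolding G_def by (rule square_integrable_add) (use pm[OF i] \<theta>pm[OF i] in simp_all)
  qed
  have G1: "integrable lborel (G i)" if i: "i \<in> Basis" for i
    by (rule square_integrable_imp_integrable[OF Gm[OF i] G2[OF i], of \<rho>]) (use z0 p0[OF i] in \<open>simp add: G_def\<close>)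
  have mt: "\<exists>d>0. \<forall>\<epsilon>\<le>d. \<forall>\<psi>. mollifier \<epsilon> \<psi> \<longrightarrow>
      integrable lborel (\<lambda>x. (mollify \<psi> k x - k x)\<^sup>2) \<and> (LINT x|lborel. (mollify \<psi> k x - k x)\<^sup>2) \<le> e"
    if k: "integrable lborel k" "integrable lborel (\<lambda>x. (k x)\<^sup>2)" for k :: "'a \<Rightarrow> real"
    by (rule mollify_tendsto[OF k(1), of 2 e]) (use k e in auto)
  obtain d1 where d1: "d1 > 0" "\<forall>\<epsilon>\<le>d1. \<forall>\<psi>. mollifier \<epsilon> \<psi> \<longrightarrow>
      integrable lborel (\<lambda>x. (mollify \<psi> g x - g x)\<^sup>2) \<and> (LINT x|lborel. (mollify \<psi> g x - g x)\<^sup>2) \<le> e"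
    using mt[OF g1 g2] by blast
  have "\<exists>d>0. \<forall>i\<in>Basis. \<forall>\<epsilon>\<le>d. \<forall>\<psi>. mollifier \<epsilon> \<psi> \<longrightarrow>
      integrable lborel (\<lambda>x. (mollify \<psi> (G i) x - G i x)\<^sup>2) \<and> (LINT x|lborel. (mollify \<psi> (G i) x - G i x)\<^sup>2) \<le> e"
    by (rule finite_min_bound[OF finite_Basis]) (rule mt[OF G1 G2])
  then obtain d2 where d2: "d2 > 0" "\<forall>i\<in>Basis. \<forall>\<epsilon>\<le>d2. \<forall>\<psi>. mollifier \<epsilon> \<psi> \<longrightarrow>
      integrable lborel (\<lambda>x. (mollify \<psi> (G i) x - G i x)\<^sup>2) \<and> (LINT x|lborel. (mollify \<psi> (G i) x - G i x)\<^sup>2) \<le> e"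
    by blast
  obtain K where K: "compact K" "K \<subseteq> ?S" "\<And>x. x \<notin> K \<Longrightarrow> \<theta> x = 0" by (rule test_functionsD[OF \<theta>]) blast
  have "\<exists>r\<ge>0. r < \<rho> \<and> (\<forall>x\<in>K. norm x \<le> r)"
  proof (cases "K = {}")
    case False
    then obtain x where x: "x \<in> K" "\<forall>y\<in>K. norm y \<le> norm x"
      using continuous_attains_sup[OF K(1) _ continuous_on_norm_id] by blast
    then show ?thesis using K(2) by (intro exI[of _ "norm x"]) auto
  qed (use \<rho> in auto)
  then obtain r where r: "r \<ge> 0" "r < \<rho>" "\<And>x. x \<in> K \<Longrightarrow> norm x \<le> r" by blast
  define \<epsilon> where "\<epsilon> = min (min d1 d2) ((\<rho> - r) / 2)"
  have \<epsilon>: "\<epsilon> > 0" "\<epsilon> \<le> d1" "\<epsilon> \<le> d2" "r + \<epsilon> < \<rho>" using d1(1) d2(1) r by (auto simp: \<epsilon>_def min_def field_simps)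
  obtain \<psi> :: "'a \<Rightarrow> real" where \<psi>: "mollifier \<epsilon> \<psi>" by (rule mollifier_exists[OF \<epsilon>(1)])
  have sc: "smooth_compact \<psi>" by (rule mollifier_smooth_compact[OF \<psi>])
  have pdm: "pd i (mollify \<psi> g) x = mollify \<psi> (G i) x" if i: "i \<in> Basis" for i x
    unfolding g_def G_def
    by (rule mollify_cutoff_pd[OF square_integrable_imp_integrable[OF zm iz z0]
          square_integrable_imp_integrable[OF pm[OF i] ip[OF i] p0[OF i]] weak[OF i] \<theta> i sc])
  show ?thesis
  proof (rule that[of "mollify \<psi> g"])
    show "mollify \<psi> g \<in> test_functions ?S"
    proof (rule test_functionsI[OF smooth_mollify[OF sc g1], of "cball 0 (r + \<epsilon>)"])
      show "cball 0 (r + \<epsilon>) \<subseteq> ?S" using \<epsilon>(4) by (simp add: cball_subset_ball_iff)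
      fix x :: 'a assume x: "x \<notin> cball 0 (r + \<epsilon>)"
      show "mollify \<psi> g x = 0"
      proof (rule mollify_eq_0[of \<epsilon>])
        show "\<psi> y = 0" if "\<epsilon> \<le> norm y" for y using \<psi> that by (simp add: mollifier_def)
        fix y assume "dist x y < \<epsilon>"
        then have "norm y > r" using x norm_triangle_ineq2[of x y] by (simp add: dist_norm)
        then have "y \<notin> K" using r(3)[of y] by force
        then show "g y = 0" by (simp add: g_def K(3))
      qed
    qed simp
  qed (use d1(2) d2(2) \<epsilon> \<psi> in \<open>auto simp: pdm g_def[symmetric] G_def[symmetric]\<close>)
qed

lemma borel_rep_weak_pderiv:
  fixes z :: "'a::euclidean_space \<Rightarrow> real"
  assumes w: "has_weak_pderiv S i z p" and z': "borel_rep S z z'" and p': "borel_rep S p p'"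
    and S: "S \<in> sets borel" and i: "i \<in> Basis" and \<phi>: "\<phi> \<in> test_functions S"
  shows "(LINT y|lborel. pd i \<phi> y * z' y) = - (LINT y|lborel. \<phi> y * p' y)"
proof -
  have l: "locally_integrable S z" "locally_integrable S p" using w by (auto simp: has_weak_pderiv_def)
  note t = test_functions_pd[OF \<phi> i]
  have "(LINT y|lebesgue_on S. pd i \<phi> y * z y) = (LINT y|lborel. pd i \<phi> y * z' y)"
    by (rule borel_rep_integral(1)[OF S borel_measurable_integrable[OF test_mult_integrable[OF t l(1) S]]
          borel_rep_mult[OF z' test_functions_measurable[OF t]]])
  moreover have "(LINT y|lebesgue_on S. \<phi> y * p y) = (LINT y|lborel. \<phi> y * p' y)"
    by (rule borel_rep_integral(1)[OF S borel_measurable_integrable[OF test_mult_integrable[OF \<phi> l(2) S]]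
          borel_rep_mult[OF p' test_functions_measurable[OF \<phi>]]])
  ultimately show ?thesis using w \<phi> by (simp add: has_weak_pderiv_def)
qed

lemma norm_basis_sum_sq: "(norm (\<Sum>i\<in>Basis. c i *\<^sub>R i))\<^sup>2 = (\<Sum>i\<in>(Basis::'a::euclidean_space set). (c i)\<^sup>2)"
  unfolding power2_norm_eq_inner
  by (subst euclidean_inner) (simp add: power2_eq_square)

lemma weak_grad_AE:
  assumes "\<And>i. i \<in> Basis \<Longrightarrow> has_weak_pderiv (ball 0 \<rho>) i u (g i)"
  shows "AE x in lebesgue_on (ball 0 \<rho>). weak_grad (ball 0 \<rho>) u x = (\<Sum>i\<in>Basis. g i x *\<^sub>R i)"
proof -
  have "AE x in lebesgue_on (ball 0 \<rho>). \<forall>i\<in>Basis. weak_pderiv (ball 0 \<rho>) i u x = g i x"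
    by (rule AE_finite_allI[OF finite_Basis]) (rule weak_pderiv_AE[OF assms])
  then show ?thesis by eventually_elim (simp add: weak_grad_def)
qed

text \<open>The test functions required by the definition of \<open>H10\<close> are mollifications of the cut-off
  function; by uniqueness of weak derivatives the norm may be computed with the product rule.\<close>

lemma cutoff_mult_H10:
  fixes z :: "'a::euclidean_space \<Rightarrow> real"
  assumes \<rho>: "\<rho> > 0" and z: "z \<in> L2 (lebesgue_on (ball 0 \<rho>))"
    and p: "\<And>i. i \<in> Basis \<Longrightarrow> p i \<in> L2 (lebesgue_on (ball 0 \<rho>))"
    and w: "\<And>i. i \<in> Basis \<Longrightarrow> has_weak_pderiv (ball 0 \<rho>) i z (p i)"
    and \<theta>: "\<theta> \<in> test_functions (ball 0 \<rho>)"
  shows "(\<lambda>x. \<theta> x * z x) \<in> H10 (ball 0 \<rho>)"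
proof -
  let ?S = "ball (0::'a) \<rho>"
  let ?G = "\<lambda>i x. \<theta> x * p i x + pd i \<theta> x * z x"
  have S: "?S \<in> sets borel" by simp
  have s\<theta>: "smooth \<theta>" by (rule test_functions_smooth[OF \<theta>])
  have \<theta>m: "\<theta> \<in> borel_measurable borel" by (rule smooth_measurable[OF s\<theta>])
  have \<theta>pm: "pd i \<theta> \<in> borel_measurable borel" if "i \<in> Basis" for i by (rule smooth_measurable[OF smooth_pd[OF s\<theta> that]])
  have [measurable]: "\<theta> \<in> borel_measurable (lebesgue_on ?S)" "z \<in> borel_measurable (lebesgue_on ?S)"
    using z borel_imp_lebesgue_on[OF \<theta>m] by (auto simp: L2_def)
  have pml: "p i \<in> borel_measurable (lebesgue_on ?S)" "pd i \<theta> \<in> borel_measurable (lebesgue_on ?S)" if "i \<in> Basis" for i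
    using p[OF that] borel_imp_lebesgue_on[OF \<theta>pm[OF that]] by (auto simp: L2_def)
  obtain B where B: "\<And>x. \<bar>\<theta> x\<bar> \<le> B" using smooth_compact_bounded[OF test_functions_smooth_compact[OF \<theta>]] by blast
  have zz: "integrable (lebesgue_on ?S) (\<lambda>x. (z x)\<^sup>2)" using z by (simp add: L2_def)
  have pp: "integrable (lebesgue_on ?S) (\<lambda>x. (p i x)\<^sup>2)" if "i \<in> Basis" for i using p[OF that] by (simp add: L2_def)
  have gL2: "(\<lambda>x. \<theta> x * z x) \<in> L2 (lebesgue_on ?S)"
    unfolding L2_def using square_integrable_bounded_mult[OF zz _ _ B] by auto
  have GL2: "?G i \<in> L2 (lebesgue_on ?S)" if i: "i \<in> Basis" for i
  proof -
    obtain C where C: "\<And>x. \<bar>pd i \<theta> x\<bar> \<le> C"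
      using smooth_compact_bounded[OF smooth_compact_pd[OF test_functions_smooth_compact[OF \<theta>] i]] by blast
    note [measurable] = pml[OF i]
    have "integrable (lebesgue_on ?S) (\<lambda>x. (\<theta> x * p i x + pd i \<theta> x * z x)\<^sup>2)"
      by (rule square_integrable_add[OF square_integrable_bounded_mult[OF pp[OF i] _ _ B]
            square_integrable_bounded_mult[OF zz _ _ C]]) simp_all
    then show ?thesis by (simp add: L2_def)
  qed
  have wG: "has_weak_pderiv ?S i (\<lambda>x. \<theta> x * z x) (?G i)" if "i \<in> Basis" for i
    by (rule has_weak_pderiv_smooth_mult[OF S w[OF that] s\<theta> that])
  have H1: "(\<lambda>x. \<theta> x * z x) \<in> H1 ?S"
    unfolding H1_def using gL2 GL2 wG by blast
  obtain z' where z': "borel_rep ?S z z'" by (rule borel_rep_exists[OF S, of z]) simp_all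
  have "\<forall>i\<in>Basis. \<exists>p'. borel_rep ?S (p i) p'"
  proof
    fix i :: 'a assume "i \<in> Basis"
    from pml(1)[OF this] show "\<exists>p'. borel_rep ?S (p i) p'" by (rule borel_rep_exists[OF S]) blast
  qed
  from bchoice[OF this] obtain p' where p': "\<And>i. i \<in> Basis \<Longrightarrow> borel_rep ?S (p i) (p' i)" by blast
  have "\<exists>\<phi>\<in>test_functions ?S. H1_norm ?S (\<lambda>x. \<theta> x * z x - \<phi> x) < \<epsilon>" if \<epsilon>: "\<epsilon> > 0" for \<epsilon>
  proof -
    define e where "e = \<epsilon>\<^sup>2 / (2 * (1 + real DIM('a)))"
    have e: "e > 0" using \<epsilon> by (simp add: e_def add_pos_nonneg)
    obtain \<phi> where \<phi>: "\<phi> \<in> test_functions ?S"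
      and a1: "integrable lborel (\<lambda>x. (\<phi> x - \<theta> x * z' x)\<^sup>2)" "(LINT x|lborel. (\<phi> x - \<theta> x * z' x)\<^sup>2) \<le> e"
      and a2: "\<And>i. i \<in> Basis \<Longrightarrow> integrable lborel (\<lambda>x. (pd i \<phi> x - (\<theta> x * p' i x + pd i \<theta> x * z' x))\<^sup>2)"
        "\<And>i. i \<in> Basis \<Longrightarrow> (LINT x|lborel. (pd i \<phi> x - (\<theta> x * p' i x + pd i \<theta> x * z' x))\<^sup>2) \<le> e"
    proof (rule cutoff_approx[of z' p' \<rho> \<theta> e])
      show "integrable lborel (\<lambda>x. (z' x)\<^sup>2)"
        using borel_rep_integral(2)[OF S _ borel_rep_power2[OF z']] zz by blast
      show "integrable lborel (\<lambda>x. (p' i x)\<^sup>2)" if "i \<in> Basis" for i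
        using borel_rep_integral(2)[OF S _ borel_rep_power2[OF p'[OF that]]] pp[OF that] by blast
      show "(LINT y|lborel. pd i \<phi> y * z' y) = - (LINT y|lborel. \<phi> y * p' i y)"
        if "i \<in> Basis" "\<phi> \<in> test_functions ?S" for i \<phi>
        by (rule borel_rep_weak_pderiv[OF w[OF that(1)] z' p'[OF that(1)] S that])
    qed (use z' p' \<theta> e \<rho> in \<open>auto simp: borel_rep_def\<close>)
    have sub: "AE x in lebesgue_on ?S. weak_grad ?S (\<lambda>x. \<theta> x * z x - \<phi> x) x = (\<Sum>i\<in>Basis. (?G i x - pd i \<phi> x) *\<^sub>R i)"
    proof (rule weak_grad_AE)
      fix i :: 'a assume i: "i \<in> Basis"
      have "has_weak_pderiv ?S i (\<lambda>x. \<theta> x * z x + (-1) * \<phi> x) (\<lambda>x. ?G i x + (-1) * pd i \<phi> x)"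
        by (intro has_weak_pderiv_add[OF S wG[OF i] _ i] has_weak_pderiv_cmult[OF S i]
            has_weak_pderiv_smooth[OF S i test_functions_smooth[OF \<phi>]])
      then show "has_weak_pderiv ?S i (\<lambda>x. \<theta> x * z x - \<phi> x) (\<lambda>x. ?G i x - pd i \<phi> x)" by simp
    qed
    let ?F = "\<lambda>x. (\<theta> x * z x - \<phi> x)\<^sup>2 + (norm (weak_grad ?S (\<lambda>x. \<theta> x * z x - \<phi> x) x))\<^sup>2"
    let ?F' = "\<lambda>x. (\<phi> x - \<theta> x * z' x)\<^sup>2 + (\<Sum>i\<in>Basis. (pd i \<phi> x - (\<theta> x * p' i x + pd i \<theta> x * z' x))\<^sup>2)"
    have iF': "integrable lborel ?F'"
      by (intro Bochner_Integration.integrable_add Bochner_Integration.integrable_sum a1 a2)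
    have rep: "borel_rep ?S ?F ?F'"
      unfolding borel_rep_def
    proof (intro conjI allI impI)
      show "?F' \<in> borel_measurable borel" using iF' by auto
      obtain K where K: "K \<subseteq> ?S" "\<And>x. x \<notin> K \<Longrightarrow> \<phi> x = 0" "\<And>x i. x \<notin> K \<Longrightarrow> pd i \<phi> x = 0"
        by (rule test_functionsD[OF \<phi>]) blast
      fix x assume x: "x \<notin> ?S"
      then have "x \<notin> K" using K(1) by blast
      then show "?F' x = 0" using x z' p' K(2,3)[of x] by (auto simp: borel_rep_def intro!: sum.neutral)
    next
      have "AE x in lebesgue_on ?S. \<forall>i\<in>Basis. p' i x = p i x"
        by (rule AE_finite_allI[OF finite_Basis]) (use p' in \<open>simp add: borel_rep_def\<close>)
      moreover have "AE x in lebesgue_on ?S. z' x = z x" using z' by (simp add: borel_rep_def)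
      ultimately show "AE x in lebesgue_on ?S. ?F' x = ?F x"
        using sub by eventually_elim (simp add: norm_basis_sum_sq power2_commute)
    qed
    have "(LINT x|lebesgue_on ?S. ?F x) = (LINT x|lborel. ?F' x)"
      by (rule borel_rep_integral(1)[OF S borel_rep_measurable[OF S rep] rep])
    also have "\<dots> = (LINT x|lborel. (\<phi> x - \<theta> x * z' x)\<^sup>2) + (\<Sum>i\<in>Basis. LINT x|lborel. (pd i \<phi> x - (\<theta> x * p' i x + pd i \<theta> x * z' x))\<^sup>2)"
      using a1 a2 by (simp add: Bochner_Integration.integral_sum)
    also have "\<dots> \<le> e + (\<Sum>i\<in>(Basis::'a set). e)" by (intro add_mono sum_mono a1 a2)
    also have "\<dots> = e * (1 + real DIM('a))" by (simp add: algebra_simps)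
    also have "\<dots> = \<epsilon>\<^sup>2 / 2"
      unfolding e_def using add_pos_nonneg[of 1 "real DIM('a)"] by (simp add: field_simps)
    also have "\<dots> < \<epsilon>\<^sup>2" using \<epsilon> by simp
    finally have "H1_norm ?S (\<lambda>x. \<theta> x * z x - \<phi> x) < \<epsilon>"
      unfolding H1_norm_def using \<epsilon> by (intro real_less_lsqrt) auto
    then show ?thesis using \<phi> by blast
  qed
  then show ?thesis using H1 by (simp add: H10_def)
qed

section \<open>An isoperimetric inequality\<close>

text \<open>Integrate the derivative along the segment from \<open>x\<close> to \<open>x + h\<close> and exchange the order of
  integration. The sum of the absolute partial derivatives stands in for the norm of the gradient,
  which is harmless since constants depending on the dimension do not matter.\<close>

lemma smooth_compact_translation_le:
  fixes w :: "'a::euclidean_space \<Rightarrow> real"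
  assumes w: "smooth_compact w" and h: "norm h \<le> L"
  shows "integrable lborel (\<lambda>x. \<bar>w (x + h) - w x\<bar>)"
    and "(LINT x|lborel. \<bar>w (x + h) - w x\<bar>) \<le> L * (LINT x|lborel. (\<Sum>i\<in>Basis. \<bar>pd i w x\<bar>))"
proof -
  have wm [measurable]: "w \<in> borel_measurable borel" by (rule smooth_compact_measurable[OF w])
  have sw: "smooth w" by (rule smooth_compactD[OF w])
  have L: "L \<ge> 0" using h norm_ge_zero[of h] by linarith
  define D where "D x = (\<Sum>i\<in>Basis. \<bar>pd i w x\<bar>)" for x
  have iD: "integrable lborel D"
    unfolding D_def by (intro Bochner_Integration.integrable_sum integrable_abs smooth_compact_integrable smooth_compact_pd[OF w])
  have Dm [measurable]: "D \<in> borel_measurable borel" using iD by auto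
  have D0: "D x \<ge> 0" for x unfolding D_def by (intro sum_nonneg) auto
  show int: "integrable lborel (\<lambda>x. \<bar>w (x + h) - w x\<bar>)"
    by (intro integrable_abs Bochner_Integration.integrable_diff integrable_lborel_translate smooth_compact_integrable[OF w])
  have frec: "\<bar>frechet_derivative w (at y) h\<bar> \<le> L * D y" for y
  proof -
    have "\<bar>frechet_derivative w (at y) h\<bar> \<le> (\<Sum>i\<in>Basis. \<bar>(h \<bullet> i) * pd i w y\<bar>)"
      unfolding smooth_frechet_sum[OF sw, of y h] by (rule sum_abs)
    also have "\<dots> \<le> (\<Sum>i\<in>Basis. L * \<bar>pd i w y\<bar>)"
      unfolding abs_mult using Basis_le_norm[of _ h] h
      by (intro sum_mono mult_right_mono) (auto intro: order_trans)
    also have "\<dots> = L * D y" by (simp add: D_def sum_distrib_left)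
    finally show ?thesis .
  qed
  have pt: "ennreal \<bar>w (x + h) - w x\<bar> \<le> (\<integral>\<^sup>+t. ennreal (L * D (x + t *\<^sub>R h)) * indicator {0..1::real} t \<partial>lborel)" for x
  proof -
    let ?f = "\<lambda>t. frechet_derivative w (at (x + t *\<^sub>R h)) h"
    have cont: "continuous_on UNIV ?f"
      unfolding smooth_frechet_sum[OF sw, of _ h]
      by (intro continuous_intros continuous_on_compose2[OF smooth_continuous[OF smooth_pd[OF sw]]]) auto
    have d: "((\<lambda>t. w (x + t *\<^sub>R h)) has_vector_derivative ?f t) (at t within {0..1})" for t
    proof -
      have "((\<lambda>t. w (x + t *\<^sub>R h)) has_derivative (\<lambda>s. frechet_derivative w (at (x + t *\<^sub>R h)) (s *\<^sub>R h))) (at t within {0..1})"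
        by (rule has_derivative_compose[OF _ smooth_has_derivative[OF sw], of "\<lambda>t. x + t *\<^sub>R h"])
          (auto intro!: derivative_eq_intros)
      then show ?thesis
        unfolding has_vector_derivative_def
        by (simp add: linear_cmul[OF has_derivative_linear[OF smooth_has_derivative[OF sw]]])
    qed
    have fi: "integrable lborel (\<lambda>t. indicator {0..1} t *\<^sub>R ?f t)"
      using borel_integrable_atLeastAtMost'[OF continuous_on_subset[OF cont], of 0 1]
      by (simp add: set_integrable_def)
    have "w (x + h) - w x = (LINT t|lborel. indicator {0..1} t *\<^sub>R ?f t)"
      using integral_FTC_Icc[of 0 1 "\<lambda>t. w (x + t *\<^sub>R h)" ?f, OF _ d continuous_on_subset[OF cont]]
      by (simp add: set_lebesgue_integral_def)
    then have "ennreal \<bar>w (x + h) - w x\<bar> \<le> (\<integral>\<^sup>+t. ennreal \<bar>indicator {0..1} t *\<^sub>R ?f t\<bar> \<partial>lborel)"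
      using integral_norm_bound_ennreal[OF fi] by simp
    also have "\<dots> \<le> (\<integral>\<^sup>+t. ennreal (L * D (x + t *\<^sub>R h)) * indicator {0..1::real} t \<partial>lborel)"
      by (intro nn_integral_mono) (auto simp: indicator_def intro!: ennreal_leI frec)
    finally show ?thesis .
  qed
  have "ennreal (LINT x|lborel. \<bar>w (x + h) - w x\<bar>) = (\<integral>\<^sup>+x. ennreal \<bar>w (x + h) - w x\<bar> \<partial>lborel)"
    by (rule nn_integral_eq_integral[OF int, symmetric]) simp
  also have "\<dots> \<le> (\<integral>\<^sup>+x. (\<integral>\<^sup>+t. ennreal (L * D (x + t *\<^sub>R h)) * indicator {0..1::real} t \<partial>lborel) \<partial>lborel)"
    by (rule nn_integral_mono) (rule pt)
  also have "\<dots> = (\<integral>\<^sup>+t. (\<integral>\<^sup>+x. ennreal (L * D (x + t *\<^sub>R h)) * indicator {0..1::real} t \<partial>lborel) \<partial>lborel)"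
    by (rule lborel_pair.Fubini'[symmetric]) measurable
  also have "\<dots> = (\<integral>\<^sup>+t. (\<integral>\<^sup>+x. ennreal (L * D x) \<partial>lborel) * indicator {0..1::real} t \<partial>lborel)"
  proof (rule nn_integral_cong)
    fix t :: real
    have "(\<integral>\<^sup>+x. ennreal (L * D (x + t *\<^sub>R h)) \<partial>lborel) = (\<integral>\<^sup>+x. ennreal (L * D x) \<partial>lborel)"
      by (rule nn_integral_lborel_translate) measurable
    then show "(\<integral>\<^sup>+x. ennreal (L * D (x + t *\<^sub>R h)) * indicator {0..1::real} t \<partial>lborel)
        = (\<integral>\<^sup>+x. ennreal (L * D x) \<partial>lborel) * indicator {0..1::real} t"
      by (simp add: nn_integral_multc)
  qed
  also have "\<dots> = (\<integral>\<^sup>+x. ennreal (L * D x) \<partial>lborel)" by (simp add: nn_integral_cmult_indicator)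
  also have "\<dots> = ennreal (LINT x|lborel. L * D x)"
    by (rule nn_integral_eq_integral) (use iD L D0 in auto)
  finally have "(LINT x|lborel. \<bar>w (x + h) - w x\<bar>) \<le> (LINT x|lborel. L * D x)"
    by (subst (asm) ennreal_le_iff) (use L D0 in \<open>auto intro!: integral_nonneg_AE\<close>)
  then show "(LINT x|lborel. \<bar>w (x + h) - w x\<bar>) \<le> L * (LINT x|lborel. (\<Sum>i\<in>Basis. \<bar>pd i w x\<bar>))"
    by (simp add: D_def)
qed

text \<open>An elementary substitute for the relative isoperimetric inequality, obtained by averaging the
  correlation of \<open>w\<close> with its translates by \<open>h \<in> ball 0 L\<close>. For each such \<open>h\<close> the correlation
  differs from \<open>\<integral> w\<^sup>2\<close> by at most \<open>L\<close> times the total variation, while integrating it over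
  all \<open>h\<close> gives \<open>(\<integral> w)\<^sup>2\<close>. So if \<open>(\<integral> w)\<^sup>2\<close> is small compared with the volume of the
  ball times \<open>\<integral> w\<^sup>2\<close>, then the variation is at least of order \<open>\<integral> w\<^sup>2 / L\<close>.\<close>

lemma smooth_isoperimetric:
  fixes w :: "'a::euclidean_space \<Rightarrow> real"
  assumes w: "smooth_compact w" and w01: "\<And>x. 0 \<le> w x" "\<And>x. w x \<le> 1" and L: "L > 0"
  shows "measure lborel (ball (0::'a) L) * ((LINT x|lborel. (w x)\<^sup>2) - L * (LINT x|lborel. (\<Sum>i\<in>Basis. \<bar>pd i w x\<bar>)))
      \<le> (LINT x|lborel. w x)\<^sup>2"
proof -
  have wm [measurable]: "w \<in> borel_measurable borel" by (rule smooth_compact_measurable[OF w])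
  have i1: "integrable lborel w" by (rule smooth_compact_integrable[OF w])
  have i2: "integrable lborel (\<lambda>x. (w x)\<^sup>2)" using smooth_compact_integrable_power[OF w, of 2] by simp
  have wb: "\<bar>w x\<bar> \<le> 1" for x using w01[of x] by simp
  have i3: "integrable lborel (\<lambda>x. w (x + h) * w x)" for h
    by (rule integrable_bounded_mult[OF i1, of "\<lambda>x. w (x + h)" 1]) (use wb in auto)
  define c where "c = (LINT x|lborel. (w x)\<^sup>2) - L * (LINT x|lborel. (\<Sum>i\<in>Basis. \<bar>pd i w x\<bar>))"
  have cA: "c \<le> (LINT x|lborel. w (x + h) * w x)" if h: "h \<in> ball 0 L" for h
  proof -
    have "(LINT x|lborel. (w x)\<^sup>2) - (LINT x|lborel. w (x + h) * w x) = (LINT x|lborel. (w x)\<^sup>2 - w (x + h) * w x)"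
      using i2 i3 by simp
    also have "\<dots> \<le> (LINT x|lborel. \<bar>w (x + h) - w x\<bar>)"
    proof (rule integral_mono)
      show "integrable lborel (\<lambda>x. \<bar>w (x + h) - w x\<bar>)"
        by (rule smooth_compact_translation_le(1)[OF w, of h L]) (use h in simp)
      fix x
      have "(w x)\<^sup>2 - w (x + h) * w x = (w x - w (x + h)) * w x" by (simp add: power2_eq_square algebra_simps)
      also have "\<dots> \<le> \<bar>w x - w (x + h)\<bar> * 1"
        using w01[of x] by (intro mult_mono) auto
      finally show "(w x)\<^sup>2 - w (x + h) * w x \<le> \<bar>w (x + h) - w x\<bar>" by (simp add: abs_minus_commute)
    qed (use i2 i3 in simp)
    also have "\<dots> \<le> L * (LINT x|lborel. (\<Sum>i\<in>Basis. \<bar>pd i w x\<bar>))"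
      by (rule smooth_compact_translation_le(2)[OF w]) (use h in simp)
    finally show ?thesis by (simp add: c_def)
  qed
  have nnw: "(\<integral>\<^sup>+x. ennreal (w x) \<partial>lborel) = ennreal (LINT x|lborel. w x)"
    by (rule nn_integral_eq_integral[OF i1]) (use w01 in simp)
  have Iw: "(LINT x|lborel. w x) \<ge> 0" by (rule integral_nonneg_AE) (use w01 in simp)
  have "ennreal c * emeasure lborel (ball (0::'a) L) = (\<integral>\<^sup>+h. ennreal c * indicator (ball (0::'a) L) h \<partial>lborel)"
    by (simp add: nn_integral_cmult_indicator)
  also have "\<dots> \<le> (\<integral>\<^sup>+h. (\<integral>\<^sup>+x. ennreal (w (x + h)) * ennreal (w x) \<partial>lborel) \<partial>lborel)"
  proof (rule nn_integral_mono)
    fix h :: 'a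
    have "ennreal c \<le> (\<integral>\<^sup>+x. ennreal (w (x + h) * w x) \<partial>lborel)" if "h \<in> ball 0 L"
      using cA[OF that] nn_integral_eq_integral[OF i3[of h]] w01 by (simp add: ennreal_leI)
    then show "ennreal c * indicator (ball (0::'a) L) h \<le> (\<integral>\<^sup>+x. ennreal (w (x + h)) * ennreal (w x) \<partial>lborel)"
      using w01 by (auto simp: indicator_def ennreal_mult)
  qed
  also have "\<dots> = (\<integral>\<^sup>+x. (\<integral>\<^sup>+h. ennreal (w (x + h)) * ennreal (w x) \<partial>lborel) \<partial>lborel)"
    by (rule lborel_pair.Fubini') measurable
  also have "\<dots> = (\<integral>\<^sup>+x. (\<integral>\<^sup>+h. ennreal (w h) \<partial>lborel) * ennreal (w x) \<partial>lborel)"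
  proof (rule nn_integral_cong)
    fix x
    have "(\<integral>\<^sup>+h. ennreal (w (x + h)) \<partial>lborel) = (\<integral>\<^sup>+h. ennreal (w h) \<partial>lborel)"
      using nn_integral_lborel_translate[of "\<lambda>h. ennreal (w h)" x] by (simp add: add.commute)
    then show "(\<integral>\<^sup>+h. ennreal (w (x + h)) * ennreal (w x) \<partial>lborel) = (\<integral>\<^sup>+h. ennreal (w h) \<partial>lborel) * ennreal (w x)"
      by (simp add: nn_integral_multc)
  qed
  also have "\<dots> = ennreal (LINT x|lborel. w x) * ennreal (LINT x|lborel. w x)"
    by (simp add: nn_integral_cmult nnw)
  also have "\<dots> = ennreal ((LINT x|lborel. w x)\<^sup>2)" using Iw by (simp add: power2_eq_square ennreal_mult)
  finally have main: "ennreal c * emeasure lborel (ball (0::'a) L) \<le> ennreal ((LINT x|lborel. w x)\<^sup>2)" .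
  have em: "emeasure lborel (ball (0::'a) L) = ennreal (measure lborel (ball (0::'a) L))"
    by (rule emeasure_eq_ennreal_measure) (use emeasure_lborel_ball_finite[of "0::'a" L] in \<open>simp add: less_top\<close>)
  have "measure lborel (ball (0::'a) L) * c \<le> (LINT x|lborel. w x)\<^sup>2"
  proof (cases "c \<ge> 0")
    case True
    then show ?thesis using main by (simp add: em ennreal_mult[symmetric] mult.commute)
  next
    case False
    then have "measure lborel (ball (0::'a) L) * c \<le> 0" by (intro mult_nonneg_nonpos) auto
    then show ?thesis using zero_le_power2[of "LINT x|lborel. w x"] by linarith
  qed
  then show ?thesis by (simp add: c_def)
qed

text \<open>The ramp switches between the levels \<open>1/4\<close> and \<open>3/4\<close>: between them the potential is bounded
  below, so the variation of \<open>ramp (g x)\<close> is controlled by the energy.\<close>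

definition ramp :: "real \<Rightarrow> real" where
  "ramp t = step (2 * t - 1 / 2)"

definition ramp' :: "real \<Rightarrow> real" where
  "ramp' t = 2 * deriv step (2 * t - 1 / 2)"

lemma smooth_ramp: "smooth ramp"
  unfolding ramp_def [abs_def]
  by (rule smooth_compose[OF smooth_step])
    (intro smooth_diff smooth_mult smooth_const smooth_linear bounded_linear_ident)

lemma ramp_deriv: "(ramp has_real_derivative ramp' t) (at t)"
  unfolding ramp_def [abs_def] ramp'_def
  by (rule DERIV_cong[OF DERIV_chain2[OF step_deriv]]) (auto intro!: derivative_eq_intros)

lemma ramp_range: "0 \<le> ramp t" "ramp t \<le> 1"
  by (simp_all add: ramp_def step_range)

lemma ramp_0: "t \<le> 1 / 4 \<Longrightarrow> ramp t = 0"
  by (simp add: ramp_def step_0)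

lemma ramp_1: "3 / 4 \<le> t \<Longrightarrow> ramp t = 1"
  by (simp add: ramp_def step_1)

lemma ramp'_0: "t \<le> 1 / 4 \<or> 3 / 4 \<le> t \<Longrightarrow> ramp' t = 0"
  by (auto simp: ramp'_def intro!: step_deriv_0)

lemma ramp_bounds:
  obtains K where "K > 0" "\<And>t. \<bar>ramp' t\<bar> \<le> K" "\<And>s t. \<bar>ramp' s - ramp' t\<bar> \<le> K * \<bar>s - t\<bar>"
    "\<And>s t. \<bar>ramp s - ramp t\<bar> \<le> K * \<bar>s - t\<bar>"
proof -
  obtain M where M: "M > 0" "\<And>t. \<bar>deriv step t\<bar> \<le> M"
    "\<And>s t. \<bar>deriv step s - deriv step t\<bar> \<le> M * \<bar>s - t\<bar>"
    by (rule deriv_step_bounds) blast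
  have b1: "\<bar>ramp' t\<bar> \<le> 4 * M" for t
    using M(2)[of "2 * t - 1 / 2"] M(1) unfolding ramp'_def by linarith
  have b2: "\<bar>ramp' s - ramp' t\<bar> \<le> 4 * M * \<bar>s - t\<bar>" for s t
  proof -
    have "\<bar>ramp' s - ramp' t\<bar> = 2 * \<bar>deriv step (2 * s - 1 / 2) - deriv step (2 * t - 1 / 2)\<bar>"
      unfolding ramp'_def right_diff_distrib[symmetric] abs_mult by simp
    also have "\<dots> \<le> 2 * (M * \<bar>(2 * s - 1 / 2) - (2 * t - 1 / 2)\<bar>)"
      by (intro mult_left_mono M(3)) simp
    also have "\<bar>(2 * s - 1 / 2) - (2 * t - 1 / 2)\<bar> = 2 * \<bar>s - t\<bar>" by (simp add: abs_if)
    finally show ?thesis by simp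
  qed
  have b3: "\<bar>ramp s - ramp t\<bar> \<le> 4 * M * \<bar>s - t\<bar>" for s t
    using field_differentiable_bound[of UNIV ramp ramp' "4 * M" s t] ramp_deriv b1 by auto
  show ?thesis by (rule that[of "4 * M"]) (use M(1) b1 b2 b3 in auto)
qed

lemma ramp_smooth_compact:
  assumes "smooth_compact \<phi>"
  shows "smooth_compact (\<lambda>x. ramp (\<phi> x))" and "pd i (\<lambda>x. ramp (\<phi> x)) x = ramp' (\<phi> x) * pd i \<phi> x"
proof -
  obtain m where m: "\<And>x. m \<le> norm x \<Longrightarrow> \<phi> x = 0" using assms unfolding smooth_compact_def by blast
  have "\<forall>x. m \<le> norm x \<longrightarrow> ramp (\<phi> x) = 0" by (simp add: m ramp_0)
  then show "smooth_compact (\<lambda>x. ramp (\<phi> x))"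
    unfolding smooth_compact_def using smooth_compose[OF smooth_ramp smooth_compactD[OF assms]] by blast
  have "((\<lambda>x. ramp (\<phi> x)) has_derivative (\<lambda>h. ramp' (\<phi> x) * frechet_derivative \<phi> (at x) h)) (at x)"
    by (rule has_derivative_compose[OF smooth_has_derivative[OF smooth_compactD[OF assms]]
          ramp_deriv[unfolded has_field_derivative_def]])
  from fun_cong[OF frechet_derivative_at[OF this], of i]
  show "pd i (\<lambda>x. ramp (\<phi> x)) x = ramp' (\<phi> x) * pd i \<phi> x" by simp
qed

lemma young_mult: assumes "\<delta> > 0" shows "\<bar>a\<bar> * \<bar>b\<bar> \<le> \<delta> * b\<^sup>2 + a\<^sup>2 / (\<delta>::real)"
proof -
  have "0 \<le> (\<delta> * \<bar>b\<bar> - \<bar>a\<bar>)\<^sup>2 + \<delta> * (\<bar>a\<bar> * \<bar>b\<bar>)" using assms by simp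
  then have "\<delta> * (\<bar>a\<bar> * \<bar>b\<bar>) \<le> \<delta>\<^sup>2 * b\<^sup>2 + a\<^sup>2"
    by (simp add: power2_diff power_mult_distrib)
  also have "\<dots> = \<delta> * (\<delta> * b\<^sup>2 + a\<^sup>2 / \<delta>)" using assms by (simp add: field_simps power2_eq_square)
  finally show ?thesis using assms by simp
qed

lemma L1_le_of_L2:
  fixes k :: "'a::euclidean_space \<Rightarrow> real"
  assumes k: "integrable lborel (\<lambda>x. (k x)\<^sup>2)" "(LINT x|lborel. (k x)\<^sup>2) \<le> \<delta>\<^sup>2"
    and km: "k \<in> borel_measurable borel" and \<delta>: "\<delta> > 0" and h: "integrable lborel (\<lambda>x. (h x)\<^sup>2)"
    and hm: "h \<in> borel_measurable borel"
  shows "integrable lborel (\<lambda>x. \<bar>k x\<bar> * \<bar>h x\<bar>)"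
    and "(LINT x|lborel. \<bar>k x\<bar> * \<bar>h x\<bar>) \<le> \<delta> * ((LINT x|lborel. (h x)\<^sup>2) + 1)"
proof -
  have i: "integrable lborel (\<lambda>x. \<delta> * (h x)\<^sup>2 + (k x)\<^sup>2 / \<delta>)" using k(1) h by simp
  show j: "integrable lborel (\<lambda>x. \<bar>k x\<bar> * \<bar>h x\<bar>)"
    by (rule integrable_dominated[OF i]) (use km hm young_mult[OF \<delta>] in auto)
  have "(LINT x|lborel. \<bar>k x\<bar> * \<bar>h x\<bar>) \<le> (LINT x|lborel. \<delta> * (h x)\<^sup>2 + (k x)\<^sup>2 / \<delta>)"
    by (rule integral_mono[OF j i]) (rule young_mult[OF \<delta>])
  also have "\<dots> = \<delta> * (LINT x|lborel. (h x)\<^sup>2) + (LINT x|lborel. (k x)\<^sup>2) / \<delta>" using k(1) h by simp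
  also have "\<dots> \<le> \<delta> * (LINT x|lborel. (h x)\<^sup>2) + \<delta>\<^sup>2 / \<delta>"
    using k(2) \<delta> by (intro add_left_mono divide_right_mono) auto
  also have "\<dots> = \<delta> * ((LINT x|lborel. (h x)\<^sup>2) + 1)" using \<delta> by (simp add: power2_eq_square algebra_simps)
  finally show "(LINT x|lborel. \<bar>k x\<bar> * \<bar>h x\<bar>) \<le> \<delta> * ((LINT x|lborel. (h x)\<^sup>2) + 1)" .
qed

text \<open>Passing to the limit only needs mean-square convergence of the functions and of their
  gradients, since the ramp and its derivative are Lipschitz; a chain rule for weak derivatives is
  avoided. All errors are of order \<open>\<delta>\<close> when the squared distances are at most \<open>\<delta>\<^sup>2\<close>.\<close>

lemma sobolev_isoperimetric:
  fixes g :: "'a::euclidean_space \<Rightarrow> real"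
  assumes gm: "g \<in> borel_measurable borel" and Gm: "\<And>i. i \<in> Basis \<Longrightarrow> G i \<in> borel_measurable borel"
    and g2: "integrable lborel (\<lambda>x. (g x)\<^sup>2)" and G2: "\<And>i. i \<in> Basis \<Longrightarrow> integrable lborel (\<lambda>x. (G i x)\<^sup>2)"
    and g0: "\<And>x. x \<notin> ball 0 \<rho> \<Longrightarrow> g x = 0" and G0: "\<And>i x. i \<in> Basis \<Longrightarrow> x \<notin> ball 0 \<rho> \<Longrightarrow> G i x = 0"
    and app: "\<And>e. e > 0 \<Longrightarrow> \<exists>\<phi>\<in>test_functions (ball 0 \<rho>).
      integrable lborel (\<lambda>x. (\<phi> x - g x)\<^sup>2) \<and> (LINT x|lborel. (\<phi> x - g x)\<^sup>2) \<le> e \<and>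
      (\<forall>i\<in>Basis. integrable lborel (\<lambda>x. (pd i \<phi> x - G i x)\<^sup>2) \<and> (LINT x|lborel. (pd i \<phi> x - G i x)\<^sup>2) \<le> e)"
    and L: "L > 0"
  shows "measure lborel (ball (0::'a) L) *
      ((LINT x|lborel. (ramp (g x))\<^sup>2) - L * (LINT x|lborel. (\<Sum>i\<in>Basis. \<bar>ramp' (g x) * G i x\<bar>)))
      \<le> (LINT x|lborel. ramp (g x))\<^sup>2"
proof -
  let ?S = "ball (0::'a) \<rho>"
  let ?v = "measure lborel (ball (0::'a) L)"
  obtain K where K: "K > 0" "\<And>t. \<bar>ramp' t\<bar> \<le> K" "\<And>s t. \<bar>ramp' s - ramp' t\<bar> \<le> K * \<bar>s - t\<bar>"
    "\<And>s t. \<bar>ramp s - ramp t\<bar> \<le> K * \<bar>s - t\<bar>"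
    by (rule ramp_bounds) blast
  have rm [measurable]: "ramp \<in> borel_measurable borel" by (rule smooth_measurable[OF smooth_ramp])
  have "continuous_on UNIV ramp'"
    unfolding ramp'_def [abs_def]
    by (intro continuous_intros continuous_on_compose2[OF smooth_continuous[OF smooth_deriv_step, of UNIV]]) auto
  then have rm' [measurable]: "ramp' \<in> borel_measurable borel" by (rule borel_measurable_continuous_onI)
  note [measurable] = gm
  define one :: "'a \<Rightarrow> real" where "one = indicator ?S"
  have one: "integrable lborel (\<lambda>x. (one x)\<^sup>2)"
    by (rule integrable_dominated[OF integrable_indicator_cball[of 0 \<rho>]]) (auto simp: one_def indicator_def)
  have onem [measurable]: "one \<in> borel_measurable borel"
    unfolding one_def by (intro borel_measurable_indicator) simp
  define V where "V = (LINT x|lborel. (one x)\<^sup>2) + 1"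
  define A where "A = (LINT x|lborel. (ramp (g x))\<^sup>2)"
  define B where "B = (LINT x|lborel. ramp (g x))"
  define D where "D = (LINT x|lborel. (\<Sum>i\<in>Basis. \<bar>ramp' (g x) * G i x\<bar>))"
  define C where "C = (\<Sum>i\<in>(Basis::'a set). K * V + K * ((LINT x|lborel. (G i x)\<^sup>2) + 1))"
  \<comment> \<open>errors linear in \<open>\<delta>\<close> disappear in the limit, whatever their constants\<close>
  have main: "?v * ((A - 2 * K * (\<delta> * V)) - L * (D + C * \<delta>)) \<le> (B + K * (\<delta> * V))\<^sup>2" if \<delta>: "\<delta> > 0" for \<delta>
  proof -
    obtain \<phi> where \<phi>: "\<phi> \<in> test_functions ?S"
      and a1: "integrable lborel (\<lambda>x. (\<phi> x - g x)\<^sup>2)" "(LINT x|lborel. (\<phi> x - g x)\<^sup>2) \<le> \<delta>\<^sup>2"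
      and a2: "\<And>i. i \<in> Basis \<Longrightarrow> integrable lborel (\<lambda>x. (pd i \<phi> x - G i x)\<^sup>2)"
        "\<And>i. i \<in> Basis \<Longrightarrow> (LINT x|lborel. (pd i \<phi> x - G i x)\<^sup>2) \<le> \<delta>\<^sup>2"
      using app[of "\<delta>\<^sup>2"] \<delta> by auto
    have sc: "smooth_compact \<phi>" by (rule test_functions_smooth_compact[OF \<phi>])
    have \<phi>m [measurable]: "\<phi> \<in> borel_measurable borel" by (rule smooth_compact_measurable[OF sc])
    have pm: "pd i \<phi> \<in> borel_measurable borel" if "i \<in> Basis" for i
      by (rule smooth_compact_measurable[OF smooth_compact_pd[OF sc that]])
    obtain Q where Q: "Q \<subseteq> ?S" "\<And>x. x \<notin> Q \<Longrightarrow> \<phi> x = 0" "\<And>x i. x \<notin> Q \<Longrightarrow> pd i \<phi> x = 0"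
      by (rule test_functionsD[OF \<phi>]) blast
    have out: "\<phi> x = 0" "pd i \<phi> x = 0" if "x \<notin> ?S" for x i using Q that by blast+
    have d1: "integrable lborel (\<lambda>x. \<bar>\<phi> x - g x\<bar> * \<bar>one x\<bar>)" "(LINT x|lborel. \<bar>\<phi> x - g x\<bar> * \<bar>one x\<bar>) \<le> \<delta> * V"
      unfolding V_def by (rule L1_le_of_L2[OF a1 _ \<delta> one onem], measurable)+
    have e1: "\<bar>\<phi> x - g x\<bar> * \<bar>one x\<bar> = \<bar>\<phi> x - g x\<bar>" for x
      using out(1)[of x] g0[of x] by (cases "x \<in> ?S") (auto simp: one_def)
    note d1 = d1[unfolded e1]
    have d2: "integrable lborel (\<lambda>x. \<bar>pd i \<phi> x - G i x\<bar>)" "(LINT x|lborel. \<bar>pd i \<phi> x - G i x\<bar>) \<le> \<delta> * V" if i: "i \<in> Basis" for i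
    proof -
      have e2: "\<bar>pd i \<phi> x - G i x\<bar> * \<bar>one x\<bar> = \<bar>pd i \<phi> x - G i x\<bar>" for x
        using out(2)[of x] G0[OF i, of x] by (cases "x \<in> ?S") (auto simp: one_def)
      have m: "(\<lambda>x. pd i \<phi> x - G i x) \<in> borel_measurable borel" using pm[OF i] Gm[OF i] by measurable
      show "integrable lborel (\<lambda>x. \<bar>pd i \<phi> x - G i x\<bar>)" "(LINT x|lborel. \<bar>pd i \<phi> x - G i x\<bar>) \<le> \<delta> * V"
        unfolding V_def using L1_le_of_L2[OF a2[OF i] m \<delta> one onem] unfolding e2 by auto
    qed
    have d3: "integrable lborel (\<lambda>x. \<bar>\<phi> x - g x\<bar> * \<bar>G i x\<bar>)"
      "(LINT x|lborel. \<bar>\<phi> x - g x\<bar> * \<bar>G i x\<bar>) \<le> \<delta> * ((LINT x|lborel. (G i x)\<^sup>2) + 1)" if i: "i \<in> Basis" for i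
    proof -
      have m: "(\<lambda>x. \<phi> x - g x) \<in> borel_measurable borel" by measurable
      show "integrable lborel (\<lambda>x. \<bar>\<phi> x - g x\<bar> * \<bar>G i x\<bar>)"
        "(LINT x|lborel. \<bar>\<phi> x - g x\<bar> * \<bar>G i x\<bar>) \<le> \<delta> * ((LINT x|lborel. (G i x)\<^sup>2) + 1)"
        by (rule L1_le_of_L2[OF a1 m \<delta> G2[OF i] Gm[OF i]])+
    qed
    have scw: "smooth_compact (\<lambda>x. ramp (\<phi> x))" by (rule ramp_smooth_compact(1)[OF sc])
    have iw: "integrable lborel (\<lambda>x. ramp (\<phi> x))" by (rule smooth_compact_integrable[OF scw])
    have iw2: "integrable lborel (\<lambda>x. (ramp (\<phi> x))\<^sup>2)" using smooth_compact_integrable_power[OF scw, of 2] by simp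
    have ig: "integrable lborel (\<lambda>x. ramp (g x))"
      by (rule integrable_dominated[OF one]) (use ramp_range g0 ramp_0 in \<open>auto simp: one_def indicator_def\<close>)
    have ig2: "integrable lborel (\<lambda>x. (ramp (g x))\<^sup>2)"
      by (rule integrable_dominated[OF one]) (use ramp_range g0 ramp_0 in \<open>auto simp: one_def indicator_def intro: power_le_one\<close>)
    have iD: "integrable lborel (\<lambda>x. (\<Sum>i\<in>Basis. \<bar>ramp' (g x) * G i x\<bar>))"
    proof (intro Bochner_Integration.integrable_sum integrable_abs)
      fix i :: 'a assume i: "i \<in> Basis"
      show "integrable lborel (\<lambda>x. ramp' (g x) * G i x)"
        by (rule integrable_bounded_mult[OF square_integrable_imp_integrable[OF Gm[OF i] G2[OF i] G0[OF i]] _ K(2)]) measurable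
    qed
    have iE: "integrable lborel (\<lambda>x. (\<Sum>i\<in>Basis. \<bar>pd i (\<lambda>x. ramp (\<phi> x)) x\<bar>))"
      by (intro Bochner_Integration.integrable_sum integrable_abs smooth_compact_integrable smooth_compact_pd[OF scw])
    have "A - (LINT x|lborel. (ramp (\<phi> x))\<^sup>2) = (LINT x|lborel. (ramp (g x))\<^sup>2 - (ramp (\<phi> x))\<^sup>2)"
      unfolding A_def using iw2 ig2 by simp
    also have "\<dots> \<le> (LINT x|lborel. 2 * K * \<bar>\<phi> x - g x\<bar>)"
    proof (rule integral_mono)
      fix x
      have "(ramp (g x))\<^sup>2 - (ramp (\<phi> x))\<^sup>2 = (ramp (g x) + ramp (\<phi> x)) * (ramp (g x) - ramp (\<phi> x))"
        by (simp add: power2_eq_square algebra_simps)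
      also have "\<dots> \<le> (ramp (g x) + ramp (\<phi> x)) * \<bar>ramp (g x) - ramp (\<phi> x)\<bar>"
        using ramp_range[of "g x"] ramp_range[of "\<phi> x"] by (intro mult_left_mono) auto
      also have "\<dots> \<le> 2 * \<bar>ramp (g x) - ramp (\<phi> x)\<bar>"
        using ramp_range[of "g x"] ramp_range[of "\<phi> x"] by (intro mult_right_mono) auto
      also have "\<dots> \<le> 2 * K * \<bar>\<phi> x - g x\<bar>" using K(4)[of "g x" "\<phi> x"] by (simp add: abs_minus_commute)
      finally show "(ramp (g x))\<^sup>2 - (ramp (\<phi> x))\<^sup>2 \<le> 2 * K * \<bar>\<phi> x - g x\<bar>" .
    qed (use iw2 ig2 d1 in auto)
    also have "\<dots> \<le> 2 * K * (\<delta> * V)" using d1 K(1) by simp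
    finally have s1: "A - 2 * K * (\<delta> * V) \<le> (LINT x|lborel. (ramp (\<phi> x))\<^sup>2)" by simp
    have "(LINT x|lborel. ramp (\<phi> x)) - B = (LINT x|lborel. ramp (\<phi> x) - ramp (g x))"
      unfolding B_def using iw ig by simp
    also have "\<dots> \<le> (LINT x|lborel. K * \<bar>\<phi> x - g x\<bar>)"
    proof (rule integral_mono)
      show "ramp (\<phi> x) - ramp (g x) \<le> K * \<bar>\<phi> x - g x\<bar>" for x using K(4)[of "\<phi> x" "g x"] by linarith
    qed (use iw ig d1 in auto)
    also have "\<dots> \<le> K * (\<delta> * V)" using d1 K(1) by simp
    finally have s2: "(LINT x|lborel. ramp (\<phi> x)) \<le> B + K * (\<delta> * V)" by simp
    have s2': "0 \<le> (LINT x|lborel. ramp (\<phi> x))" by (rule integral_nonneg_AE) (simp add: ramp_range)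
    let ?R = "\<lambda>x. (\<Sum>i\<in>Basis. K * \<bar>pd i \<phi> x - G i x\<bar> + K * (\<bar>\<phi> x - g x\<bar> * \<bar>G i x\<bar>))"
    have iR: "integrable lborel ?R"
      by (intro Bochner_Integration.integrable_sum Bochner_Integration.integrable_add integrable_mult_right d2 d3)
    have "(LINT x|lborel. (\<Sum>i\<in>Basis. \<bar>pd i (\<lambda>x. ramp (\<phi> x)) x\<bar>))
        \<le> (LINT x|lborel. (\<Sum>i\<in>Basis. \<bar>ramp' (g x) * G i x\<bar>) + ?R x)"
    proof (rule integral_mono)
      fix x
      have "(\<Sum>i\<in>Basis. \<bar>pd i (\<lambda>x. ramp (\<phi> x)) x\<bar>)
          \<le> (\<Sum>i\<in>Basis. \<bar>ramp' (g x) * G i x\<bar> + (K * \<bar>pd i \<phi> x - G i x\<bar> + K * (\<bar>\<phi> x - g x\<bar> * \<bar>G i x\<bar>)))"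
      proof (rule sum_mono)
        fix i :: 'a
        have "pd i (\<lambda>x. ramp (\<phi> x)) x = ramp' (g x) * G i x + (ramp' (\<phi> x) * (pd i \<phi> x - G i x) + (ramp' (\<phi> x) - ramp' (g x)) * G i x)"
          unfolding ramp_smooth_compact(2)[OF sc] by (simp add: algebra_simps)
        then have "\<bar>pd i (\<lambda>x. ramp (\<phi> x)) x\<bar> \<le> \<bar>ramp' (g x) * G i x\<bar> + (\<bar>ramp' (\<phi> x)\<bar> * \<bar>pd i \<phi> x - G i x\<bar> + \<bar>ramp' (\<phi> x) - ramp' (g x)\<bar> * \<bar>G i x\<bar>)"
          unfolding abs_mult[symmetric] by linarith
        also have "\<dots> \<le> \<bar>ramp' (g x) * G i x\<bar> + (K * \<bar>pd i \<phi> x - G i x\<bar> + (K * \<bar>\<phi> x - g x\<bar>) * \<bar>G i x\<bar>)"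
          by (intro add_left_mono add_mono mult_right_mono K) auto
        finally show "\<bar>pd i (\<lambda>x. ramp (\<phi> x)) x\<bar> \<le> \<bar>ramp' (g x) * G i x\<bar> + (K * \<bar>pd i \<phi> x - G i x\<bar> + K * (\<bar>\<phi> x - g x\<bar> * \<bar>G i x\<bar>))"
          by (simp add: mult.assoc)
      qed
      then show "(\<Sum>i\<in>Basis. \<bar>pd i (\<lambda>x. ramp (\<phi> x)) x\<bar>) \<le> (\<Sum>i\<in>Basis. \<bar>ramp' (g x) * G i x\<bar>) + ?R x"
        by (simp add: sum.distrib)
    qed (use iE iD iR in auto)
    also have "\<dots> = D + (LINT x|lborel. ?R x)" unfolding D_def using iD iR by simp
    also have "(LINT x|lborel. ?R x) = (\<Sum>i\<in>Basis. K * (LINT x|lborel. \<bar>pd i \<phi> x - G i x\<bar>) + K * (LINT x|lborel. \<bar>\<phi> x - g x\<bar> * \<bar>G i x\<bar>))"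
      using d2(1) d3(1) by (simp add: Bochner_Integration.integral_sum)
    also have "\<dots> \<le> (\<Sum>i\<in>Basis. K * (\<delta> * V) + K * (\<delta> * ((LINT x|lborel. (G i x)\<^sup>2) + 1)))"
      using K(1) by (intro sum_mono add_mono mult_left_mono d2 d3) auto
    also have "\<dots> = C * \<delta>" unfolding C_def sum_distrib_right by (intro sum.cong) (auto simp: algebra_simps)
    finally have s3: "(LINT x|lborel. (\<Sum>i\<in>Basis. \<bar>pd i (\<lambda>x. ramp (\<phi> x)) x\<bar>)) \<le> D + C * \<delta>" by simp
    have "?v * ((A - 2 * K * (\<delta> * V)) - L * (D + C * \<delta>))
        \<le> ?v * ((LINT x|lborel. (ramp (\<phi> x))\<^sup>2) - L * (LINT x|lborel. (\<Sum>i\<in>Basis. \<bar>pd i (\<lambda>x. ramp (\<phi> x)) x\<bar>)))"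
      using s1 s3 L by (intro mult_left_mono diff_mono) auto
    also have "\<dots> \<le> (LINT x|lborel. ramp (\<phi> x))\<^sup>2"
      by (rule smooth_isoperimetric[OF scw _ _ L]) (rule ramp_range)+
    also have "\<dots> \<le> (B + K * (\<delta> * V))\<^sup>2" using s2 s2' by (intro power_mono) auto
    finally show ?thesis .
  qed
  have "?v * ((A - 2 * K * (0 * V)) - L * (D + C * 0)) \<le> (B + K * (0 * V))\<^sup>2"
  proof (rule tendsto_le[OF trivial_limit_at_right_real])
    show "((\<lambda>\<delta>. (B + K * (\<delta> * V))\<^sup>2) \<longlongrightarrow> (B + K * (0 * V))\<^sup>2) (at_right 0)" by (intro tendsto_intros)
    show "((\<lambda>\<delta>. ?v * ((A - 2 * K * (\<delta> * V)) - L * (D + C * \<delta>))) \<longlongrightarrow> ?v * ((A - 2 * K * (0 * V)) - L * (D + C * 0))) (at_right 0)"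
      by (intro tendsto_intros)
    show "\<forall>\<^sub>F \<delta> in at_right 0. ?v * ((A - 2 * K * (\<delta> * V)) - L * (D + C * \<delta>)) \<le> (B + K * (\<delta> * V))\<^sup>2"
      by (rule eventually_at_right_less[THEN eventually_mono]) (rule main)
  qed
  then show ?thesis by (simp add: A_def B_def D_def)
qed

section \<open>The potential near a well\<close>

text \<open>The quotient \<open>W t / t\<^sup>2\<close> extends continuously to \<open>0\<close> with the positive value \<open>k / 2\<close>, by
  l'Hopital's rule, and is therefore bounded on compact intervals, and bounded away from zero on those that avoid
  the other zero of \<open>W\<close>.\<close>

lemma quadratic_well:
  fixes W w :: "real \<Rightarrow> real"
  assumes W: "\<And>t. (W has_real_derivative w t) (at t)" and w: "(w has_real_derivative k) (at 0)"
    and w0: "w 0 = 0" and k: "k > 0" and W0: "W 0 = 0"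
    and pos: "\<And>t. t \<noteq> 0 \<Longrightarrow> t \<noteq> 1 \<Longrightarrow> W t > 0"
  obtains c C where "c > 0" "C > 0" "\<And>t. -1/2 \<le> t \<Longrightarrow> t \<le> 3/2 \<Longrightarrow> W t \<le> C * t\<^sup>2"
    "\<And>t. -1/2 \<le> t \<Longrightarrow> t \<le> 3/4 \<Longrightarrow> c * t\<^sup>2 \<le> W t"
proof -
  define q where "q t = (if t = 0 then k / 2 else W t / t\<^sup>2)" for t
  have Wc: "isCont W t" for t using W by (rule DERIV_isCont)
  have "((\<lambda>t. W t / t\<^sup>2) \<longlongrightarrow> k / 2) (at 0)"
  proof (rule lhopital)
    show "(W \<longlongrightarrow> 0) (at 0)" using Wc[of 0] W0 by (simp add: isCont_def)
    show "((\<lambda>t::real. t\<^sup>2) \<longlongrightarrow> 0) (at 0)" by (rule tendsto_eq_intros | simp)+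
    show "\<forall>\<^sub>F t in at 0. t\<^sup>2 \<noteq> (0::real)" by (simp add: eventually_at_filter)
    show "\<forall>\<^sub>F t in at 0. 2 * t \<noteq> (0::real)" by (simp add: eventually_at_filter)
    show "\<forall>\<^sub>F t in at 0. (W has_real_derivative w t) (at t)" using W by simp
    show "\<forall>\<^sub>F t in at 0. ((\<lambda>t. t\<^sup>2) has_real_derivative 2 * t) (at (t::real))"
      by (intro always_eventually allI) (auto intro!: derivative_eq_intros)
    have "((\<lambda>t. w t / t) \<longlongrightarrow> k) (at 0)" using w by (simp add: DERIV_def w0)
    then have "((\<lambda>t. w t / t / 2) \<longlongrightarrow> k / 2) (at 0)" by (intro tendsto_intros) auto
    then show "((\<lambda>t. w t / (2 * t)) \<longlongrightarrow> k / 2) (at 0)" by (simp add: mult.commute)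
  qed
  then have "(q \<longlongrightarrow> q 0) (at 0)"
    by (rule Lim_transform_eventually[THEN tendsto_eq_rhs]) (auto simp: q_def eventually_at_filter)
  then have q0: "isCont q 0" by (simp add: isCont_def)
  have "isCont q t" for t
  proof (cases "t = 0")
    case False
    have "isCont (\<lambda>t. W t / t\<^sup>2) t" using False Wc by (intro continuous_intros) auto
    moreover have "\<forall>\<^sub>F s in nhds t. W s / s\<^sup>2 = q s"
      by (rule eventually_mono[OF eventually_nhds_in_open[of "- {0}" t]]) (use False in \<open>auto simp: q_def\<close>)
    ultimately show ?thesis by (subst (asm) isCont_cong)
  qed (use q0 in simp)
  then have qc: "continuous_on A q" for A by (simp add: continuous_at_imp_continuous_on)
  obtain t1 where t1: "\<And>t. t \<in> {-1/2..3/2} \<Longrightarrow> q t \<le> q t1"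
    using continuous_attains_sup[OF compact_Icc _ qc, of "-1/2" "3/2"] by (auto simp del: atLeastAtMost_iff)
  obtain t2 where t2: "t2 \<in> {-1/2..3/4}" "\<And>t. t \<in> {-1/2..3/4} \<Longrightarrow> q t2 \<le> q t"
    using continuous_attains_inf[OF compact_Icc _ qc, of "-1/2" "3/4"] by (auto simp del: atLeastAtMost_iff)
  have qW: "W t = q t * t\<^sup>2" for t by (simp add: q_def W0)
  show ?thesis
  proof (rule that)
    show "q t2 > 0" using t2(1) pos[of t2] k by (auto simp: q_def)
    show "q t1 > 0" using t1[of 0] k by (simp add: q_def)
    show "W t \<le> q t1 * t\<^sup>2" if "-1/2 \<le> t" "t \<le> 3/2" for t
      unfolding qW[of t] using t1[of t] that by (intro mult_right_mono) auto
    show "q t2 * t\<^sup>2 \<le> W t" if "-1/2 \<le> t" "t \<le> 3/4" for t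
      unfolding qW[of t] using t2(2)[of t] that by (intro mult_right_mono) auto
  qed
qed

lemma potential_deriv:
  assumes f: "continuous_on UNIV f"
  shows "(potential f has_real_derivative - f t) (at t)"
proof -
  define N where "N = \<bar>t\<bar> + 1"
  have "((\<lambda>u. LBINT s=ereal 0..ereal u. f s) has_vector_derivative f t) (at t within {-N..N})"
    using interval_integral_FTC2[of "-N" 0 N f t] continuous_on_subset[OF f, of "{-N..N}"]
    by (simp add: N_def)
  moreover have "at t within {-N..N} = at t" by (rule at_within_interior) (auto simp: N_def abs_if)
  ultimately have "((\<lambda>u. LBINT s=ereal 0..ereal u. f s) has_real_derivative f t) (at t)"
    by (simp add: has_real_derivative_iff_has_vector_derivative)
  then have "((\<lambda>u. - (LBINT s=ereal 0..ereal u. f s)) has_real_derivative - f t) (at t)"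
    by (rule DERIV_minus)
  then show ?thesis by (simp add: potential_def [abs_def])
qed

section \<open>Caratheodory integrands\<close>

lemma floor_approx: "(\<lambda>k. real_of_int \<lfloor>real (Suc k) * t\<rfloor> / real (Suc k)) \<longlonglongrightarrow> t"
proof (rule tendsto_sandwich)
  show "\<forall>\<^sub>F k in sequentially. t - 1 / (real k + 1) \<le> real_of_int \<lfloor>real (Suc k) * t\<rfloor> / real (Suc k)"
  proof (intro always_eventually allI)
    fix k
    have "real (Suc k) * t - 1 \<le> real_of_int \<lfloor>real (Suc k) * t\<rfloor>" by linarith
    then have "(real (Suc k) * t - 1) / real (Suc k) \<le> real_of_int \<lfloor>real (Suc k) * t\<rfloor> / real (Suc k)"
      by (rule divide_right_mono) simp
    moreover have "(real (Suc k) * t - 1) / real (Suc k) = t - 1 / (real k + 1)"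
      by (simp add: diff_divide_distrib add.commute)
    ultimately show "t - 1 / (real k + 1) \<le> real_of_int \<lfloor>real (Suc k) * t\<rfloor> / real (Suc k)" by simp
  qed
  show "\<forall>\<^sub>F k in sequentially. real_of_int \<lfloor>real (Suc k) * t\<rfloor> / real (Suc k) \<le> t"
  proof (intro always_eventually allI)
    fix k
    have "real_of_int \<lfloor>real (Suc k) * t\<rfloor> / real (Suc k) \<le> real (Suc k) * t / real (Suc k)"
      by (intro divide_right_mono) simp_all
    then show "real_of_int \<lfloor>real (Suc k) * t\<rfloor> / real (Suc k) \<le> t" by simp
  qed
  show "(\<lambda>k. t - 1 / (real k + 1)) \<longlonglongrightarrow> t"
    using tendsto_diff[OF tendsto_const lim_inverse_shift[of 1], of t] by simp
qed simp

text \<open>Replace the inner function by its roundings to multiples of \<open>1 / (k + 1)\<close>, which take countably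
  many values, and use continuity in the second argument for the limit.\<close>

lemma caratheodory_measurable:
  assumes G: "caratheodory S G" and S: "S \<in> sets lebesgue" and v: "v \<in> borel_measurable (lebesgue_on S)"
  shows "(\<lambda>x. G x (v x)) \<in> borel_measurable (lebesgue_on S)"
proof -
  let ?L = "lebesgue_on S"
  have Gt: "(\<lambda>x. G x t) \<in> borel_measurable ?L" for t using G by (simp add: caratheodory_def)
  have "AE x in ?L. continuous_on UNIV (G x)" using G by (simp add: caratheodory_def)
  then obtain N where N': "{x \<in> space ?L. \<not> continuous_on UNIV (G x)} \<subseteq> N"
    "emeasure ?L N = 0" "N \<in> sets ?L" by (rule AE_E)
  have N: "N \<in> null_sets ?L" "{x \<in> space ?L. \<not> continuous_on UNIV (G x)} \<subseteq> N"
    using N' by (auto intro: null_setsI)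
  have NS [measurable]: "N \<in> sets ?L" using N(1) by auto
  define H where "H x = (if x \<in> N then 0 else G x (v x))" for x
  define Hk where "Hk k x = (if x \<in> N then 0 else G x (real_of_int \<lfloor>real (Suc k) * v x\<rfloor> / real (Suc k)))" for k x
  have Gk: "(\<lambda>x. G x (real_of_int \<lfloor>real (Suc k) * v x\<rfloor> / real (Suc k))) \<in> borel_measurable ?L" for k
  proof (rule measurable_compose_countable[where f="\<lambda>j x. G x (real_of_int j / real (Suc k))"])
    show "(\<lambda>x. \<lfloor>real (Suc k) * v x\<rfloor>) \<in> ?L \<rightarrow>\<^sub>M count_space UNIV" using v by measurable
  qed (rule Gt)
  have Hkm: "Hk k \<in> borel_measurable ?L" for k
  proof -
    have "{x \<in> space ?L. x \<in> N} = N" using sets.sets_into_space[OF NS] by blast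
    then have "{x \<in> space ?L. x \<in> N} \<in> sets ?L" using NS by simp
    then show ?thesis unfolding Hk_def by (intro measurable_If Gk measurable_const) auto
  qed
  have "H \<in> borel_measurable ?L"
  proof (rule borel_measurable_LIMSEQ_real[OF _ Hkm])
    fix x assume x: "x \<in> space ?L"
    show "(\<lambda>k. Hk k x) \<longlonglongrightarrow> H x"
    proof (cases "x \<in> N")
      case False
      then have "continuous_on UNIV (G x)" using N(2) x by blast
      then have "isCont (G x) (v x)" by (simp add: continuous_on_eq_continuous_at)
      from isCont_tendsto_compose[OF this floor_approx] show ?thesis
        using False by (simp add: Hk_def H_def)
    qed (simp add: Hk_def H_def)
  qed
  then show ?thesis
  proof (rule lebesgue_on_measurable_AE[OF S])
    show "AE x in ?L. H x = G x (v x)"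
      using AE_not_in[OF N(1)] by (rule eventually_mono) (simp add: H_def)
  qed
qed

text \<open>The essential bound on the product holds for almost every \<open>t\<close> on almost every fibre; continuity
  in \<open>t\<close> extends it to every \<open>t\<close>, including the end points.\<close>

lemma caratheodory_bound:
  fixes G :: "'a::euclidean_space \<Rightarrow> real \<Rightarrow> real"
  assumes G: "caratheodory (ball 0 \<rho>) G"
    and le: "Linf_norm (lebesgue_on (ball 0 \<rho> \<times> {-1/2<..<3/2})) (\<lambda>(x, t). G x t) \<le> ereal \<gamma>"
  shows "AE x in lebesgue_on (ball 0 \<rho>). \<forall>t\<in>{-1/2..3/2}. \<bar>G x t\<bar> \<le> \<gamma>"
proof -
  let ?S = "ball (0::'a) \<rho>" and ?I = "{-1/2<..<3/2::real}"
  have SI: "?S \<times> ?I \<in> sets borel" by (intro borel_open open_Times) auto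
  have "AE z in lebesgue_on (?S \<times> ?I). ereal (norm ((\<lambda>(x, t). G x t) z)) \<le> ereal \<gamma>"
    using esssup_AE[where M="lebesgue_on (?S \<times> ?I)" and f="\<lambda>z. ereal (norm ((\<lambda>(x, t). G x t) z))"]
    by (rule eventually_mono) (rule order_trans[OF _ le[unfolded Linf_norm_def]])
  then have "AE z in lborel. z \<in> ?S \<times> ?I \<longrightarrow> \<bar>G (fst z) (snd z)\<bar> \<le> \<gamma>"
    by (simp add: AE_lebesgue_on_iff_lborel[OF SI] case_prod_beta)
  then have "AE z in lborel \<Otimes>\<^sub>M lborel. z \<in> ?S \<times> ?I \<longrightarrow> \<bar>G (fst z) (snd z)\<bar> \<le> \<gamma>"
    unfolding lborel_prod .
  then have "AE x in lborel. AE t in lborel. (x, t) \<in> ?S \<times> ?I \<longrightarrow> \<bar>G (fst (x, t)) (snd (x, t))\<bar> \<le> \<gamma>"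
    by (rule lborel_pair.AE_pair)
  moreover have "AE x in lborel. x \<in> ?S \<longrightarrow> continuous_on UNIV (G x)"
    using G by (simp add: caratheodory_def AE_lebesgue_on_iff_lborel)
  ultimately have "AE x in lborel. x \<in> ?S \<longrightarrow> (\<forall>t\<in>{-1/2..3/2}. \<bar>G x t\<bar> \<le> \<gamma>)"
  proof (eventually_elim, intro impI)
    fix x assume ae: "AE t in lborel. (x, t) \<in> ?S \<times> ?I \<longrightarrow> \<bar>G (fst (x, t)) (snd (x, t))\<bar> \<le> \<gamma>"
      and c: "x \<in> ?S \<longrightarrow> continuous_on UNIV (G x)" and x: "x \<in> ?S"
    have cl: "closed {t. \<bar>G x t\<bar> \<le> \<gamma>}"
      using c x by (intro closed_Collect_le continuous_intros) auto
    have aeI: "AE t \<in> ?I in lebesgue. t \<in> {t. \<bar>G x t\<bar> \<le> \<gamma>}"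
      using ae x by (intro AE_completion) (auto elim!: eventually_mono)
    have "?I \<subseteq> {t. \<bar>G x t\<bar> \<le> \<gamma>}"
      by (rule subsetI) (rule mem_closed_if_AE_lebesgue_open[OF open_greaterThanLessThan cl aeI])
    then have "closure ?I \<subseteq> {t. \<bar>G x t\<bar> \<le> \<gamma>}" using cl by (rule closure_minimal)
    then show "\<forall>t\<in>{-1/2..3/2}. \<bar>G x t\<bar> \<le> \<gamma>" by auto
  qed
  then show ?thesis by (simp add: AE_lebesgue_on_iff_lborel)
qed

section \<open>Comparison of energies\<close>

text \<open>With \<open>\<theta>\<^sup>2\<close> as the cutoff, the gradient of the competitor is \<open>(1 - \<theta>\<^sup>2) p + \<theta> y\<close>. The factor \<open>\<theta>\<close>
  in front of \<open>y\<close> is the reason for squaring: the mixed term can be absorbed into the gain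
  \<open>\<theta>\<^sup>2\<close> on \<open>p\<close>, by testing the form at \<open>\<theta> p - 2 y\<close>.\<close>

lemma quadratic_form_cutoff:
  fixes A :: "real^'n^'n" and p y :: "real^'n"
  assumes sym: "transpose A = A" and lam: "lam > 0" and \<theta>: "0 \<le> \<theta>" "\<theta> \<le> 1"
    and lo: "\<And>\<xi>. lam * (norm \<xi>)\<^sup>2 \<le> (A *v \<xi>) \<bullet> \<xi>" and hi: "\<And>\<xi>. (A *v \<xi>) \<bullet> \<xi> \<le> inverse lam * (norm \<xi>)\<^sup>2"
  shows "(A *v ((1 - \<theta>\<^sup>2) *\<^sub>R p + \<theta> *\<^sub>R y)) \<bullet> ((1 - \<theta>\<^sup>2) *\<^sub>R p + \<theta> *\<^sub>R y)
    \<le> (A *v p) \<bullet> p - lam / 2 * (\<theta>\<^sup>2 * (norm p)\<^sup>2) + 2 * inverse lam * (norm y)\<^sup>2"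
proof -
  define a where "a = (A *v p) \<bullet> p"
  define m where "m = (A *v p) \<bullet> y"
  define d where "d = (A *v y) \<bullet> y"
  define t where "t = \<theta>\<^sup>2"
  have m': "(A *v y) \<bullet> p = m"
    unfolding m_def by (metis dot_lmul_matrix inner_commute sym transpose_matrix_vector)
  have expand: "(A *v (\<mu> *\<^sub>R p + \<nu> *\<^sub>R y)) \<bullet> (\<mu> *\<^sub>R p + \<nu> *\<^sub>R y) = \<mu>\<^sup>2 * a + 2 * \<mu> * \<nu> * m + \<nu>\<^sup>2 * d" for \<mu> \<nu>
    unfolding matrix_vector_right_distrib matrix_vector_mult_scaleR inner_add_left inner_add_right inner_scaleR_left inner_scaleR_right
    by (simp add: a_def[symmetric] m_def[symmetric] d_def[symmetric] m' power2_eq_square algebra_simps)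
  have nn: "(A *v \<xi>) \<bullet> \<xi> \<ge> 0" for \<xi>
    using order_trans[OF _ lo[of \<xi>], of 0] lam by simp
  have a0: "a \<ge> 0" and d0: "d \<ge> 0" unfolding a_def d_def by (rule nn)+
  have t: "0 \<le> t" "t \<le> 1" using \<theta> by (auto simp: t_def power_le_one)
  have "0 \<le> \<theta>\<^sup>2 * a + 2 * \<theta> * (-2) * m + (-2)\<^sup>2 * d" using nn[of "\<theta> *\<^sub>R p + (-2) *\<^sub>R y"] unfolding expand .
  then have cross: "2 * \<theta> * m \<le> t * a / 2 + 2 * d" by (simp add: t_def)
  have "(1 - t)\<^sup>2 * a + 2 * (1 - t) * \<theta> * m + t * d = (1 - t)\<^sup>2 * a + (1 - t) * (2 * \<theta> * m) + t * d" by simp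
  also have "\<dots> \<le> (1 - t)\<^sup>2 * a + (1 - t) * (t * a / 2 + 2 * d) + t * d"
    using cross t by (intro add_mono mult_left_mono) auto
  also have "\<dots> = a - t / 2 * a - (t * (1 - t) / 2 * a + t / 2 * a) + 2 * d - t * d"
    by (simp add: power2_eq_square algebra_simps)
  also have "\<dots> \<le> a - t / 2 * a + 2 * d"
  proof -
    have "0 \<le> t * (1 - t) / 2 * a" "0 \<le> t / 2 * a" "0 \<le> t * d" using t a0 d0 by auto
    then show ?thesis by linarith
  qed
  also have "\<dots> \<le> a - t / 2 * (lam * (norm p)\<^sup>2) + 2 * (inverse lam * (norm y)\<^sup>2)"
    using lo[of p] hi[of y] t unfolding a_def d_def by (intro add_mono diff_mono mult_left_mono) auto
  finally show ?thesis unfolding expand a_def[symmetric] t_def[symmetric]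
    by (simp add: t_def mult_ac)
qed

lemma cutoff_grad_bound:
  assumes M: "\<And>t. \<bar>deriv step t\<bar> \<le> M" and r: "r \<ge> 0"
  shows "norm (\<Sum>i\<in>Basis. pd i (cutoff r (r + 1)) x *\<^sub>R i) \<le> 2 * M * indicator (ball 0 (r + 1) - ball 0 r) (x::'a::euclidean_space)"
proof -
  define s where "s = r + 1"
  have sq: "r\<^sup>2 < s\<^sup>2" using r by (intro power_strict_mono) (auto simp: s_def)
  have den: "s\<^sup>2 - r\<^sup>2 = 2 * r + 1" by (simp add: s_def power2_eq_square algebra_simps)
  define \<tau> where "\<tau> = (s\<^sup>2 - (norm x)\<^sup>2) / (s\<^sup>2 - r\<^sup>2)"
  have "(\<Sum>i\<in>Basis. pd i (cutoff r s) x *\<^sub>R i) = (- 2 / (s\<^sup>2 - r\<^sup>2) * deriv step \<tau>) *\<^sub>R (\<Sum>i\<in>Basis. (x \<bullet> i) *\<^sub>R i)"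
    unfolding pd_cutoff scaleR_sum_right \<tau>_def by (intro sum.cong) (auto simp: field_simps)
  then have n: "norm (\<Sum>i\<in>Basis. pd i (cutoff r s) x *\<^sub>R i) = 2 / (2 * r + 1) * \<bar>deriv step \<tau>\<bar> * norm x"
    using r by (simp add: euclidean_representation den abs_mult)
  show ?thesis
  proof (cases "x \<in> ball 0 (r + 1) - ball 0 r")
    case True
    have M0: "M \<ge> 0" using M[of 0] by simp
    have "2 / (2 * r + 1) * \<bar>deriv step \<tau>\<bar> * norm x \<le> 2 / (2 * r + 1) * M * (r + 1)"
      using True M r M0 by (intro mult_mono mult_left_mono mult_nonneg_nonneg) auto
    also have "\<dots> = M * (2 * (r + 1) / (2 * r + 1))" by simp
    also have "\<dots> \<le> M * 2" using r by (intro mult_left_mono M0) (simp add: field_simps)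
    finally show ?thesis using True n by (simp add: s_def)
  next
    case False
    have "\<tau> \<le> 0 \<or> 1 \<le> \<tau>"
    proof (cases "norm x < r")
      case True
      then have "(norm x)\<^sup>2 \<le> r\<^sup>2" by (intro power_mono) auto
      then show ?thesis using sq by (simp add: \<tau>_def field_simps)
    next
      case F: False
      then have "s \<le> norm x" using False by (auto simp: s_def)
      then have "s\<^sup>2 \<le> (norm x)\<^sup>2" using r by (intro power_mono) (auto simp: s_def)
      then show ?thesis using sq by (simp add: \<tau>_def divide_nonpos_pos)
    qed
    then have "deriv step \<tau> = 0" by (rule step_deriv_0)
    then show ?thesis using n False by (simp add: s_def)
  qed
qed

lemma weak_grad_measurable:
  assumes "\<And>i. i \<in> Basis \<Longrightarrow> has_weak_pderiv (ball 0 \<rho>) i u (g i)"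
  shows "weak_grad (ball 0 \<rho>) u \<in> borel_measurable (lebesgue_on (ball 0 \<rho>))"
proof -
  have "weak_pderiv (ball 0 \<rho>) i u \<in> borel_measurable (lebesgue_on (ball 0 \<rho>))" if "i \<in> Basis" for i
  proof -
    have "has_weak_pderiv (ball 0 \<rho>) i u (weak_pderiv (ball 0 \<rho>) i u)"
      unfolding weak_pderiv_def by (rule someI[where P="has_weak_pderiv (ball 0 \<rho>) i u", OF assms[OF that]])
    then show ?thesis by (auto simp: has_weak_pderiv_def intro: locally_integrable_measurable)
  qed
  then show ?thesis unfolding weak_grad_def [abs_def] by (intro borel_measurable_sum borel_measurable_scaleR) auto
qed

lemma weak_grad_square_integrable:
  assumes w: "\<And>i. i \<in> Basis \<Longrightarrow> has_weak_pderiv (ball 0 \<rho>) i u (g i)"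
    and g: "\<And>i. i \<in> Basis \<Longrightarrow> g i \<in> L2 (lebesgue_on (ball 0 \<rho>))"
  shows "integrable (lebesgue_on (ball 0 \<rho>)) (\<lambda>x. (norm (weak_grad (ball 0 \<rho>) u x))\<^sup>2)"
proof -
  have i: "integrable (lebesgue_on (ball 0 \<rho>)) (\<lambda>x. \<Sum>i\<in>Basis. (g i x)\<^sup>2)"
    by (intro Bochner_Integration.integrable_sum) (use g in \<open>simp add: L2_def\<close>)
  have m: "(\<lambda>x. (norm (weak_grad (ball 0 \<rho>) u x))\<^sup>2) \<in> borel_measurable (lebesgue_on (ball 0 \<rho>))"
    using weak_grad_measurable[OF w] by measurable
  have ae: "AE x in lebesgue_on (ball 0 \<rho>). (\<Sum>i\<in>Basis. (g i x)\<^sup>2) = (norm (weak_grad (ball 0 \<rho>) u x))\<^sup>2"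
  proof -
    have "AE x in lebesgue_on (ball 0 \<rho>). weak_grad (ball 0 \<rho>) u x = (\<Sum>i\<in>Basis. g i x *\<^sub>R i)"
      by (rule weak_grad_AE) (rule w)
    then show ?thesis by eventually_elim (simp add: norm_basis_sum_sq)
  qed
  show ?thesis by (rule integrable_cong_AE_imp[OF i m ae])
qed

lemma quadratic_form_measurable:
  fixes a :: "'a \<Rightarrow> real^'n^'n"
  assumes a: "a \<in> borel_measurable N" and P: "P \<in> borel_measurable N"
  shows "(\<lambda>x. (a x *v P x) \<bullet> P x) \<in> borel_measurable N"
proof (rule borel_measurable_continuous_Pair[OF a P])
  have eq: "(\<lambda>z::(real^'n^'n) \<times> (real^'n). (fst z *v snd z) \<bullet> snd z)
      = (\<lambda>z. \<Sum>i\<in>UNIV. (\<Sum>j\<in>UNIV. fst z $ i $ j * snd z $ j) * snd z $ i)"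
    by (simp add: inner_vec_def matrix_vector_mult_def)
  show "continuous_on UNIV (\<lambda>z::(real^'n^'n) \<times> (real^'n). (fst z *v snd z) \<bullet> snd z)"
    unfolding eq by (intro continuous_intros)
qed

lemma integrable_AE_dominated:
  fixes f g :: "'a \<Rightarrow> real"
  assumes "integrable M f" "g \<in> borel_measurable M" "AE x in M. \<bar>g x\<bar> \<le> f x"
  shows "integrable M g"
proof (rule Bochner_Integration.integrable_bound[OF assms(1,2)])
  show "AE x in M. norm (g x) \<le> norm (f x)" using assms(3) by eventually_elim auto
qed

text \<open>A Caccioppoli inequality. The competitor \<open>(1 - \<theta>\<^sup>2) u + \<theta>\<^sup>2 c\<close> equals the zero \<open>c\<close> of the potential
  on the inner ball and \<open>u\<close> outside the outer one. In the shell its gradient and potential cost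
  at most a multiple of \<open>(u - c)\<^sup>2\<close>, and the lower-order term costs at most \<open>2 \<gamma>\<close> per volume.\<close>

lemma energy_comparison:
  fixes a :: "real^'n \<Rightarrow> real^'n^'n" and u b :: "real^'n \<Rightarrow> real" and G :: "real^'n \<Rightarrow> real \<Rightarrow> real"
    and W :: "real \<Rightarrow> real"
  assumes lam: "lam > 0" and r: "0 \<le> r" "r + 1 < \<rho>"
    and am: "a \<in> borel_measurable (lebesgue_on (ball 0 \<rho>))"
    and sym: "\<And>x. x \<in> ball 0 \<rho> \<Longrightarrow> transpose (a x) = a x"
    and ell: "\<And>x \<xi>. x \<in> ball 0 \<rho> \<Longrightarrow> lam * (norm \<xi>)\<^sup>2 \<le> (a x *v \<xi>) \<bullet> \<xi> \<and> (a x *v \<xi>) \<bullet> \<xi> \<le> inverse lam * (norm \<xi>)\<^sup>2"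
    and bm: "b \<in> borel_measurable (lebesgue_on (ball 0 \<rho>))"
    and bb: "\<And>x. x \<in> ball 0 \<rho> \<Longrightarrow> lam \<le> b x \<and> b x \<le> inverse lam"
    and car: "caratheodory (ball 0 \<rho>) G"
    and Gb: "AE x in lebesgue_on (ball 0 \<rho>). \<forall>t\<in>{-1/2..3/2}. \<bar>G x t\<bar> \<le> \<gamma>"
    and Wc: "continuous_on UNIV W" and W0: "\<And>t. W t \<ge> 0" and Wz: "W c = 0"
    and WC: "\<And>t. -1/2 \<le> t \<Longrightarrow> t \<le> 3/2 \<Longrightarrow> W t \<le> C * (t - c)\<^sup>2" and C: "C \<ge> 0" and c: "0 \<le> c" "c \<le> 1"
    and min: "is_minimizer (ball 0 \<rho>) a b W G u"
    and ub: "AE x in lebesgue_on (ball 0 \<rho>). \<bar>u x - 1/2\<bar> \<le> 1"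
    and M: "\<And>t. \<bar>deriv step t\<bar> \<le> M"
  shows "lam / 2 * (LINT x|lebesgue_on (ball 0 \<rho>). (cutoff r (r + 1) x)\<^sup>2 * (norm (weak_grad (ball 0 \<rho>) u x))\<^sup>2)
      + lam * (LINT x|lebesgue_on (ball 0 \<rho>). indicator (ball 0 r) x * W (u x))
    \<le> (32 * inverse lam * M\<^sup>2 + inverse lam * C) *
        (LINT x|lebesgue_on (ball 0 \<rho>). indicator (ball 0 (r + 1) - ball 0 r) x * (u x - c)\<^sup>2)
      + 2 * \<gamma> * measure lebesgue (ball (0::real^'n) (r + 1))"
    and "integrable (lebesgue_on (ball 0 \<rho>)) (\<lambda>x. (cutoff r (r + 1) x)\<^sup>2 * (norm (weak_grad (ball 0 \<rho>) u x))\<^sup>2)"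
    and "integrable (lebesgue_on (ball 0 \<rho>)) (\<lambda>x. indicator (ball 0 r) x * W (u x))"
proof -
  let ?S = "ball (0::real^'n) \<rho>"
  let ?L = "lebesgue_on ?S"
  let ?E = "energy_density ?S a b W G"
  have S: "?S \<in> sets borel" "?S \<in> sets lebesgue" by auto
  have \<rho>: "\<rho> > 0" using r by linarith
  interpret fm: finite_measure ?L by (rule finite_measure_lebesgue_on) simp
  have one [simp]: "integrable ?L (\<lambda>x. k::real)" for k by simp
  define \<theta> :: "real^'n \<Rightarrow> real" where "\<theta> = cutoff r (r + 1)"
  define \<eta> where "\<eta> x = \<theta> x * \<theta> x" for x
  have t\<theta>: "\<theta> \<in> test_functions ?S" unfolding \<theta>_def by (rule cutoff_test_function) (use r in auto)
  have s\<theta>: "smooth \<theta>" by (rule test_functions_smooth[OF t\<theta>])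
  have \<theta>01: "0 \<le> \<theta> x" "\<theta> x \<le> 1" for x by (simp_all add: \<theta>_def cutoff_range)
  have \<eta>01: "0 \<le> \<eta> x" "\<eta> x \<le> 1" for x using \<theta>01[of x] by (auto simp: \<eta>_def mult_le_one)
  have t\<eta>: "\<eta> \<in> test_functions ?S" unfolding \<eta>_def [abs_def] by (rule test_functions_mult[OF s\<theta> t\<theta>])
  have s\<eta>: "smooth \<eta>" by (rule test_functions_smooth[OF t\<eta>])
  have pd\<eta>: "pd i \<eta> x = 2 * \<theta> x * pd i \<theta> x" for i x
    using pd_mult[OF s\<theta> s\<theta>, of x i] by (simp add: \<eta>_def [abs_def])
  have [measurable]: "\<theta> \<in> borel_measurable ?L" "\<eta> \<in> borel_measurable ?L"
    by (rule borel_imp_lebesgue_on[OF smooth_measurable[OF s\<theta>]], rule borel_imp_lebesgue_on[OF smooth_measurable[OF s\<eta>]])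
  have pd\<eta>m: "pd i \<eta> \<in> borel_measurable ?L" if "i \<in> Basis" for i
    by (rule borel_imp_lebesgue_on[OF smooth_measurable[OF smooth_pd[OF s\<eta> that]]])
  have udom: "u \<in> energy_domain ?S a b W G" using min by (simp add: is_minimizer_def)
  have uH1: "u \<in> H1 ?S" and uLinf: "u \<in> Linf ?L" and ieu: "integrable ?L (?E u)"
    using udom by (auto simp: energy_domain_def)
  have um [measurable]: "u \<in> borel_measurable ?L" and u2: "integrable ?L (\<lambda>x. (u x)\<^sup>2)"
    using uH1 by (auto simp: H1_def L2_def)
  from uH1 have "\<forall>i\<in>Basis. \<exists>g. g \<in> L2 ?L \<and> has_weak_pderiv ?S i u g" by (auto simp: H1_def)
  from bchoice[OF this] obtain g where
    g: "\<And>i. i \<in> Basis \<Longrightarrow> g i \<in> L2 ?L" "\<And>i. i \<in> Basis \<Longrightarrow> has_weak_pderiv ?S i u (g i)" by blast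
  have gm: "g i \<in> borel_measurable ?L" and g2: "integrable ?L (\<lambda>x. (g i x)\<^sup>2)" if "i \<in> Basis" for i
    using g(1)[OF that] by (auto simp: L2_def)
  define d where "d x = u x - c" for x
  have dm [measurable]: "d \<in> borel_measurable ?L" unfolding d_def by measurable
  have d2: "integrable ?L (\<lambda>x. (d x)\<^sup>2)"
    using square_integrable_add[of ?L u "\<lambda>x. - c"] u2 by (simp add: d_def)
  have wd: "has_weak_pderiv ?S i d (g i)" if i: "i \<in> Basis" for i
    using has_weak_pderiv_add[OF S(1) g(2)[OF i] has_weak_pderiv_const[OF S(1) i, of "- c"] i]
    by (simp add: d_def [abs_def])
  define v where "v x = u x + (-1) * (\<eta> x * d x)" for x
  define gv where "gv i x = g i x + (-1) * (\<eta> x * g i x + pd i \<eta> x * d x)" for i x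
  have vm [measurable]: "v \<in> borel_measurable ?L" unfolding v_def by measurable
  have wv: "has_weak_pderiv ?S i v (gv i)" if i: "i \<in> Basis" for i
    unfolding v_def [abs_def] gv_def
    by (intro has_weak_pderiv_add[OF S(1) g(2)[OF i] _ i] has_weak_pderiv_cmult[OF S(1) i]
        has_weak_pderiv_smooth_mult[OF S(1) wd[OF i] s\<eta> i])
  obtain B where B: "\<And>x. \<bar>\<eta> x\<bar> \<le> B"
    using smooth_compact_bounded[OF test_functions_smooth_compact[OF t\<eta>]] by blast
  have gvL2: "gv i \<in> L2 ?L" if i: "i \<in> Basis" for i
  proof -
    note [measurable] = gm[OF i] pd\<eta>m[OF i]
    obtain D where D: "\<And>x. \<bar>pd i \<eta> x\<bar> \<le> D"
      using smooth_compact_bounded[OF smooth_compact_pd[OF test_functions_smooth_compact[OF t\<eta>] i]] by blast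
    have "integrable ?L (\<lambda>x. (\<eta> x * g i x + pd i \<eta> x * d x)\<^sup>2)"
      by (rule square_integrable_add[OF square_integrable_bounded_mult[OF g2[OF i] _ _ B]
            square_integrable_bounded_mult[OF d2 _ _ D]]) simp_all
    then have "integrable ?L (\<lambda>x. ((-1) * (\<eta> x * g i x + pd i \<eta> x * d x))\<^sup>2)"
      unfolding power_mult_distrib[of "-1"] by simp
    then have "integrable ?L (\<lambda>x. (gv i x)\<^sup>2)"
      unfolding gv_def by (rule square_integrable_add[OF g2[OF i]]) simp_all
    then show ?thesis unfolding L2_def gv_def by simp
  qed
  have v2: "integrable ?L (\<lambda>x. (v x)\<^sup>2)"
  proof -
    have "integrable ?L (\<lambda>x. ((-1) * (\<eta> x * d x))\<^sup>2)"
      using square_integrable_bounded_mult[OF d2 dm _ B] by simp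
    then show ?thesis unfolding v_def by (rule square_integrable_add[OF u2]) simp_all
  qed
  have vL2: "v \<in> L2 ?L" using v2 by (simp add: L2_def)
  have vH1: "v \<in> H1 ?S" unfolding H1_def using vL2 wv gvL2 by blast
  have vcomb: "v x = (1 - \<eta> x) * u x + \<eta> x * c" for x by (simp add: v_def d_def algebra_simps)
  have vrange: "-1/2 \<le> v x \<and> v x \<le> 3/2" if "\<bar>u x - 1/2\<bar> \<le> 1" for x
  proof -
    have "(1 - \<eta> x) * u x + \<eta> x * c \<le> (1 - \<eta> x) * (3/2) + \<eta> x * (3/2)"
      using \<eta>01[of x] that c by (intro add_mono mult_left_mono) (auto simp: abs_le_iff)
    moreover have "(1 - \<eta> x) * (-1/2) + \<eta> x * (-1/2) \<le> (1 - \<eta> x) * u x + \<eta> x * c"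
      using \<eta>01[of x] that c by (intro add_mono mult_left_mono) (auto simp: abs_le_iff)
    moreover have "(1 - \<eta> x) * k + \<eta> x * k = k" for k by (simp add: left_diff_distrib)
    ultimately show ?thesis unfolding vcomb by (simp only: )
  qed
  have vLinf: "v \<in> Linf ?L"
  proof -
    have "Linf_norm ?L v \<le> ereal (3/2)"
      unfolding Linf_norm_def
    proof (rule esssup_I)
      show "AE x in ?L. ereal (norm (v x)) \<le> ereal (3/2)"
        using ub by eventually_elim (use vrange in \<open>force simp: abs_le_iff\<close>)
    qed measurable
    then have "Linf_norm ?L v < \<infinity>" by (rule le_less_trans) simp
    then show ?thesis using vm by (simp add: Linf_def)
  qed
  have WCd: "W (v x) \<le> C * (d x)\<^sup>2" if "\<bar>u x - 1/2\<bar> \<le> 1" for x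
  proof -
    have "v x - c = (1 - \<eta> x) * d x" by (simp add: vcomb d_def algebra_simps)
    then have "(v x - c)\<^sup>2 = (1 - \<eta> x)\<^sup>2 * (d x)\<^sup>2" by (simp add: power_mult_distrib)
    also have "\<dots> \<le> 1 * (d x)\<^sup>2" using \<eta>01[of x] by (intro mult_right_mono power_le_one) auto
    finally have "C * (v x - c)\<^sup>2 \<le> C * (d x)\<^sup>2" using C by (intro mult_left_mono) auto
    then show ?thesis using WC[of "v x"] vrange[OF that] by linarith
  qed
  have Wm [measurable]: "W \<in> borel_measurable borel" using Wc by (rule borel_measurable_continuous_onI)
  note [measurable] = bm
  have iev: "integrable ?L (?E v)"
    unfolding energy_density_def [abs_def]
  proof (intro Bochner_Integration.integrable_add)
    have Pm: "weak_grad ?S v \<in> borel_measurable ?L" by (rule weak_grad_measurable) (rule wv)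
    have P2: "integrable ?L (\<lambda>x. inverse lam * (norm (weak_grad ?S v x))\<^sup>2)"
      by (intro integrable_mult_right weak_grad_square_integrable[of \<rho> v gv] wv gvL2)
    show "integrable ?L (\<lambda>x. (a x *v weak_grad ?S v x) \<bullet> weak_grad ?S v x)"
    proof (rule integrable_dominated[OF P2 quadratic_form_measurable[OF am Pm]])
      fix x assume "x \<in> space ?L"
      then have x: "x \<in> ?S" by simp
      have "0 \<le> lam * (norm (weak_grad ?S v x))\<^sup>2" using lam by simp
      then show "\<bar>(a x *v weak_grad ?S v x) \<bullet> weak_grad ?S v x\<bar> \<le> inverse lam * (norm (weak_grad ?S v x))\<^sup>2"
        using ell[OF x, of "weak_grad ?S v x"] by linarith
    qed
    have i: "integrable ?L (\<lambda>x. inverse lam * (C * (d x)\<^sup>2))" using d2 by simp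
    show "integrable ?L (\<lambda>x. b x * W (v x))"
    proof (rule integrable_AE_dominated[OF i])
      show "AE x in ?L. \<bar>b x * W (v x)\<bar> \<le> inverse lam * (C * (d x)\<^sup>2)"
        using ub AE_space
      proof eventually_elim
        case (elim x)
        then have "\<bar>b x\<bar> \<le> inverse lam" using bb[of x] lam by auto
        then show ?case unfolding abs_mult using WCd[OF elim(1)] W0[of "v x"] lam by (intro mult_mono) auto
      qed
    qed measurable
    show "integrable ?L (\<lambda>x. G x (v x))"
    proof (rule integrable_AE_dominated[OF one[of \<gamma>] caratheodory_measurable[OF car S(2) vm]])
      show "AE x in ?L. \<bar>G x (v x)\<bar> \<le> \<gamma>" using ub Gb by eventually_elim (use vrange in force)
    qed
  qed
  have vdom: "v \<in> energy_domain ?S a b W G" using vH1 vLinf iev by (simp add: energy_domain_def)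
  have "(\<lambda>x. v x - u x) \<in> H10 ?S"
  proof -
    have t: "(\<lambda>x. (-1) * \<eta> x) \<in> test_functions ?S" by (rule test_functions_mult[OF smooth_const t\<eta>])
    have "(\<lambda>x. ((-1) * \<eta> x) * d x) \<in> H10 ?S"
      by (rule cutoff_mult_H10[OF \<rho> _ g(1) wd t]) (use d2 in \<open>simp_all add: L2_def\<close>)
    moreover have "(\<lambda>x. ((-1) * \<eta> x) * d x) = (\<lambda>x. v x - u x)" by (simp add: v_def)
    ultimately show ?thesis by simp
  qed
  then have "energy ?S a b W G u \<le> energy ?S a b W G v" using min vdom by (simp add: is_minimizer_def)
  then have le: "0 \<le> (LINT x|?L. ?E v x - ?E u x)" using ieu iev by (simp add: energy_def)
  define P where "P = weak_grad ?S u"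
  define Ir :: "real^'n \<Rightarrow> real" where "Ir = indicator (ball 0 r)"
  define Ia :: "real^'n \<Rightarrow> real" where "Ia = indicator (ball 0 (r + 1) - ball 0 r)"
  define I1 :: "real^'n \<Rightarrow> real" where "I1 = indicator (ball 0 (r + 1))"
  have [measurable]: "Ir \<in> borel_measurable ?L" "Ia \<in> borel_measurable ?L" "I1 \<in> borel_measurable ?L"
    unfolding Ir_def Ia_def I1_def by (intro borel_imp_lebesgue_on borel_measurable_indicator; simp)+
  have I01: "\<bar>Ir x\<bar> \<le> 1" "\<bar>Ia x\<bar> \<le> 1" "\<bar>I1 x\<bar> \<le> 1" for x by (auto simp: Ir_def Ia_def I1_def indicator_def)
  define K where "K = 32 * inverse lam * M\<^sup>2 + inverse lam * C"
  define F where "F x = - (lam / 2) * ((\<theta> x)\<^sup>2 * (norm (P x))\<^sup>2) - lam * (Ir x * W (u x)) + K * (Ia x * (d x)\<^sup>2) + 2 * \<gamma> * I1 x" for x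
  have wgu: "AE x in ?L. weak_grad ?S u x = (\<Sum>i\<in>Basis. g i x *\<^sub>R i)" by (rule weak_grad_AE) (rule g)
  have wgv: "AE x in ?L. weak_grad ?S v x = (\<Sum>i\<in>Basis. gv i x *\<^sub>R i)" by (rule weak_grad_AE) (rule wv)
  have pointwise: "AE x in ?L. ?E v x - ?E u x \<le> F x"
    using ub Gb wgu wgv AE_space
  proof eventually_elim
    case (elim x)
    then have x: "x \<in> ?S" by simp
    have ur: "-1/2 \<le> u x" "u x \<le> 3/2" using elim(1) by (auto simp: abs_le_iff)
    define m where "m = (\<Sum>i\<in>Basis. pd i \<theta> x *\<^sub>R i)"
    define y where "y = (- 2 * d x) *\<^sub>R m"
    have "weak_grad ?S v x = (\<Sum>i\<in>Basis. ((1 - (\<theta> x)\<^sup>2) * g i x + \<theta> x * (- 2 * d x) * pd i \<theta> x) *\<^sub>R i)"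
      unfolding elim(4) gv_def pd\<eta> by (intro sum.cong refl arg_cong2[where f=scaleR]) (simp add: \<eta>_def power2_eq_square algebra_simps)
    also have "\<dots> = (1 - (\<theta> x)\<^sup>2) *\<^sub>R P x + \<theta> x *\<^sub>R y"
      unfolding P_def elim(3) y_def m_def scaleR_sum_right sum.distrib[symmetric]
      by (intro sum.cong refl) (simp add: scaleR_add_left [symmetric] mult.assoc scaleR_diff_left)
    finally have gvx: "weak_grad ?S v x = (1 - (\<theta> x)\<^sup>2) *\<^sub>R P x + \<theta> x *\<^sub>R y" .
    have mb: "norm m \<le> 2 * M * Ia x"
      unfolding m_def \<theta>_def Ia_def by (rule cutoff_grad_bound[OF M r(1)])
    have "(norm m)\<^sup>2 \<le> (2 * M * Ia x)\<^sup>2" using mb by (intro power_mono) auto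
    also have "\<dots> = 4 * M\<^sup>2 * Ia x" by (simp add: power2_eq_square Ia_def indicator_def)
    finally have mb2: "(norm m)\<^sup>2 \<le> 4 * M\<^sup>2 * Ia x" .
    have "(norm y)\<^sup>2 = 4 * (d x)\<^sup>2 * (norm m)\<^sup>2" by (simp add: y_def power_mult_distrib)
    also have "\<dots> \<le> 4 * (d x)\<^sup>2 * (4 * M\<^sup>2 * Ia x)" by (intro mult_left_mono mb2) simp
    finally have yb: "(norm y)\<^sup>2 \<le> 16 * M\<^sup>2 * (Ia x * (d x)\<^sup>2)" by (simp add: mult_ac)
    have "(a x *v weak_grad ?S v x) \<bullet> weak_grad ?S v x
        \<le> (a x *v P x) \<bullet> P x - lam / 2 * ((\<theta> x)\<^sup>2 * (norm (P x))\<^sup>2) + 2 * inverse lam * (norm y)\<^sup>2"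
      unfolding gvx by (rule quadratic_form_cutoff[OF sym[OF x] lam \<theta>01]) (use ell[OF x] in auto)
    moreover have "2 * inverse lam * (norm y)\<^sup>2 \<le> 2 * inverse lam * (16 * M\<^sup>2 * (Ia x * (d x)\<^sup>2))"
      using yb lam by (intro mult_left_mono) auto
    ultimately have q: "(a x *v weak_grad ?S v x) \<bullet> weak_grad ?S v x - (a x *v P x) \<bullet> P x
        \<le> - (lam / 2) * ((\<theta> x)\<^sup>2 * (norm (P x))\<^sup>2) + 32 * inverse lam * M\<^sup>2 * (Ia x * (d x)\<^sup>2)" by (simp add: mult_ac)
    have pot: "b x * W (v x) - b x * W (u x) \<le> - lam * (Ir x * W (u x)) + inverse lam * C * (Ia x * (d x)\<^sup>2)"
      and Gx: "G x (v x) - G x (u x) \<le> 2 * \<gamma> * I1 x"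
    proof -
      have bx: "0 < b x" "lam \<le> b x" "b x \<le> inverse lam" using bb[OF x] lam by auto
      have Gb1: "\<bar>G x (u x)\<bar> \<le> \<gamma>" "\<bar>G x (v x)\<bar> \<le> \<gamma>" using elim(2) ur vrange[OF elim(1)] by auto
      consider "norm x < r" | "r \<le> norm x" "norm x < r + 1" | "r + 1 \<le> norm x" by linarith
      then show "b x * W (v x) - b x * W (u x) \<le> - lam * (Ir x * W (u x)) + inverse lam * C * (Ia x * (d x)\<^sup>2)"
      proof cases
        case 1
        then have "\<theta> x = 1" unfolding \<theta>_def by (intro cutoff_1) (use r in auto)
        then have "v x = c" by (simp add: vcomb \<eta>_def)
        moreover have "lam * W (u x) \<le> b x * W (u x)" using bx W0 by (intro mult_right_mono) auto
        ultimately show ?thesis using 1 by (simp add: Wz Ir_def Ia_def)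
      next
        case 2
        have "b x * W (v x) \<le> inverse lam * (C * (d x)\<^sup>2)"
          using bx WCd[OF elim(1)] W0[of "v x"] lam by (intro mult_mono) auto
        moreover have "0 \<le> b x * W (u x)" using bx W0[of "u x"] by simp
        ultimately show ?thesis using 2 by (simp add: Ir_def Ia_def)
      next
        case 3
        then have "\<theta> x = 0" unfolding \<theta>_def by (intro cutoff_0) (use r in auto)
        then have "v x = u x" by (simp add: vcomb \<eta>_def)
        then show ?thesis using 3 by (simp add: Ir_def Ia_def)
      qed
      show "G x (v x) - G x (u x) \<le> 2 * \<gamma> * I1 x"
      proof (cases "norm x < r + 1")
        case True
        then show ?thesis using Gb1 by (simp add: I1_def)
      next
        case False
        then have "\<theta> x = 0" unfolding \<theta>_def by (intro cutoff_0) (use r in auto)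
        then have "v x = u x" by (simp add: vcomb \<eta>_def)
        then show ?thesis using False by (simp add: I1_def)
      qed
    qed
    show ?case
      unfolding energy_density_def F_def K_def using q pot Gx by (simp add: P_def algebra_simps)
  qed
  have i1: "integrable ?L (\<lambda>x. (\<theta> x)\<^sup>2 * (norm (P x))\<^sup>2)"
    by (rule integrable_bounded_mult[where B=1])
      (use weak_grad_square_integrable[of \<rho> u g] g \<theta>01 in \<open>auto simp: P_def power_le_one\<close>)
  have i2: "integrable ?L (\<lambda>x. Ir x * W (u x))"
  proof (rule integrable_AE_dominated)
    show "integrable ?L (\<lambda>x. C * (d x)\<^sup>2)" using d2 by simp
    show "AE x in ?L. \<bar>Ir x * W (u x)\<bar> \<le> C * (d x)\<^sup>2"
      using ub
    proof eventually_elim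
      case (elim x)
      have "\<bar>Ir x * W (u x)\<bar> \<le> 1 * W (u x)"
        unfolding abs_mult using I01[of x] W0[of "u x"] by (intro mult_mono) auto
      also have "1 * W (u x) \<le> C * (d x)\<^sup>2" using WC[of "u x"] elim by (auto simp: d_def abs_le_iff)
      finally show ?case .
    qed
  qed measurable
  have i3: "integrable ?L (\<lambda>x. Ia x * (d x)\<^sup>2)" by (rule integrable_bounded_mult[OF d2 _ I01(2)]) measurable
  have i4: "integrable ?L I1" using integrable_bounded_mult[OF one[of 1], of I1 1] I01 by simp
  have I1i: "(LINT x|?L. I1 x) = measure lebesgue (ball (0::real^'n) (r + 1))"
  proof -
    have sub: "ball (0::real^'n) (r + 1) \<subseteq> ?S" using r by auto
    have "(LINT x|?L. I1 x) = measure ?L (ball 0 (r + 1))"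
      unfolding I1_def using sub by (simp add: Int_absorb2)
    also have "\<dots> = measure lebesgue (ball (0::real^'n) (r + 1))"
      using sub by (intro measure_restrict_space) auto
    finally show ?thesis .
  qed
  have iF: "integrable ?L F" unfolding F_def using i1 i2 i3 i4 by auto
  have "(LINT x|?L. ?E v x - ?E u x) \<le> (LINT x|?L. F x)"
    by (rule integral_mono_AE[OF _ iF pointwise]) (use ieu iev in simp)
  also have "\<dots> = - (lam / 2) * (LINT x|?L. (\<theta> x)\<^sup>2 * (norm (P x))\<^sup>2) - lam * (LINT x|?L. Ir x * W (u x))
      + K * (LINT x|?L. Ia x * (d x)\<^sup>2) + 2 * \<gamma> * measure lebesgue (ball (0::real^'n) (r + 1))"
    unfolding F_def I1i[symmetric] using i1 i2 i3 i4 by simp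
  finally show "lam / 2 * (LINT x|?L. (cutoff r (r + 1) x)\<^sup>2 * (norm (weak_grad ?S u x))\<^sup>2)
      + lam * (LINT x|?L. indicator (ball 0 r) x * W (u x))
    \<le> (32 * inverse lam * M\<^sup>2 + inverse lam * C) * (LINT x|?L. indicator (ball 0 (r + 1) - ball 0 r) x * (u x - c)\<^sup>2)
      + 2 * \<gamma> * measure lebesgue (ball (0::real^'n) (r + 1))"
    using le by (simp add: \<theta>_def P_def Ir_def Ia_def d_def K_def)
  show "integrable ?L (\<lambda>x. (cutoff r (r + 1) x)\<^sup>2 * (norm (weak_grad ?S u x))\<^sup>2)"
    "integrable ?L (\<lambda>x. indicator (ball 0 r) x * W (u x))"
    using i1 i2 by (simp_all add: \<theta>_def P_def Ir_def)
qed

section \<open>Persistence of mass\<close>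

text \<open>The isoperimetric inequality for the ramp of the cut-off function, written in terms of the mass
  and of the energy. Below the level \<open>3/4\<close> the mass is controlled by the potential, and above it by
  the ramp. The ramp and its derivative vanish below the level \<open>1/4\<close>, so wherever they act
  in the shell they are dominated by \<open>z\<^sup>2\<close>.\<close>

lemma mass_spread_estimate:
  fixes u W :: "_ \<Rightarrow> real" and c s :: real
  defines "z \<equiv> \<lambda>x::'a::euclidean_space. s * (u x - c)"
  assumes r: "0 \<le> r" "r + 1 < \<rho>" and uH1: "u \<in> H1 (ball 0 \<rho>)"
    and zb: "AE x in lebesgue_on (ball 0 \<rho>). \<bar>z x\<bar> \<le> 3/2 \<and> -1/2 \<le> z x"
    and s: "s\<^sup>2 = 1" and W0: "\<And>t. W t \<ge> 0" and c0: "c0 > 0"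
    and Wlow: "\<And>t. -1/2 \<le> t \<Longrightarrow> t \<le> 3/4 \<Longrightarrow> c0 * t\<^sup>2 \<le> W (c + s * t)"
    and M: "\<And>t. \<bar>deriv step t\<bar> \<le> M" and Kr: "\<And>t. \<bar>ramp' t\<bar> \<le> Kr"
    and iQ: "integrable (lebesgue_on (ball 0 \<rho>)) (\<lambda>x. (cutoff r (r + 1) x)\<^sup>2 * (norm (weak_grad (ball 0 \<rho>) u x))\<^sup>2)"
    and iU: "integrable (lebesgue_on (ball 0 \<rho>)) (\<lambda>x. indicator (ball 0 r) x * W (u x))"
    and L: "L > 0"
  shows "measure lborel (ball (0::'a) L) *
     (((LINT x|lebesgue_on (ball 0 \<rho>). indicator (ball 0 r) x * (z x)\<^sup>2)
        - (LINT x|lebesgue_on (ball 0 \<rho>). indicator (ball 0 r) x * W (u x)) / c0) / 4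
      - L * (real DIM('a) * Kr * ((LINT x|lebesgue_on (ball 0 \<rho>). (cutoff r (r + 1) x)\<^sup>2 * (norm (weak_grad (ball 0 \<rho>) u x))\<^sup>2)
          + 16 / c0 * (LINT x|lebesgue_on (ball 0 \<rho>). indicator (ball 0 r) x * W (u x))
          + (16 + 16 * M) * (LINT x|lebesgue_on (ball 0 \<rho>). indicator (ball 0 (r + 1) - ball 0 r) x * (z x)\<^sup>2))))
     \<le> (16 * (LINT x|lebesgue_on (ball 0 \<rho>). indicator (ball 0 (r + 1)) x * (z x)\<^sup>2))\<^sup>2"
proof -
  let ?S = "ball (0::'a) \<rho>"
  let ?L = "lebesgue_on ?S"
  have S: "?S \<in> sets borel" by simp
  have \<rho>: "\<rho> > 0" using r by linarith
  interpret fm: finite_measure ?L by (rule finite_measure_lebesgue_on) simp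
  have one [simp]: "integrable ?L (\<lambda>x. k::real)" for k by simp
  define \<theta> :: "'a \<Rightarrow> real" where "\<theta> = cutoff r (r + 1)"
  define \<eta> where "\<eta> x = \<theta> x * \<theta> x" for x
  have t\<theta>: "\<theta> \<in> test_functions ?S" unfolding \<theta>_def by (rule cutoff_test_function) (use r in auto)
  have s\<theta>: "smooth \<theta>" by (rule test_functions_smooth[OF t\<theta>])
  have \<theta>01: "0 \<le> \<theta> x" "\<theta> x \<le> 1" for x by (simp_all add: \<theta>_def cutoff_range)
  have \<eta>01: "0 \<le> \<eta> x" "\<eta> x \<le> 1" for x using \<theta>01[of x] by (auto simp: \<eta>_def mult_le_one)
  have t\<eta>: "\<eta> \<in> test_functions ?S" unfolding \<eta>_def [abs_def] by (rule test_functions_mult[OF s\<theta> t\<theta>])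
  have s\<eta>: "smooth \<eta>" by (rule test_functions_smooth[OF t\<eta>])
  have pd\<eta>: "pd i \<eta> x = 2 * \<theta> x * pd i \<theta> x" for i x
    using pd_mult[OF s\<theta> s\<theta>, of x i] by (simp add: \<eta>_def [abs_def])
  have \<eta>m: "\<eta> \<in> borel_measurable borel" by (rule smooth_measurable[OF s\<eta>])
  have pd\<eta>m: "pd i \<eta> \<in> borel_measurable borel" if "i \<in> Basis" for i by (rule smooth_measurable[OF smooth_pd[OF s\<eta> that]])
  have \<eta>r: "\<eta> x = 1" if "norm x < r" for x
    using cutoff_1[of r "r + 1" x] that r by (simp add: \<eta>_def \<theta>_def)
  have \<eta>0: "\<eta> x = 0" if "r + 1 \<le> norm x" for x
    using cutoff_0[of r "r + 1" x] that r by (simp add: \<eta>_def \<theta>_def)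
  have um: "u \<in> borel_measurable ?L" and u2: "integrable ?L (\<lambda>x. (u x)\<^sup>2)"
    using uH1 by (auto simp: H1_def L2_def)
  from uH1 have "\<forall>i\<in>Basis. \<exists>g. g \<in> L2 ?L \<and> has_weak_pderiv ?S i u g" by (auto simp: H1_def)
  from bchoice[OF this] obtain q where
    q: "\<And>i. i \<in> Basis \<Longrightarrow> q i \<in> L2 ?L" "\<And>i. i \<in> Basis \<Longrightarrow> has_weak_pderiv ?S i u (q i)" by blast
  define p where "p i x = s * q i x" for i x
  have pm: "p i \<in> borel_measurable ?L" and p2: "integrable ?L (\<lambda>x. (p i x)\<^sup>2)" if "i \<in> Basis" for i
    using q(1)[OF that] unfolding p_def L2_def by (auto simp: power_mult_distrib)
  have zm: "z \<in> borel_measurable ?L" unfolding z_def using um by measurable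
  have z2: "integrable ?L (\<lambda>x. (z x)\<^sup>2)"
    using square_integrable_add[of ?L u "\<lambda>x. - c"] u2 um by (simp add: z_def power_mult_distrib)
  have wz: "has_weak_pderiv ?S i z (p i)" if i: "i \<in> Basis" for i
    using has_weak_pderiv_cmult[OF S i has_weak_pderiv_add[OF S q(2)[OF i] has_weak_pderiv_const[OF S i, of "- c"] i], of s]
    by (simp add: z_def p_def [abs_def])
  obtain z' where z': "borel_rep ?S z z'" by (rule borel_rep_exists[OF S zm])
  have "\<forall>i\<in>Basis. \<exists>p'. borel_rep ?S (p i) p'"
  proof
    fix i :: 'a assume "i \<in> Basis"
    from pm[OF this] show "\<exists>p'. borel_rep ?S (p i) p'" by (rule borel_rep_exists[OF S]) blast
  qed
  from bchoice[OF this] obtain p' where p': "\<And>i. i \<in> Basis \<Longrightarrow> borel_rep ?S (p i) (p' i)" by blast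
  have z'm: "z' \<in> borel_measurable borel" and z'0: "\<And>x. x \<notin> ?S \<Longrightarrow> z' x = 0" using z' by (auto simp: borel_rep_def)
  have p'm: "p' i \<in> borel_measurable borel" and p'0: "\<And>x. x \<notin> ?S \<Longrightarrow> p' i x = 0" if "i \<in> Basis" for i
    using p'[OF that] by (auto simp: borel_rep_def)
  have z'2: "integrable lborel (\<lambda>x. (z' x)\<^sup>2)"
    using borel_rep_integral(2)[OF S _ borel_rep_power2[OF z']] z2 by blast
  have p'2: "integrable lborel (\<lambda>x. (p' i x)\<^sup>2)" if "i \<in> Basis" for i
    using borel_rep_integral(2)[OF S _ borel_rep_power2[OF p'[OF that]]] p2[OF that] by blast
  define g where "g x = \<eta> x * z' x" for x
  define G where "G i x = \<eta> x * p' i x + pd i \<eta> x * z' x" for i x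
  obtain B1 where B1: "\<And>x. \<bar>\<eta> x\<bar> \<le> B1"
    using smooth_compact_bounded[OF test_functions_smooth_compact[OF t\<eta>]] by blast
  have gm: "g \<in> borel_measurable borel" unfolding g_def using \<eta>m z'm by measurable
  have Gm: "G i \<in> borel_measurable borel" if "i \<in> Basis" for i
    unfolding G_def using \<eta>m z'm p'm[OF that] pd\<eta>m[OF that] by measurable
  have g2: "integrable lborel (\<lambda>x. (g x)\<^sup>2)"
    unfolding g_def by (rule square_integrable_bounded_mult[OF z'2 _ _ B1]) (use \<eta>m z'm in simp_all)
  have G2: "integrable lborel (\<lambda>x. (G i x)\<^sup>2)" if i: "i \<in> Basis" for i
  proof -
    obtain D where D: "\<And>x. \<bar>pd i \<eta> x\<bar> \<le> D"
      using smooth_compact_bounded[OF smooth_compact_pd[OF test_functions_smooth_compact[OF t\<eta>] i]] by blast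
    show ?thesis unfolding G_def
      by (rule square_integrable_add[OF square_integrable_bounded_mult[OF p'2[OF i] _ _ B1]
            square_integrable_bounded_mult[OF z'2 _ _ D]]) (use \<eta>m z'm p'm[OF i] pd\<eta>m[OF i] in simp_all)
  qed
  have g0: "g x = 0" if "x \<notin> ?S" for x using z'0[OF that] by (simp add: g_def)
  have G0: "G i x = 0" if "i \<in> Basis" "x \<notin> ?S" for i x using z'0[OF that(2)] p'0[OF that] by (simp add: G_def)
  let ?A = "LINT x|lborel. (ramp (g x))\<^sup>2" and ?B = "LINT x|lborel. ramp (g x)"
    and ?D = "LINT x|lborel. (\<Sum>i\<in>Basis. \<bar>ramp' (g x) * G i x\<bar>)"
  have iso: "measure lborel (ball (0::'a) L) * (?A - L * ?D) \<le> ?B\<^sup>2"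
  proof (rule sobolev_isoperimetric[OF gm Gm g2 G2 g0 G0 _ L])
    fix e :: real assume e: "e > 0"
    have w: "(LINT y|lborel. pd i \<phi> y * z' y) = - (LINT y|lborel. \<phi> y * p' i y)"
      if "i \<in> Basis" "\<phi> \<in> test_functions ?S" for i \<phi>
      by (rule borel_rep_weak_pderiv[OF wz[OF that(1)] z' p'[OF that(1)] S that])
    show "\<exists>\<phi>\<in>test_functions ?S. integrable lborel (\<lambda>x. (\<phi> x - g x)\<^sup>2) \<and> (LINT x|lborel. (\<phi> x - g x)\<^sup>2) \<le> e \<and>
      (\<forall>i\<in>Basis. integrable lborel (\<lambda>x. (pd i \<phi> x - G i x)\<^sup>2) \<and> (LINT x|lborel. (pd i \<phi> x - G i x)\<^sup>2) \<le> e)"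
      unfolding g_def G_def
      by (rule cutoff_approx[OF z'm p'm z'2 p'2 z'0 p'0 w t\<eta> e \<rho>]) blast+
  qed
  define I0 :: "'a \<Rightarrow> real" where "I0 = indicator (ball 0 r)"
  define Ia :: "'a \<Rightarrow> real" where "Ia = indicator (ball 0 (r + 1) - ball 0 r)"
  define I1 :: "'a \<Rightarrow> real" where "I1 = indicator (ball 0 (r + 1))"
  have Im [measurable]: "I0 \<in> borel_measurable ?L" "Ia \<in> borel_measurable ?L" "I1 \<in> borel_measurable ?L"
    unfolding I0_def Ia_def I1_def by (intro borel_imp_lebesgue_on borel_measurable_indicator; simp)+
  have I01: "\<bar>I0 x\<bar> \<le> 1" "\<bar>Ia x\<bar> \<le> 1" "\<bar>I1 x\<bar> \<le> 1" for x by (auto simp: I0_def Ia_def I1_def indicator_def)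
  have i0: "integrable ?L (\<lambda>x. I0 x * (z x)\<^sup>2)" by (rule integrable_bounded_mult[OF z2 _ I01(1)]) measurable
  have ia: "integrable ?L (\<lambda>x. Ia x * (z x)\<^sup>2)" by (rule integrable_bounded_mult[OF z2 _ I01(2)]) measurable
  have i1: "integrable ?L (\<lambda>x. I1 x * (z x)\<^sup>2)" by (rule integrable_bounded_mult[OF z2 _ I01(3)]) measurable
  define P where "P = weak_grad ?S u"
  have iQ': "integrable ?L (\<lambda>x. \<eta> x * (norm (P x))\<^sup>2)"
    using iQ by (simp add: \<eta>_def \<theta>_def P_def power2_eq_square)
  have iU': "integrable ?L (\<lambda>x. I0 x * W (u x))" using iU by (simp add: I0_def)
  have rm: "ramp \<in> borel_measurable borel" by (rule smooth_measurable[OF smooth_ramp])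
  have "continuous_on UNIV ramp'"
    unfolding ramp'_def [abs_def]
    by (intro continuous_intros continuous_on_compose2[OF smooth_continuous[OF smooth_deriv_step, of UNIV]]) auto
  then have rm': "ramp' \<in> borel_measurable borel" by (rule borel_measurable_continuous_onI)
  have zz': "AE x in ?L. z' x = z x" using z' by (simp add: borel_rep_def)
  have pp': "AE x in ?L. \<forall>i\<in>Basis. p' i x = p i x"
    by (rule AE_finite_allI[OF finite_Basis]) (use p' in \<open>simp add: borel_rep_def\<close>)
  have wg: "AE x in ?L. P x = (\<Sum>i\<in>Basis. q i x *\<^sub>R i)"
    unfolding P_def by (rule weak_grad_AE) (rule q(2))
  have onL: "integral\<^sup>L lborel h = integral\<^sup>L ?L h" "integrable ?L h \<longleftrightarrow> integrable lborel h"
    if "h \<in> borel_measurable borel" "\<And>x. x \<notin> ?S \<Longrightarrow> h x = 0" for h :: "'a \<Rightarrow> real"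
  proof -
    have rep: "borel_rep ?S h h" using that by (simp add: borel_rep_def)
    show "integral\<^sup>L lborel h = integral\<^sup>L ?L h" "integrable ?L h \<longleftrightarrow> integrable lborel h"
      using borel_rep_integral[OF S borel_rep_measurable[OF S rep] rep] by simp_all
  qed
  have K0: "Kr \<ge> 0" and M0: "M \<ge> 0" using Kr[of 0] M[of 0] by simp_all
  have rg0: "ramp 0 = 0" "ramp' 0 = 0" by (simp_all add: ramp_0 ramp'_0)
  have Am: "(\<lambda>x. (ramp (g x))\<^sup>2) \<in> borel_measurable borel" "(\<lambda>x. ramp (g x)) \<in> borel_measurable borel"
    using rm gm by measurable
  have Dm: "(\<lambda>x. \<Sum>i\<in>Basis. \<bar>ramp' (g x) * G i x\<bar>) \<in> borel_measurable borel"
    by (intro borel_measurable_sum borel_measurable_abs borel_measurable_times measurable_compose[OF gm rm'] Gm)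
  have iA: "integrable ?L (\<lambda>x. (ramp (g x))\<^sup>2)"
    by (rule integrable_dominated[OF one[of 1] borel_imp_lebesgue_on[OF Am(1)]]) (use ramp_range in \<open>simp add: power_le_one\<close>)
  have iB: "integrable ?L (\<lambda>x. ramp (g x))"
    by (rule integrable_dominated[OF one[of 1] borel_imp_lebesgue_on[OF Am(2)]]) (use ramp_range in simp)
  let ?V = "LINT x|?L. I0 x * (z x)\<^sup>2" and ?U = "LINT x|?L. I0 x * W (u x)" and ?V1 = "LINT x|?L. I1 x * (z x)\<^sup>2"
    and ?X = "LINT x|?L. Ia x * (z x)\<^sup>2" and ?Q = "LINT x|?L. \<eta> x * (norm (P x))\<^sup>2"
  have uz: "u x = c + s * z x" for x
    using s by (simp add: z_def power2_eq_square mult.assoc[symmetric])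
  have low: "c0 * (z x)\<^sup>2 \<le> W (u x)" if "-1/2 \<le> z x" "z x \<le> 3/4" for x
    unfolding uz[of x] by (rule Wlow[OF that])
  have "?V \<le> (LINT x|?L. I0 x * W (u x) / c0 + 4 * (ramp (g x))\<^sup>2)"
  proof (rule integral_mono_AE[OF i0])
    show "integrable ?L (\<lambda>x. I0 x * W (u x) / c0 + 4 * (ramp (g x))\<^sup>2)" using iU' iA by simp
    show "AE x in ?L. I0 x * (z x)\<^sup>2 \<le> I0 x * W (u x) / c0 + 4 * (ramp (g x))\<^sup>2"
      using zb zz'
    proof eventually_elim
      case (elim x)
      show ?case
      proof (cases "norm x < r")
        case True
        then have gx: "g x = z x" and Ix: "I0 x = 1" using elim(2) \<eta>r by (auto simp: g_def I0_def)
        show ?thesis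
        proof (cases "z x \<le> 3/4")
          case True
          then have "(z x)\<^sup>2 \<le> W (u x) / c0" using low[of x] elim(1) c0 by (simp add: field_simps)
          then show ?thesis using Ix by (simp add: add_increasing2)
        next
          case False
          have "(z x)\<^sup>2 \<le> (3/2)\<^sup>2" using power_mono[of "\<bar>z x\<bar>" "3/2" 2] elim(1) by simp
          then have "(z x)\<^sup>2 \<le> 4" by (simp add: power2_eq_square)
          moreover have "0 \<le> W (u x) / c0" using W0 c0 by simp
          ultimately show ?thesis using False ramp_1[of "z x"] by (simp add: gx Ix)
        qed
      next
        case False
        then show ?thesis by (simp add: I0_def)
      qed
    qed
  qed
  also have "\<dots> = ?U / c0 + 4 * (LINT x|?L. (ramp (g x))\<^sup>2)" using iU' iA by simp
  also have "(LINT x|?L. (ramp (g x))\<^sup>2) = ?A" by (rule onL(1)[symmetric, OF Am(1)]) (simp add: g0 rg0)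
  finally have eA: "(?V - ?U / c0) / 4 \<le> ?A" by simp
  have "?B = (LINT x|?L. ramp (g x))" by (rule onL(1)[OF Am(2)]) (simp add: g0 rg0)
  also have "\<dots> \<le> (LINT x|?L. 16 * (I1 x * (z x)\<^sup>2))"
  proof (rule integral_mono_AE[OF iB])
    show "integrable ?L (\<lambda>x. 16 * (I1 x * (z x)\<^sup>2))" using i1 by simp
    show "AE x in ?L. ramp (g x) \<le> 16 * (I1 x * (z x)\<^sup>2)"
      using zz'
    proof eventually_elim
      case (elim x)
      show ?case
      proof (cases "g x \<le> 1/4")
        case True
        then show ?thesis by (simp add: ramp_0 I1_def)
      next
        case False
        then have "\<not> r + 1 \<le> norm x" using \<eta>0[of x] by (auto simp: g_def)
        then have Ix: "I1 x = 1" by (simp add: I1_def)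
        have "g x \<le> \<bar>z x\<bar>"
          using \<eta>01[of x] elim mult_left_le_one_le[of "\<bar>z x\<bar>" "\<eta> x"] abs_ge_self[of "\<eta> x * z x"]
          by (simp add: g_def abs_mult)
        then have "(1/4)\<^sup>2 \<le> \<bar>z x\<bar>\<^sup>2" using False by (intro power_mono) auto
        then have "1 \<le> 16 * (z x)\<^sup>2" by (simp add: power2_eq_square)
        then show ?thesis using ramp_range(2)[of "g x"] Ix by simp
      qed
    qed
  qed
  finally have eB: "?B \<le> 16 * ?V1" by simp
  have B0: "0 \<le> ?B" by (rule integral_nonneg_AE) (simp add: ramp_range)
  define n where "n = real DIM('a)"
  have n0: "n \<ge> 0" by (simp add: n_def)
  let ?H = "\<lambda>x. n * Kr * (\<eta> x * (norm (P x))\<^sup>2 + 16 / c0 * (I0 x * W (u x)) + (16 + 16 * M) * (Ia x * (z x)\<^sup>2))"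
  have iH: "integrable ?L ?H" using iQ' iU' ia by simp
  \<comment> \<open>where the derivative of the ramp is nonzero, the potential is bounded below in the inner ball, and \<open>z\<^sup>2\<close> in the shell\<close>
  have Dpt: "AE x in ?L. (\<Sum>i\<in>Basis. \<bar>ramp' (g x) * G i x\<bar>) \<le> ?H x"
    using zb zz' pp' wg
  proof eventually_elim
    case (elim x)
    have H0: "0 \<le> \<eta> x * (norm (P x))\<^sup>2 + 16 / c0 * (I0 x * W (u x)) + (16 + 16 * M) * (Ia x * (z x)\<^sup>2)"
      using \<eta>01[of x] W0[of "u x"] c0 M0 by (intro add_nonneg_nonneg mult_nonneg_nonneg) (auto simp: I0_def Ia_def)
    show ?case
    proof (cases "g x \<le> 1/4 \<or> 3/4 \<le> g x")
      case True
      then have "ramp' (g x) = 0" by (rule ramp'_0)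
      then show ?thesis using H0 n0 K0 by simp
    next
      case False
      then have gr: "1/4 < g x" "g x < 3/4" by auto
      have nx: "\<not> r + 1 \<le> norm x" using gr \<eta>0[of x] by (auto simp: g_def)
      have "g x \<le> \<bar>z x\<bar>"
        using \<eta>01[of x] elim mult_left_le_one_le[of "\<bar>z x\<bar>" "\<eta> x"] abs_ge_self[of "\<eta> x * z x"]
        by (simp add: g_def abs_mult)
      then have zl: "1/4 \<le> \<bar>z x\<bar>" using gr by simp
      then have "(1/4)\<^sup>2 \<le> \<bar>z x\<bar>\<^sup>2" by (intro power_mono) auto
      then have z16: "1 \<le> 16 * (z x)\<^sup>2" by (simp add: power2_eq_square)
      have zabs: "\<bar>z x\<bar> \<le> 4 * (z x)\<^sup>2"
        using mult_right_mono[OF zl abs_ge_zero[of "z x"]] by (simp add: power2_eq_square)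
      define m where "m = (\<Sum>i\<in>Basis. pd i \<theta> x *\<^sub>R i)"
      have mb: "norm m \<le> 2 * M * Ia x"
        unfolding m_def \<theta>_def Ia_def by (rule cutoff_grad_bound[OF M r(1)])
      have trm: "\<bar>ramp' (g x) * G i x\<bar> \<le> Kr * (\<eta> x * (norm (P x))\<^sup>2 + 16 / c0 * (I0 x * W (u x)) + (16 + 16 * M) * (Ia x * (z x)\<^sup>2))"
        if i: "i \<in> Basis" for i
      proof -
        have "\<bar>p' i x\<bar> = \<bar>q i x\<bar>"
        proof -
          have "\<bar>s\<bar> = 1" using s by (auto simp: power2_eq_1_iff)
          then show ?thesis using elim(3) i by (simp add: p_def abs_mult)
        qed
        also have "\<dots> = \<bar>P x \<bullet> i\<bar>" using i unfolding elim(4) by (simp add: inner_sum_left inner_Basis if_distrib cong: if_cong)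
        also have "\<dots> \<le> norm (P x)" by (rule Basis_le_norm[OF i])
        also have "\<dots> \<le> (norm (P x))\<^sup>2 + 1"
        proof -
          have "0 \<le> (norm (P x) - 1)\<^sup>2 + norm (P x)" by simp
          then show ?thesis by (simp add: power2_diff)
        qed
        finally have pb: "\<bar>p' i x\<bar> \<le> (norm (P x))\<^sup>2 + 1" .
        have "\<bar>pd i \<theta> x\<bar> = \<bar>m \<bullet> i\<bar>" using i by (simp add: m_def inner_sum_left inner_Basis if_distrib cong: if_cong)
        also have "\<dots> \<le> norm m" by (rule Basis_le_norm[OF i])
        finally have "\<bar>pd i \<theta> x\<bar> \<le> 2 * M * Ia x" using mb by linarith
        then have "\<bar>pd i \<eta> x\<bar> \<le> 2 * 1 * (2 * M * Ia x)"
          unfolding pd\<eta> abs_mult using \<theta>01[of x] by (intro mult_mono) auto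
        then have pe: "\<bar>pd i \<eta> x\<bar> \<le> 4 * M * Ia x" by simp
        have "\<bar>G i x\<bar> \<le> \<bar>\<eta> x\<bar> * \<bar>p' i x\<bar> + \<bar>pd i \<eta> x\<bar> * \<bar>z' x\<bar>"
          unfolding G_def abs_mult[symmetric] by (rule abs_triangle_ineq)
        also have "\<dots> \<le> \<eta> x * ((norm (P x))\<^sup>2 + 1) + (4 * M * Ia x) * (4 * (z x)\<^sup>2)"
          using pb pe \<eta>01[of x] zabs elim(2) M0 by (intro add_mono mult_mono) (auto simp: Ia_def)
        also have "\<dots> = \<eta> x * (norm (P x))\<^sup>2 + \<eta> x + 16 * M * (Ia x * (z x)\<^sup>2)" by (simp add: algebra_simps)
        finally have Gb0: "\<bar>G i x\<bar> \<le> \<eta> x * (norm (P x))\<^sup>2 + \<eta> x + 16 * M * (Ia x * (z x)\<^sup>2)" .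
        have eb: "\<eta> x \<le> 16 / c0 * (I0 x * W (u x)) + 16 * (Ia x * (z x)\<^sup>2)"
        proof (cases "norm x < r")
          case True
          then have e: "\<eta> x = 1" "I0 x = 1" "Ia x = 0" using \<eta>r by (auto simp: I0_def Ia_def)
          then have "c0 * (z x)\<^sup>2 \<le> W (u x)" using gr elim by (intro low) (auto simp: g_def)
          then have "16 * (z x)\<^sup>2 \<le> 16 / c0 * W (u x)" using c0 by (simp add: field_simps)
          then show ?thesis using z16 e by simp
        next
          case False
          then have e: "I0 x = 0" "Ia x = 1" using nx by (auto simp: I0_def Ia_def)
          then show ?thesis using z16 \<eta>01[of x] by simp
        qed
        have "(16 + 16 * M) * (Ia x * (z x)\<^sup>2) = 16 * (Ia x * (z x)\<^sup>2) + 16 * M * (Ia x * (z x)\<^sup>2)"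
          by (simp add: distrib_right)
        then have Gb: "\<bar>G i x\<bar> \<le> \<eta> x * (norm (P x))\<^sup>2 + 16 / c0 * (I0 x * W (u x)) + (16 + 16 * M) * (Ia x * (z x)\<^sup>2)"
          using Gb0 eb by linarith
        show ?thesis unfolding abs_mult by (rule mult_mono[OF Kr Gb K0]) simp
      qed
      have "(\<Sum>i\<in>Basis. \<bar>ramp' (g x) * G i x\<bar>) \<le> (\<Sum>i\<in>(Basis::'a set). Kr * (\<eta> x * (norm (P x))\<^sup>2 + 16 / c0 * (I0 x * W (u x)) + (16 + 16 * M) * (Ia x * (z x)\<^sup>2)))"
        by (rule sum_mono) (rule trm)
      then show ?thesis by (simp add: n_def mult.assoc)
    qed
  qed
  have iD: "integrable ?L (\<lambda>x. \<Sum>i\<in>Basis. \<bar>ramp' (g x) * G i x\<bar>)"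
  proof (rule integrable_AE_dominated[OF iH borel_imp_lebesgue_on[OF Dm]])
    have "0 \<le> (\<Sum>i\<in>Basis. \<bar>ramp' (g x) * G i x\<bar>)" for x by (rule sum_nonneg) simp
    then show "AE x in ?L. \<bar>\<Sum>i\<in>Basis. \<bar>ramp' (g x) * G i x\<bar>\<bar> \<le> ?H x" using Dpt by simp
  qed
  have "?D = (LINT x|?L. (\<Sum>i\<in>Basis. \<bar>ramp' (g x) * G i x\<bar>))" by (rule onL(1)[OF Dm]) (simp add: g0 rg0)
  also have "\<dots> \<le> (LINT x|?L. ?H x)" by (rule integral_mono_AE[OF iD iH Dpt])
  also have "\<dots> = n * Kr * (?Q + 16 / c0 * ?U + (16 + 16 * M) * ?X)" using iQ' iU' ia by simp
  finally have eD: "?D \<le> n * Kr * (?Q + 16 / c0 * ?U + (16 + 16 * M) * ?X)" .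
  have "measure lborel (ball (0::'a) L) * ((?V - ?U / c0) / 4 - L * (n * Kr * (?Q + 16 / c0 * ?U + (16 + 16 * M) * ?X)))
      \<le> measure lborel (ball (0::'a) L) * (?A - L * ?D)"
    using eA eD L by (intro mult_left_mono diff_mono) auto
  also have "\<dots> \<le> ?B\<^sup>2" by (rule iso)
  also have "\<dots> \<le> (16 * ?V1)\<^sup>2" using eB B0 by (intro power_mono) auto
  finally show ?thesis
    by (simp add: n_def I0_def Ia_def I1_def P_def \<eta>_def \<theta>_def power2_eq_square)
qed

lemma power_Suc_increment:
  assumes "R \<ge> (1::real)"
  shows "(R + 1) ^ Suc k - R ^ Suc k \<le> real (Suc k) * 2 ^ k * R ^ k"
proof -
  have "1 + real (Suc k) * (- 1 / (R + 1)) \<le> (1 + (- 1 / (R + 1))) ^ Suc k"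
    by (rule Bernoulli_inequality) (use assms in \<open>simp add: field_simps\<close>)
  also have "1 + (- 1 / (R + 1)) = R / (R + 1)" using assms by (simp add: field_simps)
  finally have "(1 - real (Suc k) / (R + 1)) * (R + 1) ^ Suc k \<le> (R / (R + 1)) ^ Suc k * (R + 1) ^ Suc k"
    using assms by (intro mult_right_mono) auto
  also have "\<dots> = R ^ Suc k" using assms by (simp only: power_divide) simp
  also have "(1 - real (Suc k) / (R + 1)) * (R + 1) ^ Suc k = (R + 1) ^ Suc k - real (Suc k) * (R + 1) ^ k"
    using assms by (simp add: left_diff_distrib)
  finally have "(R + 1) ^ Suc k - R ^ Suc k \<le> real (Suc k) * (R + 1) ^ k" by simp
  also have "\<dots> \<le> real (Suc k) * (2 * R) ^ k" using assms by (intro mult_left_mono power_mono) auto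
  finally show ?thesis by (simp add: power_mult_distrib)
qed

text \<open>The arithmetic core. If the mass density stays at least \<open>\<alpha>\<close> at radius \<open>R\<close> and falls below \<open>\<alpha>\<close> at
  \<open>R + 1\<close>, then the shell carries mass of order \<open>\<alpha> R\<^sup>n / R\<close>, and hence so is the energy in the ball.
  Taking \<open>L = \<epsilon> R\<close> with a fixed small \<open>\<epsilon>\<close>, the variation term is absorbed by the mass of order
  \<open>\<alpha> R\<^sup>n\<close>, and what remains is \<open>\<epsilon>\<^sup>n \<alpha> R\<^sup>2\<^sup>n \<le> const \<alpha>\<^sup>2 R\<^sup>2\<^sup>n\<close>.\<close>

lemma mass_dichotomy:
  fixes \<omega> lam KE c0 CM nK :: real
  assumes \<omega>: "\<omega> > 0" and n: "n \<ge> (1::nat)" and pos: "lam > 0" "KE \<ge> 0" "c0 > 0" "CM \<ge> 0" "nK \<ge> 0"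
  obtains \<kappa> Rs where "\<kappa> > 0"
    "\<And>R \<alpha> \<gamma> V V1 U Q X. R \<ge> 1 \<Longrightarrow> R \<ge> Rs \<Longrightarrow> \<alpha> > 0 \<Longrightarrow> \<gamma> * (R + 1) \<le> \<alpha> \<Longrightarrow>
      \<alpha> * \<omega> * R ^ n \<le> V \<Longrightarrow> V1 < \<alpha> * \<omega> * (R + 1) ^ n \<Longrightarrow> X = V1 - V \<Longrightarrow>
      0 \<le> U \<Longrightarrow> 0 \<le> Q \<Longrightarrow> 0 \<le> V1 \<Longrightarrow>
      lam / 2 * Q + lam * U \<le> KE * X + 2 * \<gamma> * (\<omega> * (R + 1) ^ n) \<Longrightarrow>
      (\<And>L. L > 0 \<Longrightarrow> \<omega> * L ^ n * ((V - U / c0) / 4 - L * (nK * (Q + 16 / c0 * U + CM * X))) \<le> (16 * V1)\<^sup>2) \<Longrightarrow>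
      \<kappa> \<le> \<alpha>"
proof -
  obtain k where nk: "n = Suc k" using n by (cases n) auto
  define C2 where "C2 = \<omega> * real n * 2 ^ k"
  define C1 where "C1 = KE * C2 + 2 * \<omega> * 2 ^ k"
  define C3 where "C3 = nK * (2 * C1 / lam + 16 / c0 * (C1 / lam) + CM * C2) + 1"
  have C2: "C2 \<ge> 0" using \<omega> by (simp add: C2_def)
  have C1: "C1 > 0" using \<omega> pos C2 by (simp add: C1_def add_nonneg_pos)
  have C3: "C3 > 0" using pos C1 C2 by (simp add: C3_def add_nonneg_pos)
  \<comment> \<open>chosen so that the variation term costs half of the guaranteed mass \<open>\<omega> \<alpha> R\<^sup>n / 8\<close>\<close>
  define \<epsilon> where "\<epsilon> = \<omega> / (16 * C3)"
  have \<epsilon>: "\<epsilon> > 0" using \<omega> C3 by (simp add: \<epsilon>_def)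
  show ?thesis
  proof (rule that[of "\<epsilon> ^ n / (16 * 256 * 4 ^ n)" "2 * C1 / (lam * c0 * \<omega>)"])
    show "\<epsilon> ^ n / (16 * 256 * 4 ^ n) > 0" using \<epsilon> by simp
    fix R \<alpha> \<gamma> V V1 U Q X :: real
    assume R: "R \<ge> 1" "2 * C1 / (lam * c0 * \<omega>) \<le> R" and \<alpha>: "\<alpha> > 0" and \<gamma>: "\<gamma> * (R + 1) \<le> \<alpha>"
      and V: "\<alpha> * \<omega> * R ^ n \<le> V" and V1: "V1 < \<alpha> * \<omega> * (R + 1) ^ n" and X: "X = V1 - V"
      and nn: "0 \<le> U" "0 \<le> Q" "0 \<le> V1"
      and en: "lam / 2 * Q + lam * U \<le> KE * X + 2 * \<gamma> * (\<omega> * (R + 1) ^ n)"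
      and iso: "\<And>L. L > 0 \<Longrightarrow> \<omega> * L ^ n * ((V - U / c0) / 4 - L * (nK * (Q + 16 / c0 * U + CM * X))) \<le> (16 * V1)\<^sup>2"
    define Y where "Y = \<alpha> * R ^ k"
    have Y: "Y > 0" using \<alpha> R by (simp add: Y_def)
    have RY: "\<alpha> * R ^ n = R * Y" by (simp add: nk Y_def)
    have "X \<le> \<alpha> * \<omega> * ((R + 1) ^ n - R ^ n)" using X V V1 by (simp add: right_diff_distrib)
    also have "\<dots> \<le> \<alpha> * \<omega> * (real n * 2 ^ k * R ^ k)"
      using power_Suc_increment[OF R(1), of k] \<alpha> \<omega> unfolding nk by (intro mult_left_mono) auto
    finally have XY: "X \<le> C2 * Y" by (simp add: C2_def Y_def mult_ac)
    have "\<gamma> * (\<omega> * (R + 1) ^ n) = \<omega> * (R + 1) ^ k * (\<gamma> * (R + 1))" by (simp add: nk)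
    also have "\<dots> \<le> \<omega> * (R + 1) ^ k * \<alpha>" using \<gamma> \<omega> R by (intro mult_left_mono) auto
    also have "\<dots> \<le> \<omega> * (2 * R) ^ k * \<alpha>" using \<alpha> \<omega> R by (intro mult_right_mono mult_left_mono power_mono) auto
    finally have "\<gamma> * (\<omega> * (R + 1) ^ n) \<le> \<omega> * 2 ^ k * Y" by (simp add: Y_def power_mult_distrib mult_ac)
    moreover have "KE * X \<le> KE * (C2 * Y)" using XY pos by (intro mult_left_mono) auto
    ultimately have en': "lam / 2 * Q + lam * U \<le> C1 * Y" using en by (simp add: C1_def algebra_simps)
    have "lam / 2 * Q \<ge> 0" "lam * U \<ge> 0" using pos nn by auto
    then have QY: "Q \<le> 2 * C1 / lam * Y" and UY: "U \<le> C1 / lam * Y"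
      using en' pos by (simp_all add: field_simps)
    have x: "U / c0 \<le> \<omega> * (R * Y) / 2"
    proof -
      have "U / c0 \<le> C1 / lam * Y / c0" using UY pos by (intro divide_right_mono) auto
      also have "\<dots> = C1 / lam / c0 * Y" by simp
      also have "\<dots> \<le> \<omega> * R / 2 * Y"
      proof (rule mult_right_mono)
        show "C1 / lam / c0 \<le> \<omega> * R / 2" using R(2) pos \<omega> by (simp add: field_simps)
      qed (use Y in simp)
      also have "\<dots> = \<omega> * (R * Y) / 2" by simp
      finally show ?thesis .
    qed
    have w: "\<omega> * (R * Y) \<le> V" using V by (simp add: RY[symmetric] mult_ac)
    have "w / 8 \<le> (v - x) / 4" if "x \<le> w / 2" "w \<le> v" for v w x :: real using that by simp
    from this[OF x w] have VU: "\<omega> * (R * Y) / 8 \<le> (V - U / c0) / 4" .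
    have "nK * (Q + 16 / c0 * U + CM * X) \<le> nK * (2 * C1 / lam * Y + 16 / c0 * (C1 / lam * Y) + CM * (C2 * Y))"
      using QY UY XY pos by (intro mult_left_mono add_mono) auto
    also have "\<dots> = (C3 - 1) * Y" by (simp add: C3_def algebra_simps)
    also have "\<dots> \<le> C3 * Y" using Y by simp
    finally have DY: "nK * (Q + 16 / c0 * U + CM * X) \<le> C3 * Y" .
    have L: "\<epsilon> * R > 0" using \<epsilon> R by simp
    have "\<omega> * (R * Y) / 16 = \<omega> * (R * Y) / 8 - \<epsilon> * R * (C3 * Y)"
      using C3 by (simp add: \<epsilon>_def field_simps)
    also have "\<dots> \<le> (V - U / c0) / 4 - \<epsilon> * R * (nK * (Q + 16 / c0 * U + CM * X))"
      using VU DY L by (intro diff_mono mult_left_mono) auto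
    finally have "\<omega> * (\<epsilon> * R) ^ n * (\<omega> * (R * Y) / 16)
        \<le> \<omega> * (\<epsilon> * R) ^ n * ((V - U / c0) / 4 - \<epsilon> * R * (nK * (Q + 16 / c0 * U + CM * X)))"
      using \<omega> L by (intro mult_left_mono) auto
    also have "\<dots> \<le> (16 * V1)\<^sup>2" by (rule iso[OF L])
    also have "\<dots> \<le> (16 * (\<alpha> * \<omega> * (2 * R) ^ n))\<^sup>2"
    proof -
      have "\<alpha> * \<omega> * (R + 1) ^ n \<le> \<alpha> * \<omega> * (2 * R) ^ n" using \<alpha> \<omega> R by (intro mult_left_mono power_mono) auto
      then show ?thesis using V1 nn by (intro power_mono) auto
    qed
    also have "\<dots> = 256 * 4 ^ n * \<alpha> * (\<omega>\<^sup>2 * \<alpha> * (R ^ n)\<^sup>2)"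
    proof -
      have "(4::real) ^ n = (2 ^ n)\<^sup>2" by (simp add: power2_eq_square flip: power_mult_distrib)
      then show ?thesis by (simp add: power_mult_distrib power2_eq_square mult_ac)
    qed
    also have "\<omega> * (\<epsilon> * R) ^ n * (\<omega> * (R * Y) / 16) = \<epsilon> ^ n / 16 * (\<omega>\<^sup>2 * \<alpha> * (R ^ n)\<^sup>2)"
      unfolding RY[symmetric] by (simp add: power_mult_distrib power2_eq_square)
    finally have "\<epsilon> ^ n / 16 \<le> 256 * 4 ^ n * \<alpha>"
      using \<omega> \<alpha> R by (subst (asm) mult_le_cancel_right_pos) auto
    then show "\<epsilon> ^ n / (16 * 256 * 4 ^ n) \<le> \<alpha>" by (simp add: field_simps)
  qed
qed

lemma ball_average_eq:
  fixes h :: "real^'n \<Rightarrow> real"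
  assumes "R > 0" "R < \<rho>"
  shows "ball_average R h = (LINT x|lebesgue_on (ball 0 \<rho>). indicator (ball 0 R) x * h x)
    / (measure lborel (ball (0::real^'n) 1) * R ^ CARD('n))"
proof -
  have "(LINT x|lebesgue_on (ball 0 \<rho>). indicator (ball 0 R) x * h x)
      = (LINT x|lebesgue_on (ball 0 \<rho>). (if x \<in> ball 0 R then h x else 0))"
    by (rule Bochner_Integration.integral_cong) (auto simp: indicator_def)
  also have "\<dots> = (LINT x|lebesgue_on (ball 0 R). h x)"
    by (rule Lebesgue_Measure.integral_restrict) (use assms in auto)
  finally show ?thesis
    using content_ball_conv_unit_ball[of R "0::real^'n"] assms
    by (simp add: ball_average_def mult.commute)
qed

theorem theoremA1:
  fixes f :: "real \<Rightarrow> real" and \<beta> A lam :: real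
  assumes "CARD('n::finite) \<ge> 2"
    and "0 < \<beta>" "\<beta> \<le> 1" "C1_holder_loc \<beta> f"
    and "f 0 = 0" "f 1 = 0" "deriv f 0 < 0" "deriv f 1 < 0"
    and "potential f 0 = 0" "potential f 1 = 0"
    and "\<And>t. t \<noteq> 0 \<Longrightarrow> t \<noteq> 1 \<Longrightarrow> potential f t > 0"
    and "Liminf at_infinity (\<lambda>t. ereal (potential f t)) > 0"
    and "lam > 0"
  shows "\<exists>r0::nat. r0 \<ge> 1 \<and>
    (\<forall>(\<rho>::real) (a :: real^'n \<Rightarrow> real^'n^'n) b G u (\<alpha>::real) (R0::nat).
       \<rho> > 2 \<longrightarrow>
       a \<in> W1inf (ball 0 \<rho>) \<longrightarrow>
       W1inf_norm (ball 0 \<rho>) a = ereal A \<longrightarrow>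
       (\<forall>x\<in>ball 0 \<rho>. transpose (a x) = a x) \<longrightarrow>
       b \<in> Linf (lebesgue_on (ball 0 \<rho>)) \<longrightarrow>
       caratheodory (ball 0 \<rho>) G \<longrightarrow>
       (\<forall>x\<in>ball 0 \<rho>. lam \<le> b x \<and> b x \<le> inverse lam) \<longrightarrow>
       (\<forall>x\<in>ball 0 \<rho>. \<forall>\<xi>. lam * (norm \<xi>)\<^sup>2 \<le> (a x *v \<xi>) \<bullet> \<xi> \<and>
                           (a x *v \<xi>) \<bullet> \<xi> \<le> inverse lam * (norm \<xi>)\<^sup>2) \<longrightarrow>
       is_minimizer (ball 0 \<rho>) a b (potential f) G u \<longrightarrow>
       Linf_norm (lebesgue_on (ball 0 \<rho>)) (\<lambda>x. u x - 1/2) \<le> 1 \<longrightarrow>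
       0 < \<alpha> \<longrightarrow> \<alpha> < real r0 powi (1 - int CARD('n)) \<longrightarrow>
       r0 + 1 \<le> R0 \<longrightarrow> real R0 < \<rho> \<longrightarrow>
       Linf_norm (lebesgue_on (ball 0 \<rho> \<times> {-1/2<..<3/2})) (\<lambda>(x, t). G x t)
         \<le> ereal (\<alpha> * inverse (real R0)) \<longrightarrow>
       (\<forall>R::nat. r0 \<le> R \<and> R \<le> R0 \<longrightarrow>
          (ball_average (real r0) (\<lambda>x. (u x)\<^sup>2) \<ge> \<alpha> \<longrightarrow>
             ball_average (real R) (\<lambda>x. (u x)\<^sup>2) \<ge> \<alpha>) \<and>
          (ball_average (real r0) (\<lambda>x. (1 - u x)\<^sup>2) \<ge> \<alpha> \<longrightarrow>
             ball_average (real R) (\<lambda>x. (1 - u x)\<^sup>2) \<ge> \<alpha>)))"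
proof -
  let ?B = "\<lambda>r::real. ball (0::real^'n) r"
  define W where "W = potential f"
  have fd: "f differentiable_on UNIV" using assms(4) by (simp add: C1_holder_loc_def)
  have fc: "continuous_on UNIV f" using fd by (rule differentiable_imp_continuous_on)
  have fD: "(f has_real_derivative deriv f t) (at t)" for t
    using fd by (simp add: differentiable_on_def DERIV_deriv_iff_real_differentiable)
  have WD: "(W has_real_derivative - f t) (at t)" for t unfolding W_def by (rule potential_deriv[OF fc])
  have Wc: "continuous_on UNIV W" using WD DERIV_isCont by (intro continuous_at_imp_continuous_on) blast
  have Wz: "W 0 = 0" "W 1 = 0" and Wpos: "\<And>t. t \<noteq> 0 \<Longrightarrow> t \<noteq> 1 \<Longrightarrow> W t > 0"
    using assms(9,10,11) by (auto simp: W_def)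
  have Wnn: "W t \<ge> 0" for t using Wz Wpos[of t] by (cases "t = 0 \<or> t = 1") auto
  obtain c0 C0 where q0: "c0 > 0" "C0 > 0" "\<And>t. -1/2 \<le> t \<Longrightarrow> t \<le> 3/2 \<Longrightarrow> W t \<le> C0 * t\<^sup>2"
    "\<And>t. -1/2 \<le> t \<Longrightarrow> t \<le> 3/4 \<Longrightarrow> c0 * t\<^sup>2 \<le> W t"
  proof (rule quadratic_well[OF WD])
    show "((\<lambda>t. - f t) has_real_derivative - deriv f 0) (at 0)" by (rule DERIV_minus[OF fD])
  qed (use assms(5,7) Wz Wpos in auto)
  obtain c1 C1 where q1: "c1 > 0" "C1 > 0" "\<And>t. -1/2 \<le> t \<Longrightarrow> t \<le> 3/2 \<Longrightarrow> W (1 - t) \<le> C1 * t\<^sup>2"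
    "\<And>t. -1/2 \<le> t \<Longrightarrow> t \<le> 3/4 \<Longrightarrow> c1 * t\<^sup>2 \<le> W (1 - t)"
  proof (rule quadratic_well[of "\<lambda>t. W (1 - t)" "\<lambda>t. f (1 - t)"])
    show "((\<lambda>t. W (1 - t)) has_real_derivative f (1 - t)) (at t)" for t
      by (rule DERIV_cong[OF DERIV_chain2[OF WD]]) (auto intro!: derivative_eq_intros)
    show "((\<lambda>t. f (1 - t)) has_real_derivative - deriv f 1) (at 0)"
      by (rule DERIV_cong[OF DERIV_chain2[OF fD]]) (auto intro!: derivative_eq_intros)
    show "0 < W (1 - t)" if "t \<noteq> 0" "t \<noteq> 1" for t by (rule Wpos) (use that in auto)
  qed (use assms(6,8) Wz in auto)
  define cl where "cl = min c0 c1"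
  define C where "C = max C0 C1"
  have cl: "cl > 0" "cl \<le> c0" "cl \<le> c1" and C: "C > 0" "C0 \<le> C" "C1 \<le> C"
    using q0(1,2) q1(1,2) by (auto simp: cl_def C_def)
  obtain M where M: "M > 0" "\<And>t. \<bar>deriv step t\<bar> \<le> M" by (rule deriv_step_bounds) blast
  obtain Kr where Kr: "Kr > 0" "\<And>t. \<bar>ramp' t\<bar> \<le> Kr" by (rule ramp_bounds) blast
  define \<omega> where "\<omega> = measure lborel (?B 1)"
  have \<omega>: "\<omega> > 0" unfolding \<omega>_def by (rule content_ball_pos) simp
  have vol: "measure lborel (?B R) = \<omega> * R ^ CARD('n)" if "R > 0" for R
    using content_ball_conv_unit_ball[of R "0::real^'n"] that by (simp add: \<omega>_def mult.commute)
  let ?KE = "32 * inverse lam * M\<^sup>2 + inverse lam * C"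
  obtain \<kappa> Rs where \<kappa>: "\<kappa> > 0" and dich:
    "\<And>R \<alpha> \<gamma> V V1 U Q X. R \<ge> 1 \<Longrightarrow> R \<ge> Rs \<Longrightarrow> \<alpha> > 0 \<Longrightarrow> \<gamma> * (R + 1) \<le> \<alpha> \<Longrightarrow>
      \<alpha> * \<omega> * R ^ CARD('n) \<le> V \<Longrightarrow> V1 < \<alpha> * \<omega> * (R + 1) ^ CARD('n) \<Longrightarrow> X = V1 - V \<Longrightarrow>
      0 \<le> U \<Longrightarrow> 0 \<le> Q \<Longrightarrow> 0 \<le> V1 \<Longrightarrow>
      lam / 2 * Q + lam * U \<le> ?KE * X + 2 * \<gamma> * (\<omega> * (R + 1) ^ CARD('n)) \<Longrightarrow>
      (\<And>L. L > 0 \<Longrightarrow> \<omega> * L ^ CARD('n) * ((V - U / cl) / 4 - L * (real DIM(real^'n) * Kr * (Q + 16 / cl * U + (16 + 16 * M) * X))) \<le> (16 * V1)\<^sup>2) \<Longrightarrow>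
      \<kappa> \<le> \<alpha>"
    by (rule mass_dichotomy[OF \<omega>, of "CARD('n)" lam ?KE cl "16 + 16 * M" "real DIM(real^'n) * Kr"])
      (use assms(1,13) cl C M Kr in auto)
  define rt where "rt = max 1 (max Rs (1 / \<kappa>))"
  have rt: "rt \<ge> 1" "rt \<ge> Rs" "rt \<ge> 1 / \<kappa>" by (simp_all add: rt_def)
  define r0 where "r0 = nat \<lceil>rt\<rceil>"
  have r0: "real r0 \<ge> 1" "real r0 \<ge> Rs" "real r0 \<ge> 1 / \<kappa>"
    using rt order_trans[OF _ real_nat_ceiling_ge[of rt, folded r0_def]] by blast+
  show ?thesis
  proof (rule exI[of _ r0], intro conjI allI impI)
    show "1 \<le> r0" using r0(1) by simp
  next
    fix \<rho> \<alpha> :: real and a :: "real^'n \<Rightarrow> real^'n^'n" and b :: "real^'n \<Rightarrow> real"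
      and G :: "real^'n \<Rightarrow> real \<Rightarrow> real" and u :: "real^'n \<Rightarrow> real" and R0 R :: nat
    assume a: "a \<in> W1inf (ball 0 \<rho>)" and sym: "\<forall>x\<in>ball 0 \<rho>. transpose (a x) = a x"
      and b: "b \<in> Linf (lebesgue_on (ball 0 \<rho>))" and car: "caratheodory (ball 0 \<rho>) G"
      and bb: "\<forall>x\<in>ball 0 \<rho>. lam \<le> b x \<and> b x \<le> inverse lam"
      and ell: "\<forall>x\<in>ball 0 \<rho>. \<forall>\<xi>. lam * (norm \<xi>)\<^sup>2 \<le> (a x *v \<xi>) \<bullet> \<xi> \<and> (a x *v \<xi>) \<bullet> \<xi> \<le> inverse lam * (norm \<xi>)\<^sup>2"
      and min: "is_minimizer (ball 0 \<rho>) a b (potential f) G u"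
      and ule: "Linf_norm (lebesgue_on (ball 0 \<rho>)) (\<lambda>x. u x - 1 / 2) \<le> 1"
      and \<alpha>: "0 < \<alpha>" and \<alpha>r0: "\<alpha> < real r0 powi (1 - int CARD('n))"
      and R0: "r0 + 1 \<le> R0" "real R0 < \<rho>"
      and Gle: "Linf_norm (lebesgue_on (ball 0 \<rho> \<times> {- 1 / 2<..<3 / 2})) (\<lambda>(x, t). G x t) \<le> ereal (\<alpha> * inverse (real R0))"
      and RR: "r0 \<le> R \<and> R \<le> R0"
    let ?S = "?B \<rho>"
    let ?L = "lebesgue_on ?S"
    define \<gamma> where "\<gamma> = \<alpha> * inverse (real R0)"
    have \<alpha>\<kappa>: "\<alpha> < \<kappa>"
    proof -
      have "real r0 powi (1 - int CARD('n)) = inverse (real r0 ^ (CARD('n) - 1))"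
      proof -
        have "nat (int CARD('n) - 1) = CARD('n) - 1" by simp
        then show ?thesis using assms(1) by (simp add: power_int_def power_inverse)
      qed
      also have "\<dots> \<le> inverse (real r0 ^ 1)"
        using r0(1) assms(1) by (intro le_imp_inverse_le power_increasing) auto
      also have "\<dots> \<le> \<kappa>" using r0(1,3) \<kappa> by (simp add: field_simps)
      finally show ?thesis using \<alpha>r0 by linarith
    qed
    have am: "a \<in> borel_measurable ?L" using a by (simp add: W1inf_def Linf_def)
    have bm: "b \<in> borel_measurable ?L" using b by (simp add: Linf_def)
    have Gb: "AE x in ?L. \<forall>t\<in>{-1/2..3/2}. \<bar>G x t\<bar> \<le> \<gamma>"
      unfolding \<gamma>_def by (rule caratheodory_bound[OF car Gle])
    have ub: "AE x in ?L. \<bar>u x - 1/2\<bar> \<le> 1"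
    proof -
      have "AE x in ?L. ereal (norm (u x - 1/2)) \<le> esssup ?L (\<lambda>x. ereal (norm (u x - 1/2)))"
        by (rule esssup_AE)
      then show ?thesis
      proof (rule eventually_mono)
        fix x assume "ereal (norm (u x - 1/2)) \<le> esssup ?L (\<lambda>x. ereal (norm (u x - 1/2)))"
        then have "ereal (norm (u x - 1/2)) \<le> 1" by (rule order_trans[OF _ ule[unfolded Linf_norm_def]])
        then show "\<bar>u x - 1/2\<bar> \<le> 1" by simp
      qed
    qed
    have min': "is_minimizer ?S a b W G u" using min by (simp add: W_def)
    have uH1: "u \<in> H1 ?S" using min by (simp add: is_minimizer_def energy_domain_def)
    \<comment> \<open>the wells \<open>0\<close> and \<open>1\<close> are treated together: \<open>z = u\<close> for \<open>(c, s) = (0, 1)\<close>, and \<open>z = 1 - u\<close> for \<open>(c, s) = (1, -1)\<close>\<close>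
    have persist: "ball_average (real R) (\<lambda>x. (s * (u x - c))\<^sup>2) \<ge> \<alpha>"
      if cs: "(c = 0 \<and> s = 1) \<or> (c = 1 \<and> s = -1)"
        and start: "ball_average (real r0) (\<lambda>x. (s * (u x - c))\<^sup>2) \<ge> \<alpha>" for c s :: real
    proof -
      define z where "z x = s * (u x - c)" for x
      define V where "V r = (LINT x|?L. indicator (?B r) x * (z x)\<^sup>2)" for r
      have avg: "ball_average (real R) (\<lambda>x. (z x)\<^sup>2) \<ge> \<alpha> \<longleftrightarrow> \<alpha> * \<omega> * real R ^ CARD('n) \<le> V (real R)"
        if "r0 \<le> R" "R \<le> R0" for R :: nat
      proof -
        have R: "real R > 0" "real R < \<rho>" using that r0(1) R0 by linarith+
        then show ?thesis
          unfolding ball_average_eq[OF R] \<omega>_def[symmetric] V_def[symmetric] using \<omega> by (simp add: field_simps)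
      qed
      have zb: "AE x in ?L. \<bar>z x\<bar> \<le> 3/2 \<and> -1/2 \<le> z x"
        using ub by (rule eventually_mono) (use cs in \<open>auto simp: z_def abs_if split: if_splits\<close>)
      have z2eq: "(z x)\<^sup>2 = (u x - c)\<^sup>2" for x using cs by (auto simp: z_def power2_commute)
      have WC: "W t \<le> C * (t - c)\<^sup>2" if "-1/2 \<le> t" "t \<le> 3/2" for t
      proof -
        have "W t \<le> C0 * t\<^sup>2" using q0(3) that by simp
        moreover have "W t \<le> C1 * (t - 1)\<^sup>2" using q1(3)[of "1 - t"] that by (simp add: power2_commute)
        moreover have "C0 * t\<^sup>2 \<le> C * t\<^sup>2" "C1 * (t - 1)\<^sup>2 \<le> C * (t - 1)\<^sup>2"
          using C by (auto intro: mult_right_mono)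
        ultimately show ?thesis using cs by auto
      qed
      have Wlow: "cl * t\<^sup>2 \<le> W (c + s * t)" if "-1/2 \<le> t" "t \<le> 3/4" for t
      proof -
        have "cl * t\<^sup>2 \<le> c0 * t\<^sup>2" "cl * t\<^sup>2 \<le> c1 * t\<^sup>2" using cl by (auto intro: mult_right_mono)
        then show ?thesis using q0(4)[OF that] q1(4)[OF that] cs by auto
      qed
      have z2: "integrable ?L (\<lambda>x. (z x)\<^sup>2)"
      proof -
        interpret fm: finite_measure ?L by (rule finite_measure_lebesgue_on) simp
        show ?thesis
          using square_integrable_add[of ?L u "\<lambda>x. - c"] uH1 by (simp add: z2eq H1_def L2_def)
      qed
      have iz: "integrable ?L (\<lambda>x. indicator A x * (z x)\<^sup>2)" if "A \<in> sets borel" for A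
        by (rule integrable_bounded_mult[OF z2 borel_imp_lebesgue_on[OF borel_measurable_indicator[OF that]], of 1])
          (simp add: indicator_def)
      have grow: "\<alpha> * \<omega> * real (Suc k) ^ CARD('n) \<le> V (real (Suc k))"
        if k: "r0 \<le> k" "Suc k \<le> R0" and IH: "\<alpha> * \<omega> * real k ^ CARD('n) \<le> V (real k)" for k
      proof (rule ccontr)
        assume "\<not> ?thesis"
        then have lt: "V (real k + 1) < \<alpha> * \<omega> * (real k + 1) ^ CARD('n)" by (simp add: add.commute)
        have k1: "0 \<le> real k" "real k + 1 < \<rho>" "real k \<ge> 1" "real k \<ge> Rs" using k r0 R0 by linarith+
        note en = energy_comparison[OF assms(13) k1(1,2) am _ _ bm _ car Gb Wc Wnn _ WC _ _ _ min' ub M(2)]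
        let ?Q = "LINT x|?L. (cutoff (real k) (real k + 1) x)\<^sup>2 * (norm (weak_grad ?S u x))\<^sup>2"
        let ?U = "LINT x|?L. indicator (?B (real k)) x * W (u x)"
        let ?X = "LINT x|?L. indicator (?B (real k + 1) - ?B (real k)) x * (z x)\<^sup>2"
        have e1: "lam / 2 * ?Q + lam * ?U \<le> ?KE * ?X + 2 * \<gamma> * measure lebesgue (?B (real k + 1))"
          and e2: "integrable ?L (\<lambda>x. (cutoff (real k) (real k + 1) x)\<^sup>2 * (norm (weak_grad ?S u x))\<^sup>2)"
          and e3: "integrable ?L (\<lambda>x. indicator (?B (real k)) x * W (u x))"
          unfolding z2eq by (rule en; use sym ell bb Wz cs C in force)+
        have X: "?X = V (real k + 1) - V (real k)"
        proof -
          have "?X = (LINT x|?L. indicator (?B (real k + 1)) x * (z x)\<^sup>2 - indicator (?B (real k)) x * (z x)\<^sup>2)"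
            by (rule Bochner_Integration.integral_cong) (auto simp: indicator_def)
          then show ?thesis unfolding V_def using iz by simp
        qed
        have "\<kappa> \<le> \<alpha>"
        proof (rule dich[OF k1(3,4) \<alpha> _ IH lt X])
          show "\<gamma> * (real k + 1) \<le> \<alpha>"
          proof -
            have "real k + 1 \<le> real R0" using k by linarith
            then have "\<gamma> * (real k + 1) \<le> \<gamma> * real R0" using \<alpha> by (intro mult_left_mono) (auto simp: \<gamma>_def)
            also have "\<dots> = \<alpha>" using k by (simp add: \<gamma>_def)
            finally show ?thesis .
          qed
          show "0 \<le> ?U" "0 \<le> ?Q" "0 \<le> V (real k + 1)"
            unfolding V_def by (rule integral_nonneg_AE, simp add: Wnn)+
          show "lam / 2 * ?Q + lam * ?U \<le> ?KE * ?X + 2 * \<gamma> * (\<omega> * (real k + 1) ^ CARD('n))"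
            using e1 vol[of "real k + 1"] by simp
          fix L :: real assume L: "L > 0"
          show "\<omega> * L ^ CARD('n) * ((V (real k) - ?U / cl) / 4 - L * (real DIM(real^'n) * Kr * (?Q + 16 / cl * ?U + (16 + 16 * M) * ?X)))
              \<le> (16 * V (real k + 1))\<^sup>2"
            unfolding vol[OF L, symmetric] V_def z_def
            by (rule mass_spread_estimate[OF k1(1,2) uH1 zb[unfolded z_def] _ Wnn cl(1) Wlow M(2) Kr(2) e2 e3 L])
              (use cs in auto)
        qed
        then show False using \<alpha>\<kappa> by simp
      qed
      have "\<alpha> * \<omega> * real R ^ CARD('n) \<le> V (real R)"
        using conjunct1[OF RR] conjunct2[OF RR]
      proof (induction R rule: dec_induct)
        case base
        then show ?case using start avg[of r0] R0 by (simp add: z_def)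
      next
        case (step k)
        then show ?case by (intro grow) auto
      qed
      then show ?thesis using avg[of R] RR by (simp add: z_def)
    qed
    show "ball_average (real r0) (\<lambda>x. (u x)\<^sup>2) \<ge> \<alpha> \<Longrightarrow> ball_average (real R) (\<lambda>x. (u x)\<^sup>2) \<ge> \<alpha>"
      using persist[of 0 1] by simp
    show "ball_average (real r0) (\<lambda>x. (1 - u x)\<^sup>2) \<ge> \<alpha> \<Longrightarrow> ball_average (real R) (\<lambda>x. (1 - u x)\<^sup>2) \<ge> \<alpha>"
      using persist[of 1 "-1"] by simp
  qed
qed

end
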